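(* Let $\gamma:\Gamma\to\Delta$ be an epimorphism from a thick locally finite generalized octagon $\Gamma$ of order $(s,t)$ with $t$ finite, to a thin generalized octagon $\Delta$ of order $(s',1)$. Then $s'=1$ (so $\Delta$ is an ordinary octagon), and exactly two classes of such epimorphisms occur: those of class (a) and those of class (b), as defined in the context.
   Context: A point-line geometry $\Gamma=(\mathcal{P},\mathcal{L},\mathbf{I})$ consists of disjoint sets $\mathcal P$ (points) and $\mathcal L$ (lines) with a symmetric incidence relation $\mathbf{I}$ between points and lines. An ordinary $k$-gon is the geometry of $k$ points and $k$ lines whose incidence graph is a cycle of length $2k$ (for $k=2$: two points and two lines, all incident). For $m\ge 3$, $\Gamma$ is a weak generalized $m$-gon if any two elements of $\mathcal{P}\cup\mathcal{L}$ are contained in at least one ordinary sub $m$-gon (as a subgeometry of $\Gamma$), and $\Gamma$ contains no ordinary sub $k$-gons with $2\le k<m$. It is thick (and is then called a thick generalized $m$-gon) if every point is incident with at least three lines and every line with at least three points; otherwise it is thin. It has order $(u,v)$ (possibly infinite cardinals) if each line is incident with exactly $u+1$ points and each point is incident with exactly $v+1$ lines; a thin generalized $m$-gon of order $(u,1)$ is a weak generalized $m$-gon having order $(u,1)$, $u\geq 1$. Octagon means $8$-gon. A thick generalized $n$-gon of order $(s,t)$ is locally finite if exactly one of $s,t$ is finite. A morphism between weak generalized polygons is a map sending points to points and lines to lines and preserving incidence; an epimorphism is a morphism that is surjective on the point set and on the line set. Two distinct points $x,y$ are collinear, $x\sim y$, if they are incident with a common line, denoted $xy$. The point-line dual of a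 geometry is obtained by interchanging the roles of points and lines. Let $\Phi$ be an epimorphism from a thick generalized octagon $\mathcal{S}$ of order $(s,t)$ onto an ordinary octagon $\mathcal{G}$. Class (a): the points of $\mathcal{G}$ can be labelled $\overline{a},\overline{b},\overline{c},\overline{d},\overline{e},\overline{f},\overline{g},\overline{h}$ with $\overline{a}\sim\overline{b}\sim\overline{c}\sim\overline{d}\sim\overline{e}\sim\overline{f}\sim\overline{g}\sim\overline{h}\sim\overline{a}$ such that, writing $\widetilde{X}=\Phi^{-1}(\overline{x})$ for each such point (so $\widetilde A=\Phi^{-1}(\overline a)$, etc.), there is a line $L$ of $\mathcal{S}$ for which: $(\widetilde{C},\widetilde{B})$ is a partition of the set of all points incident with $L$, with $1\le|\widetilde{C}|\le s$ and $1\le|\widetilde{B}|\le s$; $\widetilde{D}$ consists of the points not incident with $L$ but collinear with a point of $\widetilde{C}$; $\widetilde{A}$ consists of the points not incident with $L$ but collinear with a point of $\widetilde{B}$; $\widetilde{E}$ consists of the points not in $\widetilde{C}\cup\widetilde{D}$ but collinear with a point of $\widetilde{D}$; $\widetilde{H}$ consists of the points not in $\widetilde{A}\cup\widetilde{B}$ but collinear with a point of $\widetilde{A}$; $\widetilde{F}$ consists of the points not in $\widetilde{D}\cup\widetilde{E}$ but collinear with a point of $\widetilde{E}$; $\widetilde{G}$ consists of the points not in $\widetilde{A}\cup\widetilde{H}$ but collinear with a point of $\widetilde{H}$; $\Phi^{-1}(\overline{c}\,\overline{b})=\{L\}$; $\Phi^{-1}(\overline{c}\,\overline{d})$ is the set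 of all lines distinct from $L$ but incident with a point of $\widetilde{C}$; $\Phi^{-1}(\overline{a}\,\overline{b})$ is the set of all lines distinct from $L$ but incident with a point of $\widetilde{B}$; $\Phi^{-1}(\overline{d}\,\overline{e})$ is the set of all lines not in $\Phi^{-1}(\overline{d}\,\overline{c})$ but incident with a point of $\widetilde{D}$; $\Phi^{-1}(\overline{a}\,\overline{h})$ is the set of all lines not in $\Phi^{-1}(\overline{a}\,\overline{b})$ but incident with a point of $\widetilde{A}$; $\Phi^{-1}(\overline{e}\,\overline{f})$ is the set of all lines not in $\Phi^{-1}(\overline{d}\,\overline{e})$ but incident with a point of $\widetilde{E}$; $\Phi^{-1}(\overline{g}\,\overline{h})$ is the set of all lines not in $\Phi^{-1}(\overline{a}\,\overline{h})$ but incident with a point of $\widetilde{H}$; and $\Phi^{-1}(\overline{g}\,\overline{f})$ is the set of all lines not in $\Phi^{-1}(\overline{h}\,\overline{g})$ but incident with a point of $\widetilde{G}$ (that is, the set of all lines not in $\Phi^{-1}(\overline{e}\,\overline{f})$ but incident with a point of $\widetilde{F}$). Class (b) (the dual of (a)): $\Phi$, regarded as an epimorphism from the point-line dual of $\mathcal{S}$ (of order $(t,s)$) onto the point-line dual of $\mathcal{G}$ (again an ordinary octagon), is of class (a). "Exactly two classes occur" means that each epimorphism belongs to class (a) or class (b), and both classes occur. *)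

theory Defs
  imports Main
begin

unbundle cardinal_syntax

text \<open>
  Points and lines live in separate types, so that the two sets are disjoint. Orders may be
  infinite, so they are cardinals in the sense of \<^const>\<open>Card_order\<close>; the cardinal one
  is \<^const>\<open>cone\<close>.
\<close>

record ('p, 'l) geometry =
  points :: "'p set"
  lines :: "'l set"
  inc :: "('p \<times> 'l) set"

definition point_line_geometry :: "('p, 'l) geometry \<Rightarrow> bool" where
  "point_line_geometry G \<longleftrightarrow> inc G \<subseteq> points G \<times> lines G"

definition dual :: "('p, 'l) geometry \<Rightarrow> ('l, 'p) geometry" where
  "dual G = \<lparr>points = lines G, lines = points G, inc = (inc G)\<inverse>\<rparr>"

definition points_on :: "('p, 'l) geometry \<Rightarrow> 'l \<Rightarrow> 'p set" where
  "points_on G L = {x \<in> points G. (x, L) \<in> inc G}"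

definition lines_through :: "('p, 'l) geometry \<Rightarrow> 'p \<Rightarrow> 'l set" where
  "lines_through G x = {L \<in> lines G. (x, L) \<in> inc G}"

definition collinear :: "('p, 'l) geometry \<Rightarrow> 'p \<Rightarrow> 'p \<Rightarrow> bool" where
  "collinear G x y \<longleftrightarrow>
     x \<in> points G \<and> y \<in> points G \<and> x \<noteq> y \<and> (\<exists>L\<in>lines G. (x, L) \<in> inc G \<and> (y, L) \<in> inc G)"

text \<open>Used only for collinear points of an ordinary octagon, where the joining line is unique.\<close>

definition join :: "('p, 'l) geometry \<Rightarrow> 'p \<Rightarrow> 'p \<Rightarrow> 'l" where
  "join G x y = (THE L. L \<in> lines G \<and> (x, L) \<in> inc G \<and> (y, L) \<in> inc G)"

text \<open>
  The incidence graph is the cycle $p_0, l_0, p_1, l_1, \ldots, p_{k-1}, l_{k-1}, p_0$ of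
  length $2k$; for $k = 2$ all four incidences hold.
\<close>

definition ordinary_gon :: "nat \<Rightarrow> ('p, 'l) geometry \<Rightarrow> bool" where
  "ordinary_gon k G \<longleftrightarrow> 2 \<le> k \<and>
     (\<exists>p l. bij_betw p {..<k} (points G) \<and> bij_betw l {..<k} (lines G) \<and>
        inc G = {(p i, l i) | i. i < k} \<union> {(p (Suc i mod k), l i) | i. i < k})"

text \<open>A subgeometry carries the induced incidence.\<close>

definition subgeometry :: "('p, 'l) geometry \<Rightarrow> ('p, 'l) geometry \<Rightarrow> bool" where
  "subgeometry H G \<longleftrightarrow> points H \<subseteq> points G \<and> lines H \<subseteq> lines G \<and>
     inc H = inc G \<inter> (points H \<times> lines H)"

definition elements :: "('p, 'l) geometry \<Rightarrow> ('p + 'l) set" where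
  "elements G = points G <+> lines G"

text \<open>
  The empty geometry would satisfy the two gon conditions vacuously and have every order;
  it is excluded.
\<close>

definition weak_generalized_gon :: "nat \<Rightarrow> ('p, 'l) geometry \<Rightarrow> bool" where
  "weak_generalized_gon m G \<longleftrightarrow> 3 \<le> m \<and> point_line_geometry G \<and> elements G \<noteq> {} \<and>
     (\<forall>x\<in>elements G. \<forall>y\<in>elements G.
        \<exists>H. subgeometry H G \<and> ordinary_gon m H \<and> x \<in> elements H \<and> y \<in> elements H) \<and>
     (\<forall>k H. 2 \<le> k \<and> k < m \<longrightarrow> \<not> (subgeometry H G \<and> ordinary_gon k H))"

definition thick :: "('p, 'l) geometry \<Rightarrow> bool" where
  "thick G \<longleftrightarrow>
     (\<forall>x\<in>points G. \<exists>X\<subseteq>lines_through G x. card X = 3) \<and>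
     (\<forall>L\<in>lines G. \<exists>X\<subseteq>points_on G L. card X = 3)"

definition thick_generalized_gon :: "nat \<Rightarrow> ('p, 'l) geometry \<Rightarrow> bool" where
  "thick_generalized_gon m G \<longleftrightarrow> weak_generalized_gon m G \<and> thick G"

definition has_order :: "('p, 'l) geometry \<Rightarrow> 'u rel \<Rightarrow> 'v rel \<Rightarrow> bool" where
  "has_order G u v \<longleftrightarrow> Card_order u \<and> Card_order v \<and>
     (\<forall>L\<in>lines G. |points_on G L| =o u +c cone) \<and>
     (\<forall>x\<in>points G. |lines_through G x| =o v +c cone)"

definition thin_generalized_gon :: "nat \<Rightarrow> ('p, 'l) geometry \<Rightarrow> 'u rel \<Rightarrow> bool" where
  "thin_generalized_gon m G u \<longleftrightarrow> weak_generalized_gon m G \<and> has_order G u cone \<and> cone \<le>o u"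

definition locally_finite_gon :: "nat \<Rightarrow> ('p, 'l) geometry \<Rightarrow> 'u rel \<Rightarrow> 'v rel \<Rightarrow> bool" where
  "locally_finite_gon m G u v \<longleftrightarrow> thick_generalized_gon m G \<and> has_order G u v \<and>
     (finite (Field u) \<noteq> finite (Field v))"

text \<open>
  A morphism is given by its restrictions \<open>f\<close> to the points and \<open>g\<close> to the lines; the values
  of \<open>f\<close> and \<open>g\<close> outside the geometry are irrelevant.
\<close>

definition morphism ::
  "('p \<Rightarrow> 'q) \<Rightarrow> ('l \<Rightarrow> 'm) \<Rightarrow> ('p, 'l) geometry \<Rightarrow> ('q, 'm) geometry \<Rightarrow> bool" where
  "morphism f g S G \<longleftrightarrow> f ` points S \<subseteq> points G \<and> g ` lines S \<subseteq> lines G \<and>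
     (\<forall>x\<in>points S. \<forall>L\<in>lines S. (x, L) \<in> inc S \<longrightarrow> (f x, g L) \<in> inc G)"

definition epimorphism ::
  "('p \<Rightarrow> 'q) \<Rightarrow> ('l \<Rightarrow> 'm) \<Rightarrow> ('p, 'l) geometry \<Rightarrow> ('q, 'm) geometry \<Rightarrow> bool" where
  "epimorphism f g S G \<longleftrightarrow> morphism f g S G \<and> f ` points S = points G \<and> g ` lines S = lines G"

text \<open>
  Below, \<open>\<Phi> = (f, g)\<close> is an epimorphism from a thick generalized octagon \<open>S\<close> of order \<open>(s, t)\<close>
  onto an ordinary octagon \<open>G\<close>; small letters are points of \<open>G\<close>, the capitals \<open>A\<close>, \dots, \<open>H\<close> are
  the corresponding point fibres, \<open>Lf x y\<close> is the fibre of the line joining \<open>x\<close> and \<open>y\<close>, and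
  \<open>K\<close> is the distinguished line of \<open>S\<close>.
\<close>

definition class_a ::
  "('p, 'l) geometry \<Rightarrow> ('q, 'm) geometry \<Rightarrow> 's rel \<Rightarrow> ('p \<Rightarrow> 'q) \<Rightarrow> ('l \<Rightarrow> 'm) \<Rightarrow> bool" where
  "class_a S G s f g \<longleftrightarrow>
    (\<exists>a b c d e f' g' h.
       distinct [a, b, c, d, e, f', g', h] \<and> set [a, b, c, d, e, f', g', h] = points G \<and>
       collinear G a b \<and> collinear G b c \<and> collinear G c d \<and> collinear G d e \<and>
       collinear G e f' \<and> collinear G f' g' \<and> collinear G g' h \<and> collinear G h a \<and>
       (let Pf = (\<lambda>x. {z \<in> points S. f z = x});
            Lf = (\<lambda>x y. {M \<in> lines S. g M = join G x y});
            A = Pf a; B = Pf b; C = Pf c; D = Pf d; E = Pf e; F = Pf f'; G' = Pf g'; H = Pf h;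
            near = (\<lambda>X. {z \<in> points S. \<exists>y\<in>X. collinear S z y});
            meets = (\<lambda>X. {M \<in> lines S. \<exists>y\<in>X. (y, M) \<in> inc S})
        in \<exists>K\<in>lines S.
          C \<union> B = points_on S K \<and> C \<inter> B = {} \<and>
          cone \<le>o |C| \<and> |C| \<le>o s \<and> cone \<le>o |B| \<and> |B| \<le>o s \<and>
          D = near C - points_on S K \<and>
          A = near B - points_on S K \<and>
          E = near D - (C \<union> D) \<and>
          H = near A - (A \<union> B) \<and>
          F = near E - (D \<union> E) \<and>
          G' = near H - (A \<union> H) \<and>
          Lf c b = {K} \<and>
          Lf c d = meets C - {K} \<and>
          Lf a b = meets B - {K} \<and>
          Lf d e = meets D - Lf d c \<and>
          Lf a h = meets A - Lf a b \<and>
          Lf e f' = meets E - Lf d e \<and>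
          Lf g' h = meets H - Lf a h \<and>
          Lf g' f' = meets G' - Lf h g' \<and>
          Lf g' f' = meets F - Lf e f'))"

definition class_b ::
  "('p, 'l) geometry \<Rightarrow> ('q, 'm) geometry \<Rightarrow> 't rel \<Rightarrow> ('p \<Rightarrow> 'q) \<Rightarrow> ('l \<Rightarrow> 'm) \<Rightarrow> bool" where
  "class_b S G t f g \<longleftrightarrow> class_a (dual S) (dual G) t g f"

end

(*
  Regard a generalized octagon as its incidence graph and an ordinary octagon as the 16-cycle; an
  epimorphism becomes a map to the integers modulo 16 that changes by 1 or -1 along every edge.
  Write F i for the fibre over i. Since opposite positions lift to opposite elements, projection
  shows that the number of neighbours over i + 1 of an element over i depends on i only and equals
  the number of neighbours over i + 7 of an element over i + 8. Projecting between opposite elements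
  over i and i + 6, if there are any, compares the numbers at i and i + 6; as 6 generates the even
  residues and point degrees are finite, not all these comparisons are available (otherwise all
  numbers would be half the degree, which a folded walk excludes). So for some i all elements of F i
  are at distance 6 from all elements of F (i + 6). A pair i, i + k of positions with this property
  and k minimal has k = 0, that is, some fibre is a singleton {c}. All fibres are then determined by
  the distance from c and the side of c: class (a) if c is a line, class (b) if c is a point.

  Conversely, any splitting of the neighbours of an element c into two sides defines an epimorphism
  with singleton fibre {c}. Composing with such maps reduces targets of order (s', 1), s' > 1, to the
  16-cycle: the singleton fibre is then so close to the chosen centre that a point of the source has
  only one line over each of the two lines through its image, contradicting thickness.
*)

theory Submission
  imports Defs
begin

section \<open>Distances in polygons and maps to the 16-cycle\<close>

text \<open>Elements over positions \<open>k \<le> 8\<close> apart have distance at least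
  \<open>k\<close> and of the same parity. Separations 7 and 8 therefore determine the distance, and
  6 is the first at which it can vary, between 6 and 8; hence the role of 6. Since one valency may
  be infinite, counting is confined to even positions, where the points of the source are put.
  Elsewhere only the statement that an element has exactly one neighbour over an adjacent position
  is used; it makes sense for infinite valencies too, and thickness forbids it in both directions at
  one position. A pair of tight positions that cannot be shortened forces such values 1 near its
  ends; for small separations these clash at once, for 5 and 6 only after going around the cycle.
  Everything is symmetric under reversing the cycle, so many lemmas come in mirrored pairs. A
  singleton fibre decides the class because flags of an ordinary octagon lift from every element of
  the source: this alone gives the recursive part of class (a), and the singleton fibre gives its
  starting point.\<close>

locale polygon =
  fixes n :: nat and V :: "'v set" and E :: "'v \<Rightarrow> 'v \<Rightarrow> bool" and d :: "'v \<Rightarrow> 'v \<Rightarrow> nat"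
  assumes E_V: "E u v \<Longrightarrow> u \<in> V \<and> v \<in> V"
    and E_sym: "E u v \<Longrightarrow> E v u"
    and d_le: "u \<in> V \<Longrightarrow> w \<in> V \<Longrightarrow> d u w \<le> n"
    and d_sym: "u \<in> V \<Longrightarrow> w \<in> V \<Longrightarrow> d u w = d w u"
    and d_eq_0: "u \<in> V \<Longrightarrow> w \<in> V \<Longrightarrow> d u w = 0 \<longleftrightarrow> u = w"
    and d_E: "E u v \<Longrightarrow> w \<in> V \<Longrightarrow> d u w = Suc (d v w) \<or> d v w = Suc (d u w)"
    and closer_ex: "u \<in> V \<Longrightarrow> w \<in> V \<Longrightarrow> u \<noteq> w \<Longrightarrow> \<exists>v. E u v \<and> d u w = Suc (d v w)"
    and closer_unique: "E u v \<Longrightarrow> E u v' \<Longrightarrow> w \<in> V \<Longrightarrow> d u w < n \<Longrightarrow>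
      d u w = Suc (d v w) \<Longrightarrow> d u w = Suc (d v' w) \<Longrightarrow> v = v'"
    and two_neighbours: "u \<in> V \<Longrightarrow> \<exists>v v'. E u v \<and> E u v' \<and> v \<noteq> v'"
begin

lemma farther:
  assumes "E u v" "E u v'" "v \<noteq> v'" "w \<in> V" "d u w < n" "d u w = Suc (d v w)"
  shows "d v' w = Suc (d u w)"
  using assms closer_unique d_E by metis

lemma farther_ex:
  assumes "u \<in> V" "w \<in> V" "d u w < n"
  shows "\<exists>v. E u v \<and> d v w = Suc (d u w)"
  using assms two_neighbours[OF assms(1)] closer_unique d_E by metis

lemma d_edge: "E u v \<Longrightarrow> d u v = 1"
  using d_E[of u v v] d_eq_0[of v v] E_V[of u v] by auto

definition nbs :: "'v \<Rightarrow> 'v set" where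
  "nbs u = {v. E u v}"

text \<open>Each neighbour \<open>l\<close> of \<open>u\<close> has distance \<open>n - 1\<close>
  from \<open>v\<close>, so exactly one neighbour of \<open>v\<close> is nearer to \<open>l\<close>.
  The same holds with \<open>u\<close> and \<open>v\<close> exchanged, which makes this projection
  bijective.\<close>

lemma opposite_bij:
  assumes "u \<in> V" "v \<in> V" "d u v = n" "2 \<le> n"
  obtains \<pi> where "bij_betw \<pi> (nbs u) (nbs v)"
    "\<And>l m. E u l \<Longrightarrow> E v m \<Longrightarrow> d l m + 2 = n \<longleftrightarrow> m = \<pi> l"
proof -
  have near: "\<exists>!m. E b m \<and> d l m + 2 = n" if "E a l" "a \<in> V" "b \<in> V" "d a b = n" for a b l
  proof -
    have lV: "l \<in> V" using that E_V by blast
    have "d l b \<le> n" using d_le lV that by blast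
    then have lb: "Suc (d l b) = n" using d_E[OF \<open>E a l\<close> \<open>b \<in> V\<close>] that by auto
    have bl: "d b l = d l b" using d_sym lV that by blast
    then have "b \<noteq> l" using lb \<open>2 \<le> n\<close> d_eq_0[of b l] lV that by auto
    then obtain m where m: "E b m" "d b l = Suc (d m l)" using closer_ex[of b l] lV \<open>b \<in> V\<close> by blast
    show ?thesis
    proof (intro ex1I conjI)
      show "E b m" by fact
      show "d l m + 2 = n" using m lb bl d_sym[OF lV, of m] E_V[OF m(1)] by linarith
      fix m' assume m': "E b m' \<and> d l m' + 2 = n"
      then have "d b l = Suc (d m' l)" using lb bl d_sym[OF lV, of m'] E_V[of b m'] by linarith
      then show "m' = m" using closer_unique[of b m' m l] m m' lV lb bl by (metis lessI)
    qed
  qed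
  define \<pi> where "\<pi> l = (THE m. E v m \<and> d l m + 2 = n)" for l
  have pi: "E v (\<pi> l) \<and> d l (\<pi> l) + 2 = n" if "E u l" for l
    unfolding \<pi>_def by (rule theI') (rule near[OF that assms(1-3)])
  have iff: "d l m + 2 = n \<longleftrightarrow> m = \<pi> l" if "E u l" "E v m" for l m
    using near[OF that(1) assms(1-3)] pi[OF that(1)] that by blast
  have vu: "d v u = n" using assms d_sym by simp
  have bij: "bij_betw \<pi> (nbs u) (nbs v)"
  proof (rule bij_betwI')
    fix l l' assume "l \<in> nbs u" "l' \<in> nbs u"
    then have l: "E u l" "E u l'" by (auto simp: nbs_def)
    show "(\<pi> l = \<pi> l') = (l = l')"
    proof
      assume eq: "\<pi> l = \<pi> l'"
      have "d (\<pi> l) l + 2 = n" "d (\<pi> l) l' + 2 = n"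
        using pi[OF l(1)] pi[OF l(2)] eq d_sym E_V l by metis+
      then show "l = l'" using near[OF _ assms(2,1) vu, of "\<pi> l"] pi[OF l(1)] l by blast
    qed simp
  next
    fix l assume "l \<in> nbs u" then show "\<pi> l \<in> nbs v" using pi by (auto simp: nbs_def)
  next
    fix m assume "m \<in> nbs v"
    then have m: "E v m" by (simp add: nbs_def)
    then obtain l where l: "E u l" "d m l + 2 = n" using near[OF m assms(2,1) vu] by blast
    then have "m = \<pi> l" using iff[OF l(1) m] d_sym[of m l] E_V[OF m] E_V[OF l(1)] by metis
    then show "\<exists>x\<in>nbs u. m = \<pi> x" using l by (auto simp: nbs_def)
  qed
  show thesis using that bij iff by blast
qed

end

text \<open>Positions are integers that matter only modulo 16; this keeps negative offsets and the
  reflection \<open>- \<phi>\<close> free of case distinctions.\<close>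

locale wrap = polygon 8 V E d for V :: "'v set" and E d +
  fixes \<phi> :: "'v \<Rightarrow> int"
  assumes step: "E u v \<Longrightarrow> 16 dvd \<phi> v - \<phi> u - 1 \<or> 16 dvd \<phi> v - \<phi> u + 1"
    and onto: "\<exists>u\<in>V. 16 dvd \<phi> u - i"
begin

definition F :: "int \<Rightarrow> 'v set" where
  "F i = {u \<in> V. 16 dvd \<phi> u - i}"

definition nb :: "'v \<Rightarrow> int \<Rightarrow> 'v set" where
  "nb u i = {v \<in> F i. E u v}"

lemma F_V: "u \<in> F i \<Longrightarrow> u \<in> V"
  by (simp add: F_def)

lemma F_ex: "\<exists>u. u \<in> F i"
  using onto[of i] by (auto simp: F_def)

lemma F_self: "u \<in> V \<Longrightarrow> u \<in> F (\<phi> u)"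
  by (simp add: F_def)

lemma F_diff: "u \<in> F i \<Longrightarrow> u \<in> F j \<longleftrightarrow> 16 dvd i - j"
proof -
  assume u: "u \<in> F i"
  then have "16 dvd \<phi> u - i" by (simp add: F_def)
  then have "16 dvd (\<phi> u - i) + (i - j) \<longleftrightarrow> 16 dvd i - j" by (rule dvd_add_right_iff)
  then show ?thesis using u by (simp add: F_def)
qed

lemma F_mod: "16 dvd i - j \<Longrightarrow> F i = F j"
  using F_diff F_V by (metis dvd_diff_commute subsetI subset_antisym)

lemma F_step: 
  assumes "u \<in> F i" "E u v"
  shows "v \<in> F (i + 1) \<or> v \<in> F (i - 1)"
proof -
  have "16 dvd \<phi> u - i" and v: "v \<in> V" using assms E_V by (auto simp: F_def)
  with step[OF assms(2)] have "16 dvd (\<phi> v - \<phi> u - 1) + (\<phi> u - i) \<or> 16 dvd (\<phi> v - \<phi> u + 1) + (\<phi> u - i)"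
    using dvd_add by blast
  then show ?thesis using v by (simp add: F_def algebra_simps)
qed

text \<open>Reversing the cycle turns each statement about going up into one about going
  down.\<close>

lemma wrap_reflect: "wrap V E d (\<lambda>u. - \<phi> u)"
proof unfold_locales
  show "16 dvd - \<phi> v - - \<phi> u - 1 \<or> 16 dvd - \<phi> v - - \<phi> u + 1" if "E u v" for u v
    using step[OF E_sym[OF that]] by (simp add: algebra_simps)
  show "\<exists>u\<in>V. 16 dvd - \<phi> u - i" for i
  proof -
    obtain u where "u \<in> V" "16 dvd \<phi> u - (- i)" using onto by blast
    then have "16 dvd - (\<phi> u + i)" by (simp only: dvd_minus_iff diff_minus_eq_add)
    then show ?thesis using \<open>u \<in> V\<close> by (intro bexI[of _ u]) simp_all
  qed
qed

lemma F_reflect: "wrap.F V (\<lambda>u. - \<phi> u) i = F (- i)"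
proof -
  have "- x - i = - (x - - i)" for x by simp
  then show ?thesis
    unfolding wrap.F_def[OF wrap_reflect] F_def by (simp only: dvd_minus_iff)
qed

lemma nb_reflect: "wrap.nb V E (\<lambda>u. - \<phi> u) u i = nb u (- i)"
  unfolding wrap.nb_def[OF wrap_reflect] F_reflect nb_def ..

text \<open>\<open>j\<close> is the net change of position along a geodesic from \<open>u\<close> to
  \<open>w\<close>, each step of which contributes 1 or -1.\<close>

lemma offset_ex:
  assumes "u \<in> V" "w \<in> V"
  shows "\<exists>j::int. \<bar>j\<bar> \<le> int (d u w) \<and> 16 dvd \<phi> w - \<phi> u - j \<and> even (int (d u w) + j)"
  using assms
proof (induction "d u w" arbitrary: u)
  case 0
  then have "u = w" using d_eq_0 by auto
  then show ?case using 0 by (intro exI[of _ 0]) auto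
next
  case (Suc k)
  then have "u \<noteq> w" using d_eq_0 by force
  then obtain v where v: "E u v" "d u w = Suc (d v w)" using closer_ex Suc by blast
  then obtain j where j: "\<bar>j\<bar> \<le> int (d v w)" "16 dvd \<phi> w - \<phi> v - j" "even (int (d v w) + j)"
    using Suc(1)[of v] Suc(2-) E_V by auto
  have "16 dvd (\<phi> w - \<phi> v - j) + (\<phi> v - \<phi> u - 1) \<or> 16 dvd (\<phi> w - \<phi> v - j) + (\<phi> v - \<phi> u + 1)"
    using step[OF v(1)] j(2) dvd_add by blast
  then have "16 dvd \<phi> w - \<phi> u - (j + 1) \<or> 16 dvd \<phi> w - \<phi> u - (j - 1)"
    by (simp add: algebra_simps)
  moreover have "\<bar>j + 1\<bar> \<le> int (d u w)" "\<bar>j - 1\<bar> \<le> int (d u w)" using j(1) v(2) by auto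
  moreover have "even (int (d u w) + (j + 1))" "even (int (d u w) + (j - 1))" using j(3) v(2) by auto
  ultimately show ?case by blast
qed

text \<open>The net change along a geodesic is congruent to \<open>k\<close> modulo 16, and for
  \<open>k \<le> 8\<close> no integer in this class has absolute value below
  \<open>k\<close>.\<close>

lemma F_dist:
  assumes "u \<in> F i" "w \<in> F (i + int k)" "k \<le> 8"
  shows "k \<le> d u w \<and> even (d u w + k)"
proof -
  obtain j where j: "\<bar>j\<bar> \<le> int (d u w)" "16 dvd \<phi> w - \<phi> u - j" "even (int (d u w) + j)"
    using offset_ex[of u w] F_V assms by blast
  have w: "16 dvd \<phi> w - (i + int k)" and u: "16 dvd \<phi> u - i" using assms by (auto simp: F_def)
  have "16 dvd (\<phi> w - \<phi> u - j) + (\<phi> u - i) - (\<phi> w - (i + int k))"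
    by (rule dvd_diff[OF dvd_add[OF j(2) u] w])
  then have "16 dvd int k - j" by (simp add: algebra_simps)
  then obtain m where "int k - j = 16 * m" by (elim dvdE)
  then have m: "int k = j + 16 * m" by simp
  have "m = 0 \<or> m \<ge> 1 \<or> m \<le> -1" by linarith
  then have "int k \<le> \<bar>j\<bar>" using m assms(3) by linarith
  moreover have "even (int (d u w) + j + 2 * (8 * m))" by (rule dvd_add[OF j(3)]) simp
  then have "even (int (d u w) + int k)" unfolding m by (simp only: add.assoc mult.assoc[symmetric]) simp
  then have "even (d u w + k)" by simp
  ultimately show ?thesis using j(1) by simp
qed

lemma F_dist': "u \<in> F i \<Longrightarrow> w \<in> F j \<Longrightarrow> 16 dvd j - i - int k \<Longrightarrow> k \<le> 8 \<Longrightarrow>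
    k \<le> d u w \<and> even (d u w + k)"
  using F_dist[of u i w k] F_mod[of j "i + int k"] by (simp add: algebra_simps)

lemma F_opp: "u \<in> F i \<Longrightarrow> w \<in> F j \<Longrightarrow> 16 dvd j - i - 8 \<Longrightarrow> d u w = 8"
  using F_dist'[of u i w j 8] d_le[of u w] F_V by fastforce

text \<open>Parity forces distance 7 from \<open>u\<close> to any \<open>z\<close> over
  \<open>i + 7\<close>. The next element towards \<open>z\<close> is at distance 6 from it, so it is
  not over \<open>i - 1\<close>, the position opposite to \<open>i + 7\<close>.\<close>

lemma lift_up:
  assumes "u \<in> F i"
  shows "\<exists>v. E u v \<and> v \<in> F (i + 1)"
proof -
  obtain z where z: "z \<in> F (i + 7)" using F_ex by blast
  have "7 \<le> d u z \<and> even (d u z + 7)" using F_dist[of u i z 7] z assms by simp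
  moreover have "d u z \<le> 8" using d_le assms z F_V by blast
  ultimately have uz: "d u z = 7" by presburger
  then have "u \<noteq> z" using d_eq_0[of u z] assms z F_V by force
  then obtain v where v: "E u v" "d u z = Suc (d v z)"
    using closer_ex[of u z] assms z F_V by blast
  have "v \<notin> F (i - 1)" using F_opp[of v "i - 1" z "i + 7"] z v uz by auto
  then show ?thesis using F_step[OF assms v(1)] v by blast
qed

lemma lift_down: "u \<in> F i \<Longrightarrow> \<exists>v. E u v \<and> v \<in> F (i - 1)"
  using wrap.lift_up[OF wrap_reflect, of u "- i"] by (simp add: F_reflect)

end

section \<open>Local degrees\<close>

locale thick_wrap = wrap +
  assumes three: "u \<in> V \<Longrightarrow> \<exists>X. X \<subseteq> {v. E u v} \<and> card X = 3"
begin

lemma thick_wrap_reflect: "thick_wrap V E d (\<lambda>u. - \<phi> u)"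
  using wrap_reflect three by (simp add: thick_wrap_def thick_wrap_axioms_def)

lemma nbs_split: "u \<in> F i \<Longrightarrow> nbs u = nb u (i + 1) \<union> nb u (i - 1)"
  using F_step by (auto simp: nbs_def nb_def)

lemma nb_disj: "nb u (i + 1) \<inter> nb u (i - 1) = {}"
proof -
  have False if "v \<in> F (i + 1)" "v \<in> F (i - 1)" for v
    using F_diff[OF that(1), of "i - 1"] that(2) by simp
  then show ?thesis by (auto simp: nb_def)
qed

text \<open>Projection pairs have distance 6, whereas elements over opposite positions have distance
  8. So a neighbour over \<open>i + 1\<close> cannot project to one over \<open>i + 9\<close>, nor
  one over \<open>i - 1\<close> to one over \<open>i + 7\<close>.\<close>

lemma opp_nb_bij:
  assumes "u \<in> F i" "v \<in> F (i + 8)"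
  shows "\<exists>\<pi>. bij_betw \<pi> (nb u (i + 1)) (nb v (i + 7))"
proof -
  have uv: "d u v = 8" using F_opp[OF assms] by simp
  obtain \<pi> where bij: "bij_betw \<pi> (nbs u) (nbs v)"
    and iff: "\<And>l m. E u l \<Longrightarrow> E v m \<Longrightarrow> d l m + 2 = 8 \<longleftrightarrow> m = \<pi> l"
    using opposite_bij[of u v] uv assms F_V by auto
  have pi: "E v (\<pi> l) \<and> d l (\<pi> l) = 6" if "E u l" for l
    using bij_betwE[OF bij] that iff[OF that, of "\<pi> l"] by (auto simp: nbs_def)
  have same: "l \<in> nb u (i + 1) \<longleftrightarrow> \<pi> l \<in> nb v (i + 7)" if l: "E u l" for l
  proof
    assume "l \<in> nb u (i + 1)"
    then have "\<pi> l \<notin> F (i + 9)" using F_opp[of l "i + 1" "\<pi> l" "i + 9"] pi[OF l] by (auto simp: nb_def)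
    then show "\<pi> l \<in> nb v (i + 7)"
      using F_step[OF assms(2), of "\<pi> l"] pi[OF l] by (auto simp: nb_def algebra_simps)
  next
    assume "\<pi> l \<in> nb v (i + 7)"
    then have "l \<notin> F (i - 1)" using F_opp[of l "i - 1" "\<pi> l" "i + 7"] pi[OF l] by (auto simp: nb_def)
    then show "l \<in> nb u (i + 1)" using F_step[OF assms(1) l] l by (auto simp: nb_def)
  qed
  have sub: "nb u (i + 1) \<subseteq> nbs u" "nb v (i + 7) \<subseteq> nbs v" by (auto simp: nb_def nbs_def)
  have "\<pi> ` nb u (i + 1) = nb v (i + 7)"
  proof
    show "\<pi> ` nb u (i + 1) \<subseteq> nb v (i + 7)" using same sub by (auto simp: nbs_def)
    show "nb v (i + 7) \<subseteq> \<pi> ` nb u (i + 1)"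
    proof
      fix m assume m: "m \<in> nb v (i + 7)"
      then obtain l where "E u l" "m = \<pi> l" using sub(2) bij unfolding bij_betw_def nbs_def by blast
      then show "m \<in> \<pi> ` nb u (i + 1)" using same m by blast
    qed
  qed
  then show ?thesis using bij_betw_subset[OF bij sub(1)] by blast
qed

text \<open>The counted set is never empty by \<open>lift_up\<close>, so the value 0 means that it
  is infinite, and the value 1 is never a default.\<close>

definition up :: "int \<Rightarrow> nat" where
  "up i = card (nb (SOME u. u \<in> F i) (i + 1))"

definition dn :: "int \<Rightarrow> nat" where
  "dn i = card (nb (SOME u. u \<in> F i) (i - 1))"

lemma up_eq_dn_opp: "u \<in> F i \<Longrightarrow> v \<in> F (i + 8) \<Longrightarrow> card (nb u (i + 1)) = card (nb v (i + 7))"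
  using opp_nb_bij bij_betw_same_card by blast

text \<open>Any two elements of \<open>F i\<close> are compared through one common element of the
  opposite fibre.\<close>

lemma up_card:
  assumes "u \<in> F i"
  shows "card (nb u (i + 1)) = up i"
proof -
  obtain v where "v \<in> F (i + 8)" using F_ex by blast
  moreover have "(SOME u. u \<in> F i) \<in> F i" using assms by (rule someI)
  ultimately show ?thesis unfolding up_def using up_eq_dn_opp assms by simp
qed

lemma F_shift: "F (i + 16) = F i"
  by (rule F_mod) simp

lemma nb_shift: "nb u (i + 16) = nb u i"
  by (simp add: nb_def F_shift)

lemma dn_card: "u \<in> F i \<Longrightarrow> card (nb u (i - 1)) = dn i"
proof -
  have "card (nb u (i - 1)) = card (nb w (i - 7))" if "u \<in> F i" "w \<in> F (i - 8)" for u w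
    using up_eq_dn_opp[of w "i - 8" u] that by simp
  moreover obtain w where "w \<in> F (i - 8)" using F_ex by blast
  moreover have "(SOME u. u \<in> F i) \<in> F i" using F_ex by (rule someI_ex)
  ultimately show "u \<in> F i \<Longrightarrow> card (nb u (i - 1)) = dn i" unfolding dn_def by simp
qed

lemma up_opp: "up i = dn (i + 8)"
proof -
  obtain u v where "u \<in> F i" "v \<in> F (i + 8)" using F_ex by blast
  moreover have "i + 8 - 1 = i + 7" by simp
  ultimately show ?thesis using up_eq_dn_opp[of u i v] up_card[of u i] dn_card[of v "i + 8"] by metis
qed

lemma up_shift: "up (i + 16) = up i" and dn_shift: "dn (i + 16) = dn i"
  using nb_shift[of _ "i + 1"] nb_shift[of _ "i - 1"]
  by (simp_all add: up_def dn_def F_shift algebra_simps)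

lemma up_reflect: "thick_wrap.up V E (\<lambda>u. - \<phi> u) i = dn (- i)"
  and dn_reflect: "thick_wrap.dn V E (\<lambda>u. - \<phi> u) i = up (- i)"
proof -
  have "- (i + 1) = - i - 1" "- (i - 1) = - i + 1" by simp_all
  then show "thick_wrap.up V E (\<lambda>u. - \<phi> u) i = dn (- i)"
    and "thick_wrap.dn V E (\<lambda>u. - \<phi> u) i = up (- i)"
    unfolding thick_wrap.up_def[OF thick_wrap_reflect] thick_wrap.dn_def[OF thick_wrap_reflect]
      F_reflect nb_reflect up_def dn_def by (simp_all only:)
qed

lemma up_unique:
  assumes "up i = 1" "u \<in> F i" "E u v" "E u v'" "v \<in> F (i + 1)" "v' \<in> F (i + 1)"
  shows "v = v'"
proof -
  have "card (nb u (i + 1)) = 1" using up_card assms by simp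
  then obtain w where "nb u (i + 1) = {w}" by (rule card_1_singletonE)
  moreover have "v \<in> nb u (i + 1)" "v' \<in> nb u (i + 1)" using assms by (auto simp: nb_def)
  ultimately show ?thesis by simp
qed

lemma dn_unique:
  assumes "dn i = 1" "u \<in> F i" "E u v" "E u v'" "v \<in> F (i - 1)" "v' \<in> F (i - 1)"
  shows "v = v'"
  using thick_wrap.up_unique[OF thick_wrap_reflect, of "- i" u v v'] assms
  by (simp add: F_reflect up_reflect)

lemma up_1I:
  assumes "u \<in> F i" "\<And>v v'. E u v \<Longrightarrow> E u v' \<Longrightarrow> v \<in> F (i + 1) \<Longrightarrow> v' \<in> F (i + 1) \<Longrightarrow> v = v'"
  shows "up i = 1"
proof -
  obtain v where "E u v" "v \<in> F (i + 1)" using lift_up assms(1) by blast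
  then have "nb u (i + 1) = {v}" using assms(2) by (auto simp: nb_def)
  then have "card (nb u (i + 1)) = 1" by simp
  then show ?thesis using up_card assms by simp
qed

lemma dn_1I:
  assumes "u \<in> F i" "\<And>v v'. E u v \<Longrightarrow> E u v' \<Longrightarrow> v \<in> F (i - 1) \<Longrightarrow> v' \<in> F (i - 1) \<Longrightarrow> v = v'"
  shows "dn i = 1"
  using thick_wrap.up_1I[OF thick_wrap_reflect, of u "- i"] assms
  by (simp add: F_reflect up_reflect)

lemma up_other:
  assumes "up i \<noteq> 1" "u \<in> F i"
  shows "\<exists>v. v \<noteq> w \<and> E u v \<and> v \<in> F (i + 1)"
  using assms up_1I by metis

text \<open>All neighbours lie over the two adjacent positions, and there are at least three of
  them.\<close>

lemma up_dn_not_1: "\<not> (up i = 1 \<and> dn i = 1)"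
proof
  assume 1: "up i = 1 \<and> dn i = 1"
  obtain u where u: "u \<in> F i" using F_ex by blast
  obtain X where X: "X \<subseteq> {v. E u v}" "card X = 3" using three F_V u by blast
  have c: "card (nb u (i + 1)) = 1" "card (nb u (i - 1)) = 1" using up_card dn_card u 1 by auto
  moreover have "X \<subseteq> nb u (i + 1) \<union> nb u (i - 1)" using X nbs_split[OF u] by (auto simp: nbs_def)
  moreover from c have "finite (nb u (i + 1) \<union> nb u (i - 1))" by (simp add: card_ge_0_finite)
  ultimately show False using X(2) card_mono[of "nb u (i + 1) \<union> nb u (i - 1)" X]
      card_Un_le[of "nb u (i + 1)" "nb u (i - 1)"] by linarith
qed

text \<open>For \<open>k \<le> 8\<close> this is the least distance that \<open>F_dist\<close>
  allows. \<open>tight i 0\<close> says that \<open>F i\<close> is a singleton.\<close>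

definition tight :: "int \<Rightarrow> nat \<Rightarrow> bool" where
  "tight i k \<longleftrightarrow> (\<forall>u\<in>F i. \<forall>v\<in>F (i + int k). d u v = k)"

lemma tight_reflect: "thick_wrap.tight V d (\<lambda>u. - \<phi> u) i k = tight (- i - int k) k"
proof -
  have "- (i + int k) = - i - int k" "- i - int k + int k = - i" by simp_all
  then show ?thesis
    unfolding thick_wrap.tight_def[OF thick_wrap_reflect] F_reflect tight_def
    using d_sym F_V by metis
qed

lemma not_tight_6_opposite:
  assumes "\<not> tight i 6"
  shows "\<exists>u v. u \<in> F i \<and> v \<in> F (i + 6) \<and> d u v = 8"
proof -
  obtain u v where uv: "u \<in> F i" "v \<in> F (i + 6)" "d u v \<noteq> 6" using assms by (auto simp: tight_def)
  then have "6 \<le> d u v \<and> even (d u v + 6)" using F_dist[of u i v 6] by simp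
  moreover have "d u v \<le> 8" using d_le uv F_V by blast
  moreover have "x = 8" if "6 \<le> x" "even (x + 6)" "x \<le> 8" "x \<noteq> 6" for x :: nat using that by presburger
  ultimately show ?thesis using uv by blast
qed

text \<open>Projection between opposite elements over positions \<open>i\<close> and \<open>i + 6\<close> cannot join a
  neighbour over \<open>i - 1\<close> to one over \<open>i + 7\<close>, since these positions are opposite.\<close>

lemma proj_6:
  assumes "u \<in> F i" "v \<in> F (i + 6)" "d u v = 8"
  obtains \<pi> where "inj_on \<pi> (nb u (i - 1))" "\<pi> ` nb u (i - 1) \<subseteq> nb v (i + 5)"
    "\<And>l m. E u l \<Longrightarrow> E v m \<Longrightarrow> d l m = 6 \<Longrightarrow> m = \<pi> l" "inj_on \<pi> (nbs u)"
proof -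
  obtain \<pi> where bij: "bij_betw \<pi> (nbs u) (nbs v)"
    and iff: "\<And>l m. E u l \<Longrightarrow> E v m \<Longrightarrow> d l m + 2 = 8 \<longleftrightarrow> m = \<pi> l"
    using opposite_bij[of u v] assms F_V by auto
  have pi: "E v (\<pi> l) \<and> d l (\<pi> l) = 6" if "E u l" for l
    using bij_betwE[OF bij] that iff[OF that, of "\<pi> l"] by (auto simp: nbs_def)
  have "\<pi> l \<in> nb v (i + 5)" if l: "l \<in> nb u (i - 1)" for l
  proof -
    have ul: "E u l" using l by (simp add: nb_def)
    have "\<pi> l \<notin> F (i + 7)" using F_opp[of l "i - 1" "\<pi> l" "i + 7"] pi[OF ul] l by (auto simp: nb_def)
    then show "\<pi> l \<in> nb v (i + 5)"
      using F_step[OF assms(2), of "\<pi> l"] pi[OF ul] by (auto simp: nb_def algebra_simps)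
  qed
  moreover have "nb u (i - 1) \<subseteq> nbs u" by (auto simp: nb_def nbs_def)
  moreover have "m = \<pi> l" if "E u l" "E v m" "d l m = 6" for l m using iff[OF that(1,2)] that(3) by simp
  ultimately show thesis using that[of \<pi>] bij unfolding bij_betw_def by (meson image_subsetI inj_on_subset)
qed

text \<open>Projection injects the lower neighbours of \<open>u\<close> into those of
  \<open>v\<close>; a one-element target bounds the source even where valencies may be
  infinite.\<close>

lemma dn_mono_6:
  assumes "\<not> tight i 6" "dn (i + 6) = 1"
  shows "dn i = 1"
proof -
  obtain u v where uv: "u \<in> F i" "v \<in> F (i + 6)" "d u v = 8" using not_tight_6_opposite[OF assms(1)] by blast
  obtain \<pi> where pi: "inj_on \<pi> (nb u (i - 1))" "\<pi> ` nb u (i - 1) \<subseteq> nb v (i + 5)"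
    using proj_6[OF uv] by metis
  have 1: "card (nb v (i + 5)) = 1" using dn_card[OF uv(2)] assms(2) by (simp add: add.commute)
  then have "finite (nb v (i + 5))" by (simp add: card_ge_0_finite)
  then have le: "card (nb u (i - 1)) \<le> 1" and fin: "finite (nb u (i - 1))"
    using card_inj_on_le[OF pi] 1 inj_on_finite[OF pi] by auto
  moreover have "nb u (i - 1) \<noteq> {}" using lift_down[OF uv(1)] by (auto simp: nb_def)
  ultimately have "card (nb u (i - 1)) = 1" by (metis One_nat_def card_gt_0_iff le_antisym Suc_leI)
  then show ?thesis using dn_card[OF uv(1)] by simp
qed

lemma up_mono_6:
  assumes "\<not> tight i 6" "up i = 1"
  shows "up (i + 6) = 1"
  using thick_wrap.dn_mono_6[OF thick_wrap_reflect, of "- i - 6"] assms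
  by (simp add: dn_reflect tight_reflect add.commute)

end

section \<open>Tight pairs of positions\<close>

context thick_wrap
begin

lemma dn_other:
  assumes "dn i \<noteq> 1" "u \<in> F i"
  shows "\<exists>v. v \<noteq> w \<and> E u v \<and> v \<in> F (i - 1)"
  using assms dn_1I by metis

text \<open>An element over \<open>i - 1\<close> is at distance \<open>k + 1 \<le> 7\<close> from
  \<open>y\<close>, and all its neighbours over \<open>i\<close> are nearer to \<open>y\<close>;
  below distance 8 only one neighbour is nearer.\<close>

lemma tight_up_before:
  assumes "tight i k" "k \<le> 6"
  shows "up (i - 1) = 1"
proof -
  obtain r y where r: "r \<in> F (i - 1)" and y: "y \<in> F (i + int k)" using F_ex by blast
  have "k + 1 \<le> d r y" using F_dist'[OF r y, of "k + 1"] assms(2) by simp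
  then have *: "d r y = Suc (d v y)" "d r y < 8" if "E r v" "v \<in> F i" for v
    using d_E[OF that(1), of y] that(2) assms y F_V unfolding tight_def by fastforce+
  show ?thesis
  proof (rule up_1I[OF r])
    fix v v' assume "E r v" "E r v'" "v \<in> F (i - 1 + 1)" "v' \<in> F (i - 1 + 1)"
    then have v: "E r v" "E r v'" "v \<in> F i" "v' \<in> F i" by simp_all
    show "v = v'"
      using closer_unique[OF v(1,2) F_V[OF y]] *[OF v(1,3)] *[OF v(2,4)] by blast
  qed
qed

text \<open>If \<open>l\<close> and \<open>y\<close> witness that tightness fails one step further,
  then \<open>d l y = k + 1\<close>, and every neighbour of \<open>l\<close> over \<open>i\<close>
  is nearer to \<open>y\<close>, hence unique.\<close>

lemma tight_dn_next:
  assumes "tight i k" "1 \<le> k" "k \<le> 6" "\<not> tight (i + 1) (k - 1)"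
  shows "dn (i + 1) = 1"
proof -
  obtain l y where l: "l \<in> F (i + 1)" and y: "y \<in> F (i + int k)" and ly: "d l y \<noteq> k - 1"
    using assms(2,4) unfolding tight_def by (auto simp: of_nat_diff)
  have *: "d l y = Suc (d v y)" "d l y < 8" if "E l v" "v \<in> F i" for v
  proof -
    have "d v y = k" using assms(1) that(2) y by (auto simp: tight_def)
    then show "d l y = Suc (d v y)" "d l y < 8"
      using d_E[OF that(1) F_V[OF y]] ly assms(3) by auto
  qed
  show ?thesis
  proof (rule dn_1I[OF l])
    fix v v' assume "E l v" "E l v'" "v \<in> F (i + 1 - 1)" "v' \<in> F (i + 1 - 1)"
    then have v: "E l v" "E l v'" "v \<in> F i" "v' \<in> F i" by simp_all
    show "v = v'"
      using closer_unique[OF v(1,2) F_V[OF y]] *[OF v(1,3)] *[OF v(2,4)] by blast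
  qed
qed

lemma tight_up_prev:
  assumes "tight i k" "1 \<le> k" "k \<le> 6" "\<not> tight i (k - 1)"
  shows "up (i + int k - 1) = 1"
proof -
  have eq: "i + int k - 1 - int (k - 1) = i" "- (- i - int k) - int k = i"
    "- (- i - int k + 1) = i + int k - 1"
    using assms(2) by (simp_all add: of_nat_diff)
  show ?thesis
    using thick_wrap.tight_dn_next[OF thick_wrap_reflect, of "- i - int k" k] assms
    unfolding tight_reflect dn_reflect eq by blast
qed

lemma tight_closer:
  assumes "tight i k" "k \<le> 6" "x \<in> F i" "y \<in> F (i + int k)" "E x v" "d x y = Suc (d v y)"
  shows "v \<in> F (i + 1)"
proof -
  have "d x y = k" using assms by (auto simp: tight_def)
  moreover have "k + 1 \<le> d v y" if "v \<in> F (i - 1)"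
    using F_dist'[OF that assms(4), of "k + 1"] assms(2) by simp
  ultimately show ?thesis using F_step[OF assms(3,5)] assms(6) by fastforce
qed

text \<open>By \<open>tight_closer\<close> a geodesic from \<open>x\<close> to \<open>y\<close>
  starts upwards, and \<open>l\<close> is the only neighbour of \<open>x\<close> there.\<close>

lemma tight_next:
  assumes "tight i k" "1 \<le> k" "k \<le> 6" "up i = 1"
  shows "tight (i + 1) (k - 1)"
  unfolding tight_def
proof (intro ballI)
  fix l y assume l: "l \<in> F (i + 1)" and "y \<in> F (i + 1 + int (k - 1))"
  then have y: "y \<in> F (i + int k)" using assms(2) by (simp add: of_nat_diff)
  obtain x where x: "E l x" "x \<in> F i" using lift_down[OF l] by auto
  have xy: "d x y = k" using assms(1) x y by (auto simp: tight_def)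
  then have "x \<noteq> y" using d_eq_0 assms(2) F_V y by fastforce
  then obtain v where v: "E x v" "d x y = Suc (d v y)" using closer_ex F_V x(2) y by blast
  have "v \<in> F (i + 1)" by (rule tight_closer[OF assms(1,3) x(2) y v])
  then have "v = l" using up_unique[OF assms(4) x(2) v(1)] E_sym x(1) l by blast
  then show "d l y = k - 1" using v xy by simp
qed

lemma tight_prev:
  assumes "tight i k" "1 \<le> k" "k \<le> 6" "dn (i + int k) = 1"
  shows "tight i (k - 1)"
proof -
  have eq: "- (- i - int k + 1) - int (k - 1) = i" "i + int k - int k = i"
    "- (- i - int k) = i + int k"
    using assms(2) by (simp_all add: of_nat_diff)
  show ?thesis
    using thick_wrap.tight_next[OF thick_wrap_reflect, of "- i - int k" k] assms
    unfolding tight_reflect up_reflect eq by blast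
qed

text \<open>By \<open>tight_next\<close>, \<open>x\<close> has a second upper neighbour
  \<open>l2\<close>, through which one moves away from \<open>y\<close> to some \<open>z\<close> at
  distance \<open>k + 2\<close>. Each neighbour of \<open>z\<close> over \<open>i + 1\<close> has a
  neighbour over \<open>i\<close>, at distance \<open>k\<close> from \<open>y\<close>, so it is
  nearer to \<open>y\<close> than \<open>z\<close>; as \<open>k + 2 < 8\<close>, there is only
  one.\<close>

lemma tight_dn_second:
  assumes "tight i k" "2 \<le> k" "k < 6" "\<not> tight (i + 1) (k - 1)"
  shows "dn (i + 2) = 1"
proof (rule ccontr)
  assume dn: "dn (i + 2) \<noteq> 1"
  obtain x y where x: "x \<in> F i" and y: "y \<in> F (i + int k)" using F_ex by blast
  have yV: "y \<in> V" using F_V y by blast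
  have dk: "d v y = k" if "v \<in> F i" for v using assms(1) that y by (auto simp: tight_def)
  have "x \<noteq> y" using d_eq_0[OF yV yV] dk[OF x] assms(2) by auto
  then obtain l1 where l1: "E x l1" "d x y = Suc (d l1 y)" using closer_ex F_V x yV by blast
  have up: "up i \<noteq> 1" using tight_next[OF assms(1)] assms by auto
  obtain l2 where l2: "l2 \<noteq> l1" "E x l2" "l2 \<in> F (i + 1)" using up_other[OF up x] by blast
  have l2y: "d l2 y = k + 1" using farther[OF l1(1) l2(2) _ yV] l2(1) l1(2) dk[OF x] assms(3) by simp
  obtain z where z: "E l2 z" "z \<in> F (i + 2)" using lift_up[OF l2(3)] by (auto simp: add.assoc)
  have "x \<noteq> z" using F_diff[OF x] z(2) by fastforce
  then have zy: "d z y = k + 2"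
    using farther[OF E_sym[OF l2(2)] z(1) _ yV] l2y dk[OF x] assms(3) by simp
  obtain l3 where l3: "l3 \<noteq> l2" "E z l3" "l3 \<in> F (i + 1)"
    using dn_other[OF dn z(2), of l2] by (auto simp: algebra_simps)
  obtain x' where x': "E l3 x'" "x' \<in> F i" using lift_down[OF l3(3)] by auto
  have "d z y = Suc (d l3 y)" using d_E[OF l3(2) yV] d_E[OF x'(1) yV] dk[OF x'(2)] zy by linarith
  moreover have "d z y < 8" "d z y = Suc (d l2 y)" using zy l2y assms(3) by simp_all
  ultimately have "l3 = l2" using closer_unique[OF l3(2) E_sym[OF z(1)] yV] by blast
  then show False using l3(1) by simp
qed

lemma tight_up_second:
  assumes "tight i k" "2 \<le> k" "k < 6" "\<not> tight i (k - 1)"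
  shows "up (i + int k - 2) = 1"
proof -
  have eq: "- (- i - int k + 1) - int (k - 1) = i" "- (- i - int k) - int k = i"
    "- (- i - int k + 2) = i + int k - 2"
    using assms(2) by (simp_all add: of_nat_diff)
  show ?thesis
    using thick_wrap.tight_dn_second[OF thick_wrap_reflect, of "- i - int k" k] assms
    unfolding tight_reflect dn_reflect eq by blast
qed

text \<open>The value 1 of \<open>up\<close> at \<open>i + 3\<close> reappears as that of
  \<open>dn\<close> at the opposite position \<open>i + 11\<close>. Without
  \<open>tight (i + 5) 6\<close> it would pass on to \<open>dn (i + 5)\<close> and shorten the given
  pair; with it, the pair from \<open>i + 5\<close> to \<open>i + 11\<close> is shortened at its
  upper end.\<close>

lemma tight_5_shift:
  assumes "tight i 5" and least: "\<And>i. \<not> tight i 4"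
  shows "tight (i + 5) 5"
proof -
  have "up (i + 3) = 1" using tight_up_second[OF assms(1)] least by (simp add: add.commute)
  then have dn11: "dn (i + 11) = 1" using up_opp[of "i + 3"] by (simp add: add.assoc)
  have "dn (i + 5) \<noteq> 1" using tight_prev[OF assms(1)] least by auto
  then have t6: "tight (i + 5) 6" using dn_mono_6[of "i + 5"] dn11 by (auto simp: add.assoc)
  show ?thesis unfolding tight_def
  proof (intro ballI)
    fix u v assume u: "u \<in> F (i + 5)" and "v \<in> F (i + 5 + int 5)"
    then have v: "v \<in> F (i + 10)" by (simp add: add.assoc)
    obtain p where p: "E v p" "p \<in> F (i + 11)" using lift_up[OF v] by (auto simp: add.assoc)
    have "d u p = 6" using t6 u p(2) by (simp add: tight_def add.assoc)
    then have pu: "d p u = 6" using d_sym F_V u p(2) by metis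
    then have "p \<noteq> u" using d_eq_0[of u u] F_V u by auto
    then obtain w where w: "E p w" "d p u = Suc (d w u)" using closer_ex F_V u p(2) by blast
    have "w \<notin> F (i + 12)"
      using F_dist'[OF u, of w "i + 12" 7] w pu d_sym[of w u] E_V[OF w(1)] F_V[OF u] by auto
    then have "w \<in> F (i + 10)" using F_step[OF p(2) w(1)] by (auto simp: algebra_simps)
    then have "w = v" using dn_unique[OF dn11 p(2) w(1) E_sym[OF p(1)]] v by (simp add: algebra_simps)
    then show "d u v = 5" using w pu d_sym F_V u v by simp
  qed
qed

lemma singleton_of_tight:
  assumes "tight i k" "k \<le> 6"
  shows "\<exists>j c. F j = {c}"
  using assms
proof (induction k arbitrary: i rule: less_induct)
  case (less k)
  note t = less.prems(1)
  show ?case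
  proof (cases "\<exists>k'<k. \<exists>i. tight i k'")
    case True
    then obtain k' i' where "k' < k" "tight i' k'" by blast
    then show ?thesis using less.IH less.prems(2) by simp
  next
    case False
    then have least: "\<not> tight j k'" if "k' < k" for j k' using that by blast
    consider "k = 0" | "1 \<le> k \<and> k \<le> 2" | "k = 3" | "k = 4" | "k = 5" | "k = 6"
      using less.prems(2) by linarith
    then show ?thesis
    proof cases
      case 1
      obtain c where c: "c \<in> F i" using F_ex by blast
      have "u = c" if "u \<in> F i" for u using t c that d_eq_0[of u c] F_V 1 by (auto simp: tight_def)
      then have "F i = {c}" using c by blast
      then show ?thesis by blast
    next
      case 2
      have l: "\<not> tight (i + 1) (k - 1)" "\<not> tight i (k - 1)" using least 2 by auto
      have "dn (i + 1) = 1" "up (i + int k - 1) = 1" "up i \<noteq> 1"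
        using tight_dn_next[OF t] tight_up_prev[OF t] tight_next[OF t] 2 l by auto
      \<comment> \<open>For \<open>k = 1\<close> the value \<open>up (i + int k - 1) = 1\<close>
        contradicts \<open>up i \<noteq> 1\<close>; for \<open>k = 2\<close> it sits at
        \<open>i + 1\<close>, where \<open>dn\<close> is 1 as well.\<close>
      moreover have "i + int k - 1 = i \<or> i + int k - 1 = i + 1" using 2 by linarith
      ultimately show ?thesis using up_dn_not_1[of "i + 1"] by metis
    next
      case 3
      have "dn (i + 1) = 1" "up (i + 1) = 1"
        using tight_dn_next[OF t] tight_up_second[OF t] 3 least by (auto simp: add.commute)
      then show ?thesis using up_dn_not_1 by blast
    next
      case 4
      have "dn (i + 2) = 1" "up (i + 2) = 1"
        using tight_dn_second[OF t] tight_up_second[OF t] 4 least by (auto simp: add.commute)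
      then show ?thesis using up_dn_not_1 by blast
    next
      case 5
      have l4: "\<not> tight j 4" for j using least 5 by simp
      have t5: "tight i 5" using t 5 by simp
      \<comment> \<open>Three shifts by 5 lead to \<open>i + 15\<close>, which is
        \<open>i - 1\<close> modulo 16. There \<open>up\<close> must differ from 1 because no
        shorter tight pair exists, yet \<open>tight_up_before\<close> makes it 1.\<close>
      have "tight (i + 5) 5" by (rule tight_5_shift[OF t5 l4])
      then have "tight (i + 10) 5" using tight_5_shift[OF _ l4, of "i + 5"] by (simp add: add.assoc)
      then have "tight (i + 15) 5" using tight_5_shift[OF _ l4, of "i + 10"] by (simp add: add.assoc)
      then have "up (i + 15) \<noteq> 1" using tight_next[of "i + 15" 5] l4 by auto
      moreover have "up (i - 1) = 1" using tight_up_before[OF t5] by simp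
      ultimately show ?thesis using up_shift[of "i - 1"] by (simp add: algebra_simps)
    next
      case 6
      have l5: "\<not> tight j 5" for j using least 6 by simp
      have t6: "tight i 6" using t 6 by simp
      have dn_next: "dn (j + 1) = 1" if "tight j 6" for j using tight_dn_next[OF that] l5 by simp
      have up_prev: "up (j + 5) = 1" if "tight j 6" for j using tight_up_prev[OF that] l5 by (simp add: add.commute)
      have n: "up i \<noteq> 1" "dn (i + 6) \<noteq> 1" using tight_next[OF t6] tight_prev[OF t6] l5 by auto
      \<comment> \<open>The clash occurs at \<open>i + 11\<close>: the value 1 of \<open>dn\<close>
        comes down from \<open>i + 17\<close>, that is \<open>i + 1\<close>, and the value 1 of
        \<open>up\<close> comes up from \<open>i + 5\<close>. Tightness at \<open>i + 11\<close> or
        \<open>i + 5\<close> would contradict \<open>n\<close>.\<close>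
      have "\<not> tight (i + 11) 6" using up_prev[of "i + 11"] n(1) up_shift[of i] by (auto simp: add.assoc)
      moreover have "dn (i + 11 + 6) = 1" using dn_next[OF t6] dn_shift[of "i + 1"] by (simp add: add.assoc)
      ultimately have "dn (i + 11) = 1" by (rule dn_mono_6)
      moreover have "\<not> tight (i + 5) 6" using dn_next[of "i + 5"] n(2) by (auto simp: add.assoc)
      then have "up (i + 5 + 6) = 1" using up_mono_6 up_prev[OF t6] by blast
      ultimately show ?thesis using up_dn_not_1[of "i + 11"] by (simp add: add.assoc)
    qed
  qed
qed

end

section \<open>Existence of a singleton fibre\<close>

context wrap
begin

section \<open>Consequences of a singleton fibre for the other fibres\<close>

lemma reach_down: "u \<in> F (i + int k) \<Longrightarrow> \<exists>v\<in>F i. d u v \<le> k"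
proof (induction k arbitrary: u)
  case 0
  then show ?case using d_eq_0 F_V by (intro bexI[of _ u]) auto
next
  case (Suc k)
  then obtain w where w: "E u w" "w \<in> F (i + int k)" using lift_down[of u "i + int (Suc k)"] by auto
  then obtain v where "v \<in> F i" "d w v \<le> k" using Suc.IH by blast
  then show ?case using d_E[OF w(1), of v] F_V by (intro bexI[of _ v]) auto
qed

text \<open>Going down \<open>k\<close> times must end in \<open>c\<close>, which bounds the
  distance from above; \<open>F_dist\<close> bounds it from below.\<close>

lemma singleton_dist:
  assumes "F i = {c}" "u \<in> F (i + int k)" "k \<le> 8"
  shows "d u c = k"
proof -
  have "d u c \<le> k" using reach_down[OF assms(2)] assms(1) by auto
  moreover have "k \<le> d c u" using F_dist[of c i u k] assms by auto
  ultimately show ?thesis using d_sym[of u c] F_V assms by fastforce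
qed

lemma down_unique_of_singleton:
  assumes "F i = {c}" "1 \<le> k" "k \<le> 7" "u \<in> F (i + int k)"
    "E u v" "E u v'" "v \<in> F (i + int k - 1)" "v' \<in> F (i + int k - 1)"
  shows "v = v'"
proof -
  have eq: "i + int k - 1 = i + int (k - 1)" using assms(2) by simp
  have "d u c = k" using singleton_dist[OF assms(1,4)] assms(3) by simp
  moreover have "d w c = k - 1" if "w \<in> F (i + int k - 1)" for w
    using singleton_dist[OF assms(1), of w "k - 1"] that assms(3) unfolding eq by simp
  ultimately have "d u c < 8" "d u c = Suc (d v c)" "d u c = Suc (d v' c)"
    using assms(2,3,7,8) by simp_all
  moreover have "c \<in> V" using F_V assms(1) by blast
  ultimately show ?thesis using closer_unique[OF assms(5,6)] by blast
qed

text \<open>Thickness is asked at odd positions only, since in the application the even ones carry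
  points with two lines each. An element over 1 has a single lower neighbour, so two elements lie
  over 2. Their lifts stay distinct up to position 7 because lower neighbours are unique there, and
  position 8 is reached from 7 as 2 is from 1.\<close>

lemma two_in_fibre:
  assumes "F 0 = {b}" and three: "\<And>i u. odd i \<Longrightarrow> u \<in> F i \<Longrightarrow> \<exists>X\<subseteq>nbs u. card X = 3"
    and "2 \<le> k" "k \<le> 8"
  shows "\<exists>u v. u \<in> F (int k) \<and> v \<in> F (int k) \<and> u \<noteq> v"
proof -
  have two: "\<exists>v v'. v \<in> F (i + 1) \<and> v' \<in> F (i + 1) \<and> v \<noteq> v'"
    if u: "odd i" "u \<in> F i" and un: "\<And>v v'. E u v \<Longrightarrow> E u v' \<Longrightarrow> v \<in> F (i - 1) \<Longrightarrow> v' \<in> F (i - 1) \<Longrightarrow> v = v'" for i u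
  proof -
    obtain X where X: "X \<subseteq> nbs u" "card X = 3" using three[OF u] by blast
    then obtain x y z where "X = {x, y, z}" and ne: "x \<noteq> y" "y \<noteq> z" "x \<noteq> z"
      unfolding card_3_iff by blast
    then have "E u x" "E u y" "E u z" using X by (auto simp: nbs_def)
    then show ?thesis using F_step[OF u(2)] un ne by metis
  qed
  show ?thesis using assms(3,4)
  proof (induction k)
    case 0
    then show ?case by simp
  next
    case (Suc k)
    consider "k = 1" | "k = 7" | "2 \<le> k" "k < 7" using Suc.prems by linarith
    then show ?case
    proof cases
      case 1
      obtain l where "l \<in> F 1" using F_ex by blast
      then show ?thesis using two[of 1 l] assms(1) 1 by simp
    next
      case 2
      obtain l where "l \<in> F 7" using F_ex by blast
      then show ?thesis using two[of 7 l] down_unique_of_singleton[OF assms(1), of 7 l] 2 by simp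
    next
      case 3
      then obtain u v where uv: "u \<in> F (int k)" "v \<in> F (int k)" "u \<noteq> v" using Suc.IH by auto
      obtain u' v' where u': "E u u'" "u' \<in> F (int k + 1)" and v': "E v v'" "v' \<in> F (int k + 1)"
        using lift_up uv by blast
      have "u' \<noteq> v'"
      proof
        assume "u' = v'"
        then have "u = v"
          using down_unique_of_singleton[OF assms(1), of "Suc k" u' u v] u' v' uv E_sym 3
          by (simp add: add.commute)
        then show False using uv(3) by simp
      qed
      then show ?thesis using u'(2) v'(2) by (intro exI[of _ u'] exI[of _ v']) (simp add: add.commute)
    qed
  qed
qed

text \<open>\<open>two_in_fibre\<close> and its reflection leave only -1, 0 and 1. The positions -1
  and 1 stay possible, as a centre with two neighbours may have one on each side.\<close>

lemma singleton_near_centre: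
  assumes b: "F 0 = {b}" and three: "\<And>i u. odd i \<Longrightarrow> u \<in> F i \<Longrightarrow> \<exists>X\<subseteq>nbs u. card X = 3"
    and "F j = {c}"
  shows "\<exists>i\<in>{-1, 0, 1}. F i = {c}"
proof -
  interpret R: wrap V E d "\<lambda>u. - \<phi> u" by (rule wrap_reflect)
  define r where "r = j mod 16"
  have Fr: "F r = {c}" using F_mod[of r j] assms(3) unfolding r_def by (simp add: mod_eq_dvd_iff[symmetric])
  have F16: "F (r - 16) = {c}" using F_mod[of "r - 16" r] Fr by simp
  have r: "0 \<le> r" "r < 16" by (simp_all add: r_def)
  have False if "2 \<le> r" "r \<le> 8"
  proof -
    have "\<exists>u v. u \<in> F (int (nat r)) \<and> v \<in> F (int (nat r)) \<and> u \<noteq> v"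
      using that by (intro two_in_fibre[OF b three]) auto
    then show False using Fr that by auto
  qed
  moreover have False if "8 \<le> r" "r \<le> 14"
  proof -
    have "\<exists>X\<subseteq>nbs u. card X = 3" if "odd i" "u \<in> R.F i" for i u
      using three[of "- i"] that by (simp add: F_reflect)
    moreover have "R.F 0 = {b}" using b by (simp add: F_reflect)
    ultimately have "\<exists>u v. u \<in> R.F (int (nat (16 - r))) \<and> v \<in> R.F (int (nat (16 - r))) \<and> u \<noteq> v"
      using that by (intro R.two_in_fibre[of b]) auto
    then show False using F16 that by (auto simp: F_reflect)
  qed
  ultimately have "r \<in> {0, 1, 15}" using r by force
  then show ?thesis using Fr F16 by force
qed

end

section \<open>Existence of a tight pair of positions 6 apart\<close>

context thick_wrap
begin

text \<open>The walk \<open>x, l1, z, l, z', m, w, q, y\<close> over the positions \<open>0, 1, 2, 3, 2, 3, 4, 5, 6\<close> is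
  folded once in the middle. It joins opposite elements, so that \<open>l1\<close> projects to \<open>q\<close>, while by
  counting every neighbour of \<open>y\<close> over \<open>5\<close> is the projection of a neighbour of \<open>x\<close> over \<open>-1\<close>.\<close>

lemma folded_walk:
  assumes fin: "\<And>u. u \<in> F (i + 6) \<Longrightarrow> finite (nbs u)"
    and eq: "dn i = dn (i + 6)" and up: "up (i + 2) \<noteq> 1"
  shows "dn (i + 3) = 1"
proof (rule ccontr)
  assume "dn (i + 3) \<noteq> 1"
  obtain l where l: "l \<in> F (i + 3)" using F_ex by blast
  obtain z where z: "E l z" "z \<in> F (i + 2)" using lift_down[OF l] by (auto simp: add.commute)
  obtain z' where z': "z' \<noteq> z" "E l z'" "z' \<in> F (i + 2)"
    using dn_other[OF \<open>dn (i + 3) \<noteq> 1\<close> l, of z] by (auto simp: add.commute)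
  obtain l1 where l1: "E z l1" "l1 \<in> F (i + 1)" using lift_down[OF z(2)] by (auto simp: add.commute)
  obtain x where x: "E l1 x" "x \<in> F i" using lift_down[OF l1(2)] by (auto simp: add.commute)
  obtain m where m: "m \<noteq> l" "E z' m" "m \<in> F (i + 3)"
    using up_other[OF up z'(3), of l] by (auto simp: add.assoc)
  obtain w where w: "E m w" "w \<in> F (i + 4)" using lift_up[OF m(3)] by (auto simp: add.assoc)
  obtain q where q: "E w q" "q \<in> F (i + 5)" using lift_up[OF w(2)] by (auto simp: add.assoc)
  obtain y where y: "E q y" "y \<in> F (i + 6)" using lift_up[OF q(2)] by (auto simp: add.assoc)
  have ne: "a \<noteq> b" if "a \<in> F (i + s)" "b \<in> F (i + s + 2)" for a b s
    using F_diff[OF that(1), of "i + s + 2"] that(2) by auto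
  have n: "x \<noteq> z" "l1 \<noteq> l" "z' \<noteq> w" "m \<noteq> q" "w \<noteq> y"
    using ne[of x 0 z] ne[of l1 1 l] ne[of z' 2 w] ne[of m 3 q] ne[of w 4 y]
      x l1 z l z' m w q y by (auto simp: add.assoc)
  have V: "x \<in> V" "l1 \<in> V" using F_V x l1 by auto
  have dx: "d l1 x = 1" "d x x = 0" using d_edge[OF x(1)] d_eq_0[of x x] V by auto
  have 1: "d z x = 2" using farther[OF x(1) E_sym[OF l1(1)] n(1) V(1)] dx by simp
  have 2: "d l x = 3" using farther[OF l1(1) E_sym[OF z(1)] n(2) V(1)] dx 1 by simp
  have 3: "d z' x = 4" using farther[OF z(1) z'(2) z'(1)[symmetric] V(1)] 1 2 by simp
  have 4: "d m x = 5" using farther[OF E_sym[OF z'(2)] m(2) m(1)[symmetric] V(1)] 2 3 by simp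
  have 5: "d w x = 6" using farther[OF E_sym[OF m(2)] w(1) n(3) V(1)] 3 4 by simp
  have 6: "d q x = 7" using farther[OF E_sym[OF w(1)] q(1) n(4) V(1)] 4 5 by simp
  have 7: "d y x = 8" using farther[OF E_sym[OF q(1)] y(1) n(5) V(1)] 5 6 by simp
  have dl: "d z l1 = 1" "d l1 l1 = 0" using d_edge[OF l1(1)] d_eq_0[of l1 l1] V by auto
  have b2: "d l l1 = 2" using farther[OF l1(1) E_sym[OF z(1)] n(2) V(2)] dl by simp
  have b3: "d z' l1 = 3" using farther[OF z(1) z'(2) z'(1)[symmetric] V(2)] dl b2 by simp
  have b4: "d m l1 = 4" using farther[OF E_sym[OF z'(2)] m(2) m(1)[symmetric] V(2)] b2 b3 by simp
  have b5: "d w l1 = 5" using farther[OF E_sym[OF m(2)] w(1) n(3) V(2)] b3 b4 by simp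
  have b6: "d q l1 = 6" using farther[OF E_sym[OF w(1)] q(1) n(4) V(2)] b4 b5 by simp
  have xy: "d x y = 8" "d l1 q = 6" using 7 b6 d_sym V F_V[OF y(2)] F_V[OF q(2)] by auto
  obtain \<pi> where pi: "inj_on \<pi> (nb x (i - 1))" "\<pi> ` nb x (i - 1) \<subseteq> nb y (i + 5)"
    "\<And>l m. E x l \<Longrightarrow> E y m \<Longrightarrow> d l m = 6 \<Longrightarrow> m = \<pi> l" "inj_on \<pi> (nbs x)"
    using proj_6[OF x(2) y(2) xy(1)] by metis
  have "nb y (i + 5) \<subseteq> nbs y" by (auto simp: nb_def nbs_def)
  then have finy: "finite (nb y (i + 5))" using fin[OF y(2)] finite_subset by blast
  have cx: "card (nb x (i - 1)) = dn i" using dn_card[OF x(2)] .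
  have "card (nb y (i + 6 - 1)) = dn (i + 6)" using dn_card[OF y(2)] .
  then have cy: "card (nb y (i + 5)) = dn (i + 6)" by (simp add: add.commute)
  have "\<pi> ` nb x (i - 1) = nb y (i + 5)"
    using card_subset_eq[OF finy pi(2)] card_image[OF pi(1)] cx cy eq by simp
  moreover have "q \<in> nb y (i + 5)" using q y E_sym by (simp add: nb_def)
  ultimately obtain l' where l': "l' \<in> nb x (i - 1)" "q = \<pi> l'" by blast
  have "q = \<pi> l1" using pi(3)[OF E_sym[OF x(1)] E_sym[OF y(1)] xy(2)] .
  then have "l' = l1" using pi(4) l' E_sym[OF x(1)] by (auto simp: inj_on_def nb_def nbs_def)
  moreover have "l1 \<in> nb x (i + 1)" using l1 x E_sym by (simp add: nb_def)
  ultimately show False using l'(1) nb_disj by blast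
qed

lemma ex_tight_6:
  assumes deg: "\<And>i u. even i \<Longrightarrow> u \<in> F i \<Longrightarrow> finite (nbs u) \<and> card (nbs u) = T"
  shows "\<exists>i. tight i 6"
proof (rule ccontr)
  assume no: "\<nexists>i. tight i 6"
  interpret R: thick_wrap V E d "\<lambda>u. - \<phi> u" by (rule thick_wrap_reflect)
  have le: "dn i \<le> dn (i + 6)" if "even i" for i
  proof -
    obtain u v where uv: "u \<in> F i" "v \<in> F (i + 6)" "d u v = 8" using not_tight_6_opposite no by blast
    obtain \<pi> where pi: "inj_on \<pi> (nb u (i - 1))" "\<pi> ` nb u (i - 1) \<subseteq> nb v (i + 5)"
      using proj_6[OF uv] by metis
    have "nb v (i + 5) \<subseteq> nbs v" by (auto simp: nb_def nbs_def)
    then have fv: "finite (nb v (i + 5))" using deg[of "i + 6" v] uv(2) that finite_subset by simp blast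
    have cv: "card (nb v (i + 6 - 1)) = dn (i + 6)" using dn_card[OF uv(2)] .
    have "i + 6 - 1 = i + 5" by simp
    then show ?thesis using card_inj_on_le[OF pi fv] dn_card[OF uv(1)] cv by metis
  qed
  have eq: "dn i = dn (i + 6)" if "even i" for i
  proof -
    \<comment> \<open>Eight steps of 6 add up to 48, three full turns, so the chain of inequalities
      closes up.\<close>
    have "dn (i + 6) \<le> dn (i + 12)" "dn (i + 12) \<le> dn (i + 18)" "dn (i + 18) \<le> dn (i + 24)"
      "dn (i + 24) \<le> dn (i + 30)" "dn (i + 30) \<le> dn (i + 36)" "dn (i + 36) \<le> dn (i + 42)"
      "dn (i + 42) \<le> dn (i + 48)"
      using le[of "i + 6"] le[of "i + 12"] le[of "i + 18"] le[of "i + 24"] le[of "i + 30"]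
        le[of "i + 36"] le[of "i + 42"] that by (simp_all add: add.assoc)
    moreover have "dn (i + 48) = dn i"
      using dn_shift[of i] dn_shift[of "i + 16"] dn_shift[of "i + 32"] by (simp add: add.assoc)
    ultimately show ?thesis using le[OF that] by linarith
  qed
  \<comment> \<open>Four steps of 6 make 24, which is the opposite position modulo 16.\<close>
  have up_dn: "up i = dn i" if "even i" for i
    using eq[of i] eq[of "i + 6"] eq[of "i + 12"] eq[of "i + 18"] dn_shift[of "i + 8"] up_opp[of i] that
    by (simp add: add.assoc)
  have n1: "up i \<noteq> 1" if "even i" for i using up_dn_not_1 up_dn that by metis
  have fin: "finite (nbs u)" if "even i" "u \<in> F i" for i u using deg that by blast
  \<comment> \<open>The folded walk from 0 to 6 and its mirror image from 6 to 0 both bear on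
    position 3, in opposite directions.\<close>
  have "dn 3 = 1" using folded_walk[of 0] fin[of 6] eq[of 0] n1[of 2] by simp
  moreover have "up 3 = 1"
  proof -
    have "R.dn (- 6) = R.dn (- 6 + 6)" using up_dn[of 6] up_dn[of 0] eq[of 0] by (simp add: dn_reflect)
    moreover have "R.up (- 6 + 2) \<noteq> 1" using up_dn[of 4] n1[of 4] by (simp add: up_reflect)
    moreover have "finite (nbs u)" if "u \<in> R.F (- 6 + 6)" for u using fin[of 0] that by (simp add: F_reflect)
    ultimately have "R.dn (- 6 + 3) = 1" by (rule R.folded_walk[rotated])
    then show ?thesis by (simp add: dn_reflect)
  qed
  ultimately show False using up_dn_not_1 by blast
qed

theorem singleton_fibre:
  assumes "\<And>i u. even i \<Longrightarrow> u \<in> F i \<Longrightarrow> finite (nbs u) \<and> card (nbs u) = T"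
  shows "\<exists>j c. F j = {c}"
proof -
  have "\<exists>i. tight i 6" by (rule ex_tight_6) (rule assms)
  then show ?thesis using singleton_of_tight by blast
qed

end

section \<open>Position maps with a prescribed centre\<close>

locale centred = polygon 8 V E d for V :: "'v set" and E d +
  fixes c :: 'v and N1 N2 :: "'v set"
  assumes c: "c \<in> V" and N1: "N1 \<noteq> {}" and N2: "N2 \<noteq> {}"
    and N: "N1 \<union> N2 = nbs c" "N1 \<inter> N2 = {}"
begin

text \<open>At distances 1 to 7 the only candidate for \<open>w\<close> is the projection of
  \<open>u\<close> to the centre. The centre itself is not on this side, harmlessly, as its position
  is 0 either way.\<close>

definition side :: "'v \<Rightarrow> bool" where
  "side u \<longleftrightarrow> (\<exists>w\<in>N1. d u c = Suc (d u w))"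

text \<open>The two sides are told apart by the projection to the centre; elements opposite to the centre
  have no projection, but for them \<open>8\<close> and \<open>-8\<close> agree modulo \<open>16\<close>.\<close>

definition pos :: "'v \<Rightarrow> int" where
  "pos u = (if d u c = 8 \<or> side u then int (d u c) else - int (d u c))"

lemma abs_pos: "\<bar>pos u\<bar> = int (d u c)"
  by (simp add: pos_def)

lemma N1_side: "v \<in> N1 \<Longrightarrow> side v \<and> d v c = 1"
  and N2_side: "v \<in> N2 \<Longrightarrow> \<not> side v \<and> d v c = 1"
proof -
  have 1: "E c v \<and> d v c = 1" if "v \<in> nbs c" for v
    using that d_edge[OF E_sym] by (auto simp: nbs_def)
  have zero: "d v w = 0 \<longleftrightarrow> v = w" if "v \<in> nbs c" "w \<in> nbs c" for v w
    using that d_eq_0 E_V by (auto simp: nbs_def)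
  show "side v \<and> d v c = 1" if v: "v \<in> N1"
  proof -
    have "v \<in> nbs c" using v N by blast
    then show ?thesis using 1[of v] zero[of v v] v by (auto simp: side_def intro!: bexI[of _ v])
  qed
  show "\<not> side v \<and> d v c = 1" if v: "v \<in> N2"
  proof -
    have "d v w \<noteq> 0" if "w \<in> N1" for w using zero[of v w] that v N by auto
    moreover have "d v c = 1" using 1[of v] v N by blast
    ultimately show ?thesis by (auto simp: side_def)
  qed
qed

text \<open>The neighbour \<open>w0\<close> of the centre nearest to \<open>u\<close> is also
  nearest to \<open>v\<close>, and below distance 8 it is the only one.\<close>

lemma side_next:
  assumes "E u v" "u \<noteq> c" "d v c = Suc (d u c)" "d v c < 8"
  shows "side v \<longleftrightarrow> side u"
proof -
  have V: "u \<in> V" "v \<in> V" using E_V assms(1) by auto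
  have sym: "d c x = d x c" if "x \<in> V" for x using d_sym c that by blast
  obtain w0 where w0: "E c w0" "d c u = Suc (d w0 u)" using closer_ex c V assms(2) by blast
  have w0V: "w0 \<in> V" using w0 E_V by blast
  have u0: "d u c = Suc (d u w0)" using w0(2) sym[OF V(1)] d_sym[OF w0V V(1)] by simp
  have "d c v = Suc (d w0 v) \<or> d w0 v = Suc (d c v)" by (rule d_E[OF w0(1) V(2)])
  then have v0: "d v c = Suc (d v w0)"
    using d_E[OF assms(1) w0V] u0 assms(3) sym[OF V(2)] d_sym[OF w0V V(2)] by linarith
  have "side x \<longleftrightarrow> w0 \<in> N1" if x: "x \<in> V" "d x c < 8" "d x c = Suc (d x w0)" for x
  proof
    assume "side x"
    then obtain w where w: "w \<in> N1" "d x c = Suc (d x w)" by (auto simp: side_def)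
    have cw: "E c w" using w(1) N by (auto simp: nbs_def)
    have "d c x = Suc (d w x)" "d c x = Suc (d w0 x)" "d c x < 8"
      using w(2) x(2,3) sym[OF x(1)] d_sym[OF x(1), of w] d_sym[OF x(1) w0V] E_V[OF cw] by linarith+
    then have "w = w0" using closer_unique[OF cw w0(1) x(1)] by blast
    then show "w0 \<in> N1" using w(1) by simp
  qed (use x in \<open>auto simp: side_def\<close>)
  then show ?thesis using u0 v0 assms(3,4) V by simp
qed

lemma pos_next:
  assumes "E u v" "d v c = Suc (d u c)"
  shows "16 dvd pos v - pos u - 1 \<or> 16 dvd pos v - pos u + 1"
proof -
  consider "u = c" | "u \<noteq> c" "d v c < 8" | "d v c = 8"
    using d_le[of v c] E_V assms(1) c by fastforce
  then show ?thesis
  proof cases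
    case 1
    then have "\<bar>pos v\<bar> = 1" "pos u = 0" using abs_pos[of v] abs_pos[of u] assms(2) d_eq_0[OF c c] by auto
    then show ?thesis by (cases "pos v \<ge> 0") auto
  next
    case 2
    then have "side v = side u" using side_next assms by blast
    then show ?thesis using 2(2) assms(2) by (auto simp: pos_def)
  next
    case 3
    then have "pos v = 8" "pos u = 7 \<or> pos u = - 7" using assms(2) by (auto simp: pos_def)
    then show ?thesis by auto
  qed
qed

lemma pos_step:
  assumes "E u v"
  shows "16 dvd pos v - pos u - 1 \<or> 16 dvd pos v - pos u + 1"
proof -
  have swap: "16 dvd x \<longleftrightarrow> 16 dvd - x" for x :: int by simp
  have "d v c = Suc (d u c) \<or> d u c = Suc (d v c)" using d_E[OF assms c] by auto
  then show ?thesis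
    using pos_next[OF assms] pos_next[OF E_sym[OF assms]]
      swap[of "pos u - pos v - 1"] swap[of "pos u - pos v + 1"] by (auto simp: algebra_simps)
qed

lemma reach_side:
  assumes "1 \<le> k" "k \<le> 7"
  shows "\<exists>u\<in>V. d u c = k \<and> side u = b"
  using assms
proof (induction k rule: dec_induct)
  case base
  obtain v1 v2 where "v1 \<in> N1" "v2 \<in> N2" using N1 N2 by blast
  then have "v1 \<in> V" "v2 \<in> V" using N E_V by (auto simp: nbs_def)
  then show ?case using N1_side N2_side \<open>v1 \<in> N1\<close> \<open>v2 \<in> N2\<close> by (cases b) auto
next
  case (step k)
  then obtain u where u: "u \<in> V" "d u c = k" "side u = b" by auto
  obtain v where v: "E u v" "d v c = Suc (d u c)" using farther_ex[OF u(1) c] u(2) step by auto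
  have "u \<noteq> c" using u(2) step d_eq_0[OF c c] by auto
  then have "side v = side u" using side_next[OF v(1)] v(2) u(2) step by simp
  then show ?case using u v E_V by auto
qed

lemma pos_onto: "\<exists>u\<in>V. 16 dvd pos u - i"
proof -
  define r where "r = i mod 16"
  have r: "0 \<le> r" "r < 16" by (simp_all add: r_def)
  have "\<exists>u\<in>V. pos u = r \<or> pos u = r - 16"
  proof -
    consider "r = 0" | "1 \<le> r" "r \<le> 7" | "r = 8" | "9 \<le> r" using r by linarith
    then show ?thesis
    proof cases
      case 1
      then show ?thesis using c d_eq_0[OF c c] by (intro bexI[of _ c]) (auto simp: pos_def)
    next
      case 2
      then have "1 \<le> nat r" "nat r \<le> 7" by linarith+
      then obtain u where "u \<in> V" "d u c = nat r" "side u" using reach_side[of "nat r" True] by auto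
      then show ?thesis using 2 by (intro bexI[of _ u]) (auto simp: pos_def)
    next
      case 3
      obtain u where u: "u \<in> V" "d u c = 7" using reach_side[of 7 True] by auto
      then obtain v where "E u v" "d v c = 8" using farther_ex[OF u(1) c] by auto
      then show ?thesis using 3 E_V by (intro bexI[of _ v]) (auto simp: pos_def)
    next
      case 4
      then have "1 \<le> nat (16 - r)" "nat (16 - r) \<le> 7" using r by linarith+
      then obtain u where "u \<in> V" "d u c = nat (16 - r)" "\<not> side u"
        using reach_side[of "nat (16 - r)" False] by auto
      then show ?thesis using 4 r by (intro bexI[of _ u]) (auto simp: pos_def)
    qed
  qed
  moreover have "16 dvd r - i" "16 dvd r - 16 - i"
    using dvd_diff[of 16 "r - i" 16] by (simp_all add: r_def mod_eq_dvd_iff[symmetric] algebra_simps)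
  ultimately show ?thesis by metis
qed

lemma pos_centre: "u \<in> V \<Longrightarrow> 16 dvd pos u \<longleftrightarrow> u = c"
proof
  assume u: "u \<in> V" "16 dvd pos u"
  have "\<bar>pos u\<bar> \<le> 8" using abs_pos[of u] d_le[OF u(1) c] by simp
  then have "pos u = 0" using u(2) zdvd_imp_le[of 16 "\<bar>pos u\<bar>"] by (cases "pos u = 0") auto
  then show "u = c" using abs_pos[of u] d_eq_0[OF u(1) c] by simp
qed (use d_eq_0[OF c c] in \<open>simp add: pos_def\<close>)

lemma pos_N1: "v \<in> N1 \<Longrightarrow> pos v = 1" and pos_N2: "v \<in> N2 \<Longrightarrow> pos v = -1"
  using N1_side N2_side by (auto simp: pos_def)

lemma wrap_pos: "wrap V E d pos"
  using pos_step pos_onto by unfold_locales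

end

section \<open>Incidence graphs of weak generalized polygons\<close>

text \<open>The graph form of a weak generalized polygon. Subgeometries carry the induced incidence,
  so the cycles excluded by \<open>no_cycle\<close> are the chordless ones; a common sub m-gon of
  two elements provides \<open>walk\<close>.\<close>

locale bipartite_gon =
  fixes m :: nat and V :: "'v set" and E :: "'v \<Rightarrow> 'v \<Rightarrow> bool" and col :: "'v \<Rightarrow> bool"
  assumes E_V: "E u v \<Longrightarrow> u \<in> V \<and> v \<in> V"
    and E_sym: "E u v \<Longrightarrow> E v u"
    and E_col: "E u v \<Longrightarrow> col v \<longleftrightarrow> \<not> col u"
    and walk: "u \<in> V \<Longrightarrow> w \<in> V \<Longrightarrow> \<exists>k\<le>m. (E ^^ k) u w"
    and two_nbs: "u \<in> V \<Longrightarrow> \<exists>v v'. E u v \<and> E u v' \<and> v \<noteq> v'"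
    and no_cycle: "2 \<le> k \<Longrightarrow> k < m \<Longrightarrow> inj_on c {..<2 * k} \<Longrightarrow>
      (\<And>i j. i < 2 * k \<Longrightarrow> j < 2 * k \<Longrightarrow>
        E (c i) (c j) \<longleftrightarrow> j = Suc i mod (2 * k) \<or> i = Suc j mod (2 * k)) \<Longrightarrow> False"
begin

definition dist :: "'v \<Rightarrow> 'v \<Rightarrow> nat" where
  "dist u w = (LEAST k. (E ^^ k) u w)"

lemma walk_dist: "u \<in> V \<Longrightarrow> w \<in> V \<Longrightarrow> (E ^^ dist u w) u w"
  unfolding dist_def using walk by (metis LeastI)

lemma dist_le: "(E ^^ k) u w \<Longrightarrow> dist u w \<le> k"
  unfolding dist_def by (rule Least_le)

lemma walk_sym: "(E ^^ k) u w \<Longrightarrow> (E ^^ k) w u"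
proof (induction k arbitrary: w)
  case 0
  then show ?case by auto
next
  case (Suc k)
  then obtain y where "(E ^^ k) u y" "E y w" by (auto elim: relpowp_Suc_E)
  then show ?case using Suc.IH E_sym relpowp_Suc_I2 by metis
qed

lemma dist_sym: "u \<in> V \<Longrightarrow> w \<in> V \<Longrightarrow> dist u w = dist w u"
  using dist_le[OF walk_sym[OF walk_dist[of u w]]] dist_le[OF walk_sym[OF walk_dist[of w u]]] by simp

lemma dist_0: "u \<in> V \<Longrightarrow> w \<in> V \<Longrightarrow> dist u w = 0 \<longleftrightarrow> u = w"
  using walk_dist[of u w] dist_le[of 0 u w] by auto

lemma walk_parity: "(E ^^ k) u w \<Longrightarrow> even k \<longleftrightarrow> (col u \<longleftrightarrow> col w)"
proof (induction k arbitrary: w)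
  case 0
  then show ?case by auto
next
  case (Suc k)
  then obtain y where "(E ^^ k) u y" "E y w" by (auto elim: relpowp_Suc_E)
  then show ?case using Suc.IH[of y] E_col[of y w] by simp
qed

lemma dist_edge:
  assumes "E u v" "w \<in> V"
  shows "dist u w = Suc (dist v w) \<or> dist v w = Suc (dist u w)"
proof -
  have V: "u \<in> V" "v \<in> V" using assms E_V by auto
  have "dist u w \<le> Suc (dist v w)" "dist v w \<le> Suc (dist u w)"
    using dist_le relpowp_Suc_I2[OF assms(1) walk_dist[OF V(2) assms(2)]]
      relpowp_Suc_I2[OF E_sym[OF assms(1)] walk_dist[OF V(1) assms(2)]] by auto
  moreover have "dist u w \<noteq> dist v w"
    using walk_parity[OF walk_dist[OF V(1) assms(2)]] walk_parity[OF walk_dist[OF V(2) assms(2)]]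
      E_col[OF assms(1)] by metis
  ultimately show ?thesis by linarith
qed

lemma dist_closer:
  assumes "u \<in> V" "w \<in> V" "u \<noteq> w"
  shows "\<exists>v. E u v \<and> dist u w = Suc (dist v w)"
proof -
  obtain k where k: "dist u w = Suc k" using dist_0 assms by (cases "dist u w") auto
  then have "(E ^^ Suc k) u w" using walk_dist assms by metis
  then obtain v where v: "E u v" "(E ^^ k) v w" by (blast dest: relpowp_Suc_D2)
  then have "dist v w \<le> k" by (simp add: dist_le)
  then show ?thesis using dist_edge[OF v(1) assms(2)] k v(1) by auto
qed

lemma dist_triangle:
  assumes "u \<in> V" "y \<in> V" "w \<in> V"
  shows "dist u w \<le> dist u y + dist y w"
  using walk_dist[of u y] walk_dist[of y w] assms by (intro dist_le) (auto simp: relpowp_add)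

text \<open>A chosen geodesic from \<open>v\<close> to \<open>w\<close>, meaningful for indices up
  to \<open>dist v w\<close>.\<close>

definition descent :: "'v \<Rightarrow> 'v \<Rightarrow> nat \<Rightarrow> 'v" where
  "descent w v i = ((\<lambda>x. SOME y. E x y \<and> dist x w = Suc (dist y w)) ^^ i) v"

lemma descent:
  assumes "v \<in> V" "w \<in> V" "i \<le> dist v w"
  shows "descent w v i \<in> V" "dist (descent w v i) w = dist v w - i"
    "i < dist v w \<Longrightarrow> E (descent w v i) (descent w v (Suc i))" "dist v (descent w v i) \<le> i"
proof -
  have step: "E x (descent w x 1) \<and> dist x w = Suc (dist (descent w x 1) w)" if "x \<in> V" "dist x w \<noteq> 0" for x
  proof -
    have "x \<noteq> w" using dist_0[OF that(1) assms(2)] that(2) by simp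
    then show ?thesis unfolding descent_def
      using someI_ex[OF dist_closer[OF that(1) assms(2)]] by simp
  qed
  have suc: "descent w v (Suc i) = descent w (descent w v i) 1" for i by (simp add: descent_def)
  have *: "descent w v i \<in> V \<and> dist (descent w v i) w = dist v w - i \<and> dist v (descent w v i) \<le> i"
    if "i \<le> dist v w" for i
    using that
  proof (induction i)
    case 0
    then show ?case using assms dist_0[of v v] by (simp add: descent_def)
  next
    case (Suc i)
    then have i: "descent w v i \<in> V" "dist (descent w v i) w = dist v w - i" "dist v (descent w v i) \<le> i"
      by auto
    then have s: "E (descent w v i) (descent w v (Suc i))"
      "dist (descent w v i) w = Suc (dist (descent w v (Suc i)) w)"
      using step[of "descent w v i"] Suc.prems unfolding suc by auto
    then have "descent w v (Suc i) \<in> V" using E_V by blast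
    moreover have "dist v (descent w v (Suc i)) \<le> Suc i"
      using dist_le[OF relpowp_Suc_I[OF walk_dist[OF assms(1) i(1)] s(1)]] i(3) by simp
    ultimately show ?case using s(2) i(2) by simp
  qed
  show "descent w v i \<in> V" "dist (descent w v i) w = dist v w - i" "dist v (descent w v i) \<le> i"
    using * assms by auto
  show "E (descent w v i) (descent w v (Suc i))" if "i < dist v w"
    using step[of "descent w v i"] *[of i] that unfolding suc by auto
qed

text \<open>A shortest violation produces two geodesics that meet only in their ends; they form a cycle
  without chords.\<close>

lemma dist_closer_unique:
  assumes "dist u w < m" "w \<in> V" "E u v" "E u v'" "dist u w = Suc (dist v w)" "dist u w = Suc (dist v' w)"
  shows "v = v'"
  using assms
proof (induction "dist u w" arbitrary: u w v v' rule: less_induct)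
  case less
  note km = less.prems(1) and wV = less.prems(2) and uv = less.prems(3) and uv' = less.prems(4)
    and v = less.prems(5) and v' = less.prems(6)
  define k where "k = dist u w"
  have V: "u \<in> V" "v \<in> V" "v' \<in> V" using uv uv' E_V by auto
  show ?case
  proof (rule ccontr)
    assume ne: "v \<noteq> v'"
    have k2: "2 \<le> k"
    proof (rule ccontr)
      assume "\<not> 2 \<le> k"
      then have "dist v w = 0" "dist v' w = 0" using v v' by (auto simp: k_def)
      then show False using dist_0 V wV ne by auto
    qed
    define a b where "a = descent w v" and "b = descent w v'"
    have a: "a i \<in> V" "dist (a i) w = k - 1 - i" "dist v (a i) \<le> i" if "i \<le> k - 1" for i
      using descent[OF V(2) wV, of i] that v by (auto simp: a_def k_def)
    have b: "b i \<in> V" "dist (b i) w = k - 1 - i" "dist v' (b i) \<le> i" if "i \<le> k - 1" for i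
      using descent[OF V(3) wV, of i] that v' by (auto simp: b_def k_def)
    have aE: "E (a i) (a (Suc i))" and bE: "E (b i) (b (Suc i))" if "i < k - 1" for i
      using descent(3)[OF V(2) wV, of i] descent(3)[OF V(3) wV, of i] that v v'
      by (auto simp: a_def b_def k_def)
    have a0: "a 0 = v" "b 0 = v'" by (auto simp: a_def b_def descent_def)
    have ak: "a (k - 1) = w" "b (k - 1) = w" using a[of "k - 1"] b[of "k - 1"] dist_0 wV by auto
    \<comment> \<open>Meeting early at \<open>y\<close> would make \<open>v\<close> and
      \<open>v'\<close> two neighbours of \<open>u\<close> nearer to \<open>y\<close>, a violation
      at the smaller distance \<open>Suc i\<close>.\<close>
    have ab: "a i \<noteq> b i" if i: "i < k - 1" for i
    proof
      assume eq: "a i = b i"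
      define y where "y = a i"
      have y: "y \<in> V" "dist y w = k - 1 - i" "dist v y \<le> i" "dist v' y \<le> i"
        using a[of i] b[of i] i eq by (auto simp: y_def)
      have "k \<le> dist u y + dist y w" unfolding k_def by (rule dist_triangle[OF V(1) y(1) wV])
      then have "dist u y = Suc i" "dist v y = i" "dist v' y = i"
        using dist_edge[OF uv y(1)] dist_edge[OF uv' y(1)] y i by linarith+
      then have "v = v'" using less.hyps[of u y v v'] km i y(1) uv uv' by (auto simp: k_def)
      then show False using ne by simp
    qed
    \<comment> \<open>The cycle runs from \<open>u\<close> along \<open>a\<close> to
      \<open>w\<close> at index \<open>k\<close> and returns along \<open>b\<close>, ending with
      \<open>v'\<close> at index \<open>2 * k - 1\<close>.\<close>
    define c where "c i = (if i = 0 then u else if i \<le> k then a (i - 1) else b (2 * k - 1 - i))" for i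
    have c_hi: "c i = b (2 * k - 1 - i)" if "k \<le> i" "i < 2 * k" for i
      using that ak k2 by (cases "i = k") (auto simp: c_def)
    have cV: "c i \<in> V" if "i < 2 * k" for i using that V a b by (auto simp: c_def)
    have lev: "dist (c i) w = (if i \<le> k then k - i else i - k)" if "i < 2 * k" for i
      using that a(2)[of "i - 1"] b(2)[of "2 * k - 1 - i"] by (auto simp: c_def k_def[symmetric])
    have inj: "inj_on c {..<2 * k}"
    proof (rule linorder_inj_onI)
      fix i j assume ij: "i < j" "i \<in> {..<2 * k}" "j \<in> {..<2 * k}"
      show "c i \<noteq> c j"
      proof
        assume eq: "c i = c j"
        then have s: "i < k" "k < j" "i + j = 2 * k" using lev[of i] lev[of j] ij by (auto split: if_splits)
        then have "c i = a (i - 1)" "c j = b (i - 1)" using ij by (auto simp: c_def intro: arg_cong[of _ _ b])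
        moreover have "i - 1 < k - 1" using s ij by auto
        ultimately show False using ab eq by metis
      qed
    qed auto
    have up: "E (c i) (c (Suc i))" if "Suc i < 2 * k" for i
    proof -
      consider "i = 0" | "1 \<le> i" "i < k" | "k \<le> i" by linarith
      then show ?thesis
      proof cases
        case 1
        then show ?thesis using uv a0 k2 by (simp add: c_def)
      next
        case 2
        then show ?thesis using aE[of "i - 1"] by (simp add: c_def)
      next
        case 3
        then have "c i = b (Suc (2 * k - 2 - i))" "c (Suc i) = b (2 * k - 2 - i)"
          using c_hi[of i] c_hi[of "Suc i"] that by (auto simp: Suc_diff_le intro: arg_cong[of _ _ b])
        then show ?thesis using bE[of "2 * k - 2 - i"] E_sym 3 that by auto
      qed
    qed
    have last: "E (c (2 * k - 1)) (c 0)" using c_hi[of "2 * k - 1"] a0 uv' E_sym k2 by (auto simp: c_def)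
    have adj: "E (c i) (c (Suc i mod (2 * k)))" if "i < 2 * k" for i
    proof (cases "Suc i < 2 * k")
      case True
      then show ?thesis using up by simp
    next
      case False
      then have "i = 2 * k - 1" using that by simp
      then show ?thesis using last k2 by simp
    qed
    \<comment> \<open>A chord would give its end farther from \<open>w\<close> a second neighbour
      nearer to \<open>w\<close>. For \<open>i \<noteq> 0\<close> this is excluded by induction, the
      distance to \<open>w\<close> being below \<open>k\<close>; for \<open>i = 0\<close> only
      \<open>v\<close> and \<open>v'\<close> lie at distance \<open>k - 1\<close>.\<close>
    have down: "j = Suc i mod (2 * k) \<or> i = Suc j mod (2 * k)"
      if i: "i < 2 * k" and j: "j < 2 * k" and e: "E (c i) (c j)" and l: "dist (c i) w = Suc (dist (c j) w)" for i j
    proof -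
      have uniq: "j = j'" if j': "j' < 2 * k" "E (c i) (c j')" "dist (c i) w = Suc (dist (c j') w)" "i \<noteq> 0" for j'
      proof -
        have "dist (c i) w < dist u w" using lev[OF i] i that(4) by (auto simp: k_def)
        moreover then have "dist (c i) w < m" using km by simp
        ultimately have "c j = c j'" using less.hyps[of "c i" w "c j" "c j'"] wV e j' l by blast
        then show ?thesis using inj j j'(1) by (auto dest: inj_onD)
      qed
      consider "i = 0" | "1 \<le> i" "i < k" | "k = i" | "k < i" by linarith
      then show ?thesis
      proof cases
        case 1
        then have "j = 1 \<or> j = 2 * k - 1" using lev[OF i] lev[OF j] l j k2 by (auto split: if_splits)
        then show ?thesis using 1 k2 by auto
      next
        case 2
        then have "j = Suc i" using uniq[of "Suc i"] up[of i] lev[of i] lev[of "Suc i"] by auto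
        then show ?thesis using 2 by simp
      next
        case 3
        then show ?thesis using l lev[OF i] by simp
      next
        case 4
        then have "dist (c (i - 1)) w = i - 1 - k" using lev[of "i - 1"] i by (cases "i - 1 = k") auto
        then have "dist (c i) w = Suc (dist (c (i - 1)) w)" using lev[OF i] 4 by simp
        then have "j = i - 1" using uniq[of "i - 1"] E_sym[OF up[of "i - 1"]] 4 i by simp
        then show ?thesis using 4 i by simp
      qed
    qed
    have iff: "E (c i) (c j) \<longleftrightarrow> j = Suc i mod (2 * k) \<or> i = Suc j mod (2 * k)"
      if "i < 2 * k" "j < 2 * k" for i j
    proof
      assume e: "E (c i) (c j)"
      show "j = Suc i mod (2 * k) \<or> i = Suc j mod (2 * k)"
        using dist_edge[OF e wV] down[OF that e] down[OF that(2,1) E_sym[OF e]] by blast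
    next
      assume "j = Suc i mod (2 * k) \<or> i = Suc j mod (2 * k)"
      then show "E (c i) (c j)" using adj E_sym that by blast
    qed
    show False using no_cycle[OF k2 _ inj iff] km by (simp add: k_def)
  qed
qed

lemma polygon_dist: "polygon m V E dist"
proof unfold_locales
  show "dist u w \<le> m" if "u \<in> V" "w \<in> V" for u w using walk[OF that] dist_le le_trans by blast
qed (assumption | rule E_V E_sym dist_sym dist_0 dist_edge dist_closer dist_closer_unique two_nbs)+

end

section \<open>Incidence graphs of geometries, labelled ordinary polygons and their walks\<close>

fun gadj :: "('p, 'l) geometry \<Rightarrow> 'p + 'l \<Rightarrow> 'p + 'l \<Rightarrow> bool" where
  "gadj G (Inl x) (Inr L) \<longleftrightarrow> (x, L) \<in> inc G"
| "gadj G (Inr L) (Inl x) \<longleftrightarrow> (x, L) \<in> inc G"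
| "gadj G _ _ \<longleftrightarrow> False"

lemma gadj_sym: "gadj G u v \<Longrightarrow> gadj G v u"
  by (cases u; cases v) auto

lemma gadj_isl: "gadj G u v \<Longrightarrow> isl v \<longleftrightarrow> \<not> isl u"
  by (cases u; cases v) auto

lemma gadj_elements: "point_line_geometry G \<Longrightarrow> gadj G u v \<Longrightarrow> u \<in> elements G \<and> v \<in> elements G"
  by (cases u; cases v) (auto simp: point_line_geometry_def elements_def)

lemma gadj_sub: "subgeometry H G \<Longrightarrow> gadj H u v \<Longrightarrow> gadj G u v"
  by (cases u; cases v) (auto simp: subgeometry_def)

lemma elements_sub: "subgeometry H G \<Longrightarrow> elements H \<subseteq> elements G"
  by (auto simp: subgeometry_def elements_def)

definition labelled :: "nat \<Rightarrow> ('p, 'l) geometry \<Rightarrow> (nat \<Rightarrow> 'p) \<Rightarrow> (nat \<Rightarrow> 'l) \<Rightarrow> bool" where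
  "labelled k G p l \<longleftrightarrow> bij_betw p {..<k} (points G) \<and> bij_betw l {..<k} (lines G) \<and>
     inc G = {(p i, l i) | i. i < k} \<union> {(p (Suc i mod k), l i) | i. i < k}"

lemma ordinary_gon_labelled: "ordinary_gon k G \<longleftrightarrow> 2 \<le> k \<and> (\<exists>p l. labelled k G p l)"
  by (simp add: ordinary_gon_def labelled_def)

context
  fixes k :: nat and G :: "('p, 'l) geometry" and p l
  assumes lab: "labelled k G p l" and k2: "2 \<le> k"
begin

lemma points_labelled: "points G = p ` {..<k}" and lines_labelled: "lines G = l ` {..<k}"
  using lab by (auto simp: labelled_def bij_betw_def)

lemma p_eq: "i < k \<Longrightarrow> j < k \<Longrightarrow> p i = p j \<longleftrightarrow> i = j"
  using lab by (auto simp: labelled_def bij_betw_def inj_on_def)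

lemma l_eq: "i < k \<Longrightarrow> j < k \<Longrightarrow> l i = l j \<longleftrightarrow> i = j"
  using lab by (auto simp: labelled_def bij_betw_def inj_on_def)

lemma inc_labelled: "i < k \<Longrightarrow> j < k \<Longrightarrow> (p i, l j) \<in> inc G \<longleftrightarrow> i = j \<or> i = Suc j mod k"
proof -
  assume ij: "i < k" "j < k"
  have "(p i, l j) \<in> inc G \<longleftrightarrow> (\<exists>a<k. p i = p a \<and> l j = l a) \<or> (\<exists>a<k. p i = p (Suc a mod k) \<and> l j = l a)"
    using lab by (auto simp: labelled_def)
  also have "\<dots> \<longleftrightarrow> p i = p j \<or> p i = p (Suc j mod k)" using ij l_eq by metis
  also have "\<dots> \<longleftrightarrow> i = j \<or> i = Suc j mod k" using ij p_eq k2 by simp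
  finally show ?thesis .
qed

lemma labelled_geometry: "point_line_geometry G"
  using lab points_labelled lines_labelled k2 by (auto simp: point_line_geometry_def labelled_def)

text \<open>Adding \<open>k - 1\<close> gives the cyclic predecessor without subtracting from
  0.\<close>

lemma pred_mod: "j < k \<Longrightarrow> i < k \<Longrightarrow> j = Suc i mod k \<longleftrightarrow> i = (j + (k - 1)) mod k"
proof -
  assume ij: "j < k" "i < k"
  have "(j + (k - 1)) mod k = (if j = 0 then k - 1 else j - 1)"
    using ij by (cases j) (auto simp: mod_if)
  then show ?thesis using ij by (auto simp: mod_Suc)
qed

lemma nbs_point: "j < k \<Longrightarrow> {v. gadj G (Inl (p j)) v} = {Inr (l j), Inr (l ((j + (k - 1)) mod k))}"
proof -
  assume j: "j < k"
  have "gadj G (Inl (p j)) v \<longleftrightarrow> v = Inr (l j) \<or> v = Inr (l ((j + (k - 1)) mod k))" for v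
  proof (cases v)
    case (Inr L)
    show ?thesis
    proof (cases "L \<in> lines G")
      case True
      then obtain i where "i < k" "L = l i" using lines_labelled by auto
      then show ?thesis using Inr inc_labelled[OF j] l_eq pred_mod[OF j] j by auto
    next
      case False
      then show ?thesis
        using Inr labelled_geometry lines_labelled j by (auto simp: point_line_geometry_def)
    qed
  qed simp
  then show ?thesis by blast
qed

lemma nbs_line: "j < k \<Longrightarrow> {v. gadj G (Inr (l j)) v} = {Inl (p j), Inl (p (Suc j mod k))}"
proof -
  assume j: "j < k"
  have "gadj G (Inr (l j)) v \<longleftrightarrow> v = Inl (p j) \<or> v = Inl (p (Suc j mod k))" for v
  proof (cases v)
    case (Inl x)
    show ?thesis
    proof (cases "x \<in> points G")
      case True
      then obtain i where "i < k" "x = p i" using points_labelled by auto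
      then show ?thesis using Inl inc_labelled[OF _ j] p_eq j by auto
    next
      case False
      then show ?thesis
        using Inl labelled_geometry points_labelled j by (auto simp: point_line_geometry_def)
    qed
  qed simp
  then show ?thesis by blast
qed

lemma card_nbs: "u \<in> elements G \<Longrightarrow> card {v. gadj G u v} = 2"
proof -
  have 1: "Suc j mod k \<noteq> j" if "j < k" for j using that k2 by (auto simp: mod_Suc)
  have 2: "(j + (k - 1)) mod k \<noteq> j" if "j < k" for j
    using that 1 pred_mod[OF that, of "(j + (k - 1)) mod k"] k2 by fastforce
  assume "u \<in> elements G"
  then consider j where "j < k" "u = Inl (p j)" | j where "j < k" "u = Inr (l j)"
    by (auto simp: elements_def points_labelled lines_labelled)
  then show ?thesis
  proof cases
    case 1
    then show ?thesis using nbs_point 2[of j] l_eq[of j "(j + (k - 1)) mod k"] k2 by auto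
  next
    case 2
    then show ?thesis using nbs_line 1[of j] p_eq[of j "Suc j mod k"] k2 by auto
  qed
qed

text \<open>The two arcs between elements of the cycle have total length \<open>2 * k\<close>, so
  one of them has length at most \<open>k\<close>.\<close>

lemma walk_labelled:
  assumes "u \<in> elements G" "w \<in> elements G"
  shows "\<exists>i\<le>k. (gadj G ^^ i) u w"
proof -
  define c where "c i = (if even i then Inl (p (i div 2 mod k)) else Inr (l (i div 2 mod k)))" for i
  have step: "gadj G (c i) (c (Suc i))" for i
  proof (cases "even i")
    case True
    then show ?thesis using inc_labelled k2 by (simp add: c_def)
  next
    case False
    then show ?thesis using inc_labelled k2 by (simp add: c_def mod_Suc_eq)
  qed
  have walk: "(gadj G ^^ j) (c i) (c (i + j))" for i j
    using step by (induction j) (auto intro: relpowp_Suc_I)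
  have per: "c (i + 2 * k) = c i" for i
    by (simp add: c_def)
  have ex: "\<exists>i<2 * k. x = c i" if x: "x \<in> elements G" for x
  proof -
    consider j where "j < k" "x = Inl (p j)" | j where "j < k" "x = Inr (l j)"
      using x by (auto simp: elements_def points_labelled lines_labelled)
    then show ?thesis
    proof cases
      case 1
      then show ?thesis by (intro exI[of _ "2 * j"]) (simp add: c_def)
    next
      case 2
      then show ?thesis by (intro exI[of _ "2 * j + 1"]) (simp add: c_def)
    qed
  qed
  have main: "\<exists>n\<le>k. (gadj G ^^ n) (c i) (c j) \<or> (gadj G ^^ n) (c j) (c i)" if "i \<le> j" "j < 2 * k" for i j
  proof (cases "j - i \<le> k")
    case True
    then show ?thesis using walk[of "j - i" i] that by auto
  next
    case False
    then have "2 * k - (j - i) \<le> k" by simp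
    moreover have "j + (2 * k - (j - i)) = i + 2 * k" using that by simp
    ultimately show ?thesis using walk[of "2 * k - (j - i)" j] per[of i] by metis
  qed
  have sym: "(gadj G ^^ n) a b \<Longrightarrow> (gadj G ^^ n) b a" for n a b
  proof (induction n arbitrary: b)
    case (Suc n)
    then obtain y where "(gadj G ^^ n) a y" "gadj G y b" by (auto elim: relpowp_Suc_E)
    then show ?case using Suc.IH gadj_sym relpowp_Suc_I2 by metis
  qed auto
  obtain i j where "i < 2 * k" "u = c i" "j < 2 * k" "w = c j" using ex assms by meson
  then show ?thesis using main[of i j] main[of j i] sym by (meson nat_le_linear)
qed

end

text \<open>Inside \<open>H\<close> every element already has two neighbours, which is all it has in
  \<open>G\<close>; so no edge leaves \<open>H\<close>.\<close>

lemma sub_gon_closed: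
  assumes "subgeometry H G" "ordinary_gon k H" "\<And>u. u \<in> elements H \<Longrightarrow> card {v. gadj G u v} = 2"
    and "u \<in> elements H" "(gadj G ^^ i) u w"
  shows "w \<in> elements H"
  using assms(4,5)
proof (induction i arbitrary: w)
  case 0
  then show ?case by auto
next
  case (Suc i)
  obtain p l where lab: "labelled k H p l" and k2: "2 \<le> k"
    using assms(2) unfolding ordinary_gon_labelled by blast
  obtain y where y: "(gadj G ^^ i) u y" "gadj G y w" using Suc.prems by (auto elim: relpowp_Suc_E)
  then have yH: "y \<in> elements H" using Suc by blast
  then have "card {v. gadj H y v} = 2" "card {v. gadj G y v} = 2"
    using card_nbs[OF lab k2] assms(3) by auto
  moreover have "{v. gadj H y v} \<subseteq> {v. gadj G y v}" using gadj_sub[OF assms(1)] by blast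
  ultimately have "{v. gadj H y v} = {v. gadj G y v}"
    by (metis card_subset_eq card_eq_0_iff zero_neq_numeral)
  then have "gadj H y w" using y(2) by blast
  then show ?case using gadj_elements[OF labelled_geometry[OF lab k2]] by blast
qed

text \<open>Points and lines alternate along the cycle, and the absence of chords makes the induced
  incidence exactly that of an ordinary polygon.\<close>

lemma sub_gon_of_cycle:
  assumes G: "point_line_geometry G" and "2 \<le> k" and inj: "inj_on c {..<2 * k}"
    and adj: "\<And>i j. i < 2 * k \<Longrightarrow> j < 2 * k \<Longrightarrow>
      gadj G (c i) (c j) \<longleftrightarrow> j = Suc i mod (2 * k) \<or> i = Suc j mod (2 * k)"
    and pt: "isl (c 0)"
  shows "\<exists>H. subgeometry H G \<and> ordinary_gon k H"
proof -
  have isl: "isl (c i) \<longleftrightarrow> even i" if "i < 2 * k" for i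
    using that
  proof (induction i)
    case (Suc i)
    then have "gadj G (c i) (c (Suc i))" using adj[of i "Suc i"] by simp
    then show ?case using gadj_isl Suc by auto
  qed (use pt in simp)
  define p l where "p i = projl (c (2 * i))" and "l i = projr (c (2 * i + 1))" for i
  have cp: "c (2 * i) = Inl (p i)" and cl: "c (2 * i + 1) = Inr (l i)" if "i < k" for i
    using isl[of "2 * i"] isl[of "2 * i + 1"] that by (auto simp: p_def l_def)
  define H where "H = \<lparr>points = p ` {..<k}, lines = l ` {..<k}, inc = inc G \<inter> (p ` {..<k} \<times> l ` {..<k})\<rparr>"
  have inc: "(p i, l j) \<in> inc G \<longleftrightarrow> i = j \<or> i = Suc j mod k" if "i < k" "j < k" for i j
  proof -
    have "(p i, l j) \<in> inc G \<longleftrightarrow> gadj G (c (2 * i)) (c (2 * j + 1))" using cp cl that by simp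
    also have "\<dots> \<longleftrightarrow> 2 * j + 1 = Suc (2 * i) mod (2 * k) \<or> 2 * i = Suc (2 * j + 1) mod (2 * k)"
      using adj[of "2 * i" "2 * j + 1"] that by simp
    also have "Suc (2 * i) mod (2 * k) = 2 * i + 1" using that by simp
    also have "Suc (2 * j + 1) mod (2 * k) = 2 * (Suc j mod k)" by (simp add: mult_mod_right)
    finally show ?thesis by auto
  qed
  have el: "p i \<in> points G" "l i \<in> lines G" if "i < k" for i
    using inc[of i i] that G by (auto simp: point_line_geometry_def)
  have ip: "inj_on p {..<k}"
  proof (rule inj_onI)
    fix i j assume "i \<in> {..<k}" "j \<in> {..<k}" "p i = p j"
    then have "c (2 * i) = c (2 * j)" using cp by simp
    then show "i = j" using inj_onD[OF inj, of "2 * i" "2 * j"] \<open>i \<in> _\<close> \<open>j \<in> _\<close> by simp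
  qed
  have il: "inj_on l {..<k}"
  proof (rule inj_onI)
    fix i j assume "i \<in> {..<k}" "j \<in> {..<k}" "l i = l j"
    then have "c (2 * i + 1) = c (2 * j + 1)" using cl by simp
    then show "i = j" using inj_onD[OF inj, of "2 * i + 1" "2 * j + 1"] \<open>i \<in> _\<close> \<open>j \<in> _\<close> by simp
  qed
  have "inc H = {(p i, l i) | i. i < k} \<union> {(p (Suc i mod k), l i) | i. i < k}"
  proof (intro set_eqI iffI)
    fix z assume "z \<in> inc H"
    then obtain i j where "z = (p i, l j)" "i < k" "j < k" "(p i, l j) \<in> inc G" by (auto simp: H_def)
    then show "z \<in> {(p i, l i) | i. i < k} \<union> {(p (Suc i mod k), l i) | i. i < k}" using inc by auto
  next
    fix z assume "z \<in> {(p i, l i) | i. i < k} \<union> {(p (Suc i mod k), l i) | i. i < k}"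
    then show "z \<in> inc H" using inc \<open>2 \<le> k\<close> by (auto simp: H_def)
  qed
  then have "labelled k H p l" using ip il by (simp add: labelled_def H_def bij_betw_def)
  then have "ordinary_gon k H" using \<open>2 \<le> k\<close> by (auto simp: ordinary_gon_labelled)
  moreover have "subgeometry H G" using el by (auto simp: subgeometry_def H_def)
  ultimately show ?thesis by blast
qed

text \<open>Rotating by one turns a cycle that starts with a line into one that starts with a point,
  as \<open>sub_gon_of_cycle\<close> requires.\<close>

lemma cycle_shift:
  assumes "0 < n" and inj: "inj_on c {..<n}"
    and adj: "\<And>i j. i < n \<Longrightarrow> j < n \<Longrightarrow> E (c i) (c j) \<longleftrightarrow> j = Suc i mod n \<or> i = Suc j mod n"
  shows "inj_on (\<lambda>i. c (Suc i mod n)) {..<n}"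
    and "\<And>i j. i < n \<Longrightarrow> j < n \<Longrightarrow>
      E (c (Suc i mod n)) (c (Suc j mod n)) \<longleftrightarrow> j = Suc i mod n \<or> i = Suc j mod n"
proof -
  have s: "Suc i mod n = Suc j mod n \<longleftrightarrow> i = j" if "i < n" "j < n" for i j
    using that by (auto simp: mod_Suc)
  show "inj_on (\<lambda>i. c (Suc i mod n)) {..<n}"
  proof (rule inj_onI)
    fix i j assume "i \<in> {..<n}" "j \<in> {..<n}" "c (Suc i mod n) = c (Suc j mod n)"
    then show "i = j" using inj_onD[OF inj, of "Suc i mod n" "Suc j mod n"] s assms(1) by simp
  qed
  show "E (c (Suc i mod n)) (c (Suc j mod n)) \<longleftrightarrow> j = Suc i mod n \<or> i = Suc j mod n"
    if "i < n" "j < n" for i j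
    using adj[of "Suc i mod n" "Suc j mod n"] s[of j "Suc i mod n"] s[of i "Suc j mod n"] that assms(1) by simp
qed

definition gdist :: "('p, 'l) geometry \<Rightarrow> 'p + 'l \<Rightarrow> 'p + 'l \<Rightarrow> nat" where
  "gdist G = bipartite_gon.dist (gadj G)"

theorem polygon_of_weak_gon:
  assumes "weak_generalized_gon m G"
  shows "polygon m (elements G) (gadj G) (gdist G)"
proof -
  have G: "point_line_geometry G" using assms by (simp add: weak_generalized_gon_def)
  have apt: "\<exists>H p l. subgeometry H G \<and> labelled m H p l \<and> 2 \<le> m \<and> u \<in> elements H \<and> w \<in> elements H"
    if "u \<in> elements G" "w \<in> elements G" for u w
    using assms that unfolding weak_generalized_gon_def ordinary_gon_labelled by meson
  have mono: "(gadj G ^^ i) u w" if "subgeometry H G" "(gadj H ^^ i) u w" for H u w i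
    using that(2) gadj_sub[OF that(1)]
    by (induction i arbitrary: w) (auto elim!: relpowp_Suc_E intro!: relpowp_Suc_I)
  interpret bipartite_gon m "elements G" "gadj G" isl
  proof
    fix u v assume "gadj G u v"
    then show "u \<in> elements G \<and> v \<in> elements G" "gadj G v u" "isl v \<longleftrightarrow> \<not> isl u"
      using gadj_elements[OF G] gadj_sym gadj_isl by blast+
  next
    fix u w assume "u \<in> elements G" "w \<in> elements G"
    then show "\<exists>k\<le>m. (gadj G ^^ k) u w" using apt walk_labelled mono by meson
  next
    fix u assume "u \<in> elements G"
    then obtain H p l where H: "subgeometry H G" "labelled m H p l" "2 \<le> m" "u \<in> elements H"
      using apt by meson
    then have "card {v. gadj H u v} = 2" using card_nbs by blast
    then obtain v v' where "{v. gadj H u v} = {v, v'}" "v \<noteq> v'" by (meson card_2_iff)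
    then have "gadj H u v" "gadj H u v'" by blast+
    then show "\<exists>v v'. gadj G u v \<and> gadj G u v' \<and> v \<noteq> v'" using gadj_sub[OF H(1)] \<open>v \<noteq> v'\<close> by blast
  next
    fix k and c :: "nat \<Rightarrow> 'a + 'b"
    assume k: "2 \<le> k" "k < m" and inj: "inj_on c {..<2 * k}"
      and adj: "\<And>i j. i < 2 * k \<Longrightarrow> j < 2 * k \<Longrightarrow>
        gadj G (c i) (c j) \<longleftrightarrow> j = Suc i mod (2 * k) \<or> i = Suc j mod (2 * k)"
    have "\<exists>H. subgeometry H G \<and> ordinary_gon k H"
    proof (cases "isl (c 0)")
      case True
      then show ?thesis using sub_gon_of_cycle[OF G k(1) inj adj] by blast
    next
      case False
      have "gadj G (c 0) (c 1)" using adj[of 0 1] k by simp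
      then have "isl (c (Suc 0 mod (2 * k)))" using gadj_isl False k by auto
      moreover have "0 < 2 * k" using k by simp
      ultimately show ?thesis
        using sub_gon_of_cycle[OF G k(1) cycle_shift[of "2 * k" c "gadj G", OF _ inj adj]] by blast
    qed
    then show False using assms k by (auto simp: weak_generalized_gon_def)
  qed
  show ?thesis unfolding gdist_def by (rule polygon_dist)
qed

lemma gdist_parity:
  assumes "weak_generalized_gon m G" "u \<in> elements G" "w \<in> elements G"
  shows "even (gdist G u w) \<longleftrightarrow> (isl u \<longleftrightarrow> isl w)"
proof -
  interpret polygon m "elements G" "gadj G" "gdist G" by (rule polygon_of_weak_gon[OF assms(1)])
  show ?thesis using assms(2)
  proof (induction "gdist G u w" arbitrary: u)
    case 0
    then show ?case using d_eq_0[of u w] assms(3) by simp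
  next
    case (Suc k)
    then have "u \<noteq> w" using d_eq_0[of u w] assms(3) by force
    then obtain v where v: "gadj G u v" "gdist G u w = Suc (gdist G v w)"
      using closer_ex Suc.prems assms(3) by blast
    then have "even (gdist G v w) \<longleftrightarrow> (isl v \<longleftrightarrow> isl w)" using Suc.hyps E_V by simp
    then show ?case using v gadj_isl[OF v(1)] by simp
  qed
qed

section \<open>Labelled ordinary octagons\<close>

lemma dual_simps [simp]: "points (dual G) = lines G" "lines (dual G) = points G"
  "(L, x) \<in> inc (dual G) \<longleftrightarrow> (x, L) \<in> inc G"
  by (simp_all add: dual_def)

lemma dual_dual [simp]: "dual (dual G) = G"
  by (simp add: dual_def)

text \<open>The lines \<open>l i\<close> and \<open>l (Suc i mod k)\<close> meet in
  \<open>p (Suc i mod k)\<close>; hence the shift by one in the labels of the dual lines.\<close>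

lemma labelled_dual:
  assumes "labelled k G p l" "2 \<le> k"
  shows "labelled k (dual G) l (\<lambda>i. p (Suc i mod k))"
proof -
  have "bij_betw (\<lambda>i. Suc i mod k) {..<k} {..<k}"
    by (rule bij_betw_byWitness[where f' = "\<lambda>i. if i = 0 then k - 1 else i - 1"])
      (use assms(2) in \<open>auto simp: mod_Suc\<close>)
  then have "bij_betw (\<lambda>i. p (Suc i mod k)) {..<k} (points G)"
    using bij_betw_trans[of "\<lambda>i. Suc i mod k" "{..<k}" "{..<k}" p] assms(1)
    by (simp add: labelled_def comp_def)
  moreover have "inc (dual G) =
      {(l i, p (Suc i mod k)) | i. i < k} \<union> {(l (Suc i mod k), p (Suc i mod k)) | i. i < k}"
  proof -
    have "{(l i, p i) | i. i < k} = {(l (Suc i mod k), p (Suc i mod k)) | i. i < k}" (is "?A = ?B")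
    proof
      show "?A \<subseteq> ?B"
      proof
        fix z assume "z \<in> ?A"
        then obtain i where i: "i < k" "z = (l i, p i)" by blast
        then have "i = Suc ((i + (k - 1)) mod k) mod k"
          using assms(2) by (cases i) (auto simp: mod_Suc_eq)
        moreover have "(i + (k - 1)) mod k < k" using assms(2) by simp
        ultimately show "z \<in> ?B" using i(2) by (metis (mono_tags, lifting) mem_Collect_eq)
      qed
      show "?B \<subseteq> ?A" using assms(2) by auto
    qed
    moreover have "inc (dual G) = {(l i, p i) | i. i < k} \<union> {(l i, p (Suc i mod k)) | i. i < k}"
    proof -
      have "inc G = {(p i, l i) | i. i < k} \<union> {(p (Suc i mod k), l i) | i. i < k}"
        using assms(1) by (simp add: labelled_def)
      then show ?thesis unfolding dual_def by (simp add: converse_Un) (auto simp: converse_unfold)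
    qed
    ultimately show ?thesis by (simp add: Un_commute)
  qed
  ultimately show ?thesis using assms(1) by (simp add: labelled_def)
qed

lemma labelled_rotate:
  assumes "labelled k G p l" "2 \<le> k"
  shows "labelled k G (\<lambda>i. p ((i + m) mod k)) (\<lambda>i. l ((i + m) mod k))"
proof -
  define r where "r i = (i + m) mod k" for i
  define r' where "r' i = (i + (k - m mod k)) mod k" for i
  have r': "r (r' i) = i" "r' (r i) = i" "r i < k" "r' i < k" if "i < k" for i
  proof -
    have "r (r' i) = (i + (k - m mod k) + m) mod k" by (simp add: r_def r'_def mod_add_left_eq)
    also have "\<dots> = (i + (k - m mod k) + m mod k) mod k" by (simp add: mod_add_right_eq)
    also have "i + (k - m mod k) + m mod k = i + k" using mod_less_divisor[of k m] assms(2) by linarith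
    finally show "r (r' i) = i" using that by simp
    have "r' (r i) = (i + m + (k - m mod k)) mod k" by (simp add: r_def r'_def mod_add_left_eq)
    also have "\<dots> = ((i + (k - m mod k)) + m) mod k" by (simp add: add_ac)
    also have "\<dots> = (i + (k - m mod k) + m mod k) mod k" by (simp add: mod_add_right_eq)
    also have "i + (k - m mod k) + m mod k = i + k" using mod_less_divisor[of k m] assms(2) by linarith
    finally show "r' (r i) = i" using that by simp
  qed (use assms(2) in \<open>simp_all add: r_def r'_def\<close>)
  have bij: "bij_betw r {..<k} {..<k}"
    by (rule bij_betw_byWitness[where f' = r']) (use r' in auto)
  have im: "{f i | i. i < k} = {f (r i) | i. i < k}" for f :: "nat \<Rightarrow> 'a \<times> 'b"
    using bij unfolding bij_betw_def by (auto simp: set_eq_iff) (metis imageE lessThan_iff)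
  have suc: "Suc (r i) mod k = r (Suc i mod k)" for i
    by (simp add: r_def mod_Suc_eq mod_add_left_eq)
  have "inc G = {(p i, l i) | i. i < k} \<union> {(p (Suc i mod k), l i) | i. i < k}"
    using assms(1) by (simp add: labelled_def)
  also have "\<dots> = {(p (r i), l (r i)) | i. i < k} \<union> {(p (r (Suc i mod k)), l (r i)) | i. i < k}"
    using im[of "\<lambda>i. (p i, l i)"] im[of "\<lambda>i. (p (Suc i mod k), l i)"] unfolding suc by simp
  finally show ?thesis
    using assms(1) bij_betw_trans[OF bij, of p] bij_betw_trans[OF bij, of l]
    unfolding labelled_def r_def by (simp add: comp_def)
qed

lemma epimorphism_dual: "epimorphism g f (dual S) (dual G) \<longleftrightarrow> epimorphism f g S G"
  by (auto simp: epimorphism_def morphism_def)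

lemma gadj_map:
  assumes "weak_generalized_gon m S" "epimorphism f g S G" "gadj S u v"
  shows "gadj G (map_sum f g u) (map_sum f g v)"
proof -
  have "(f x, g L) \<in> inc G" if "(x, L) \<in> inc S" for x L
    using assms(1,2) that
    by (auto simp: epimorphism_def morphism_def point_line_geometry_def weak_generalized_gon_def)
  then show ?thesis using assms(3) by (cases u; cases v) auto
qed

lemma labelled_inj: "labelled k G p l \<Longrightarrow> inj_on p {..<k} \<and> inj_on l {..<k}"
  by (simp add: labelled_def bij_betw_def)

context
  fixes G :: "('q, 'm) geometry" and p l
  assumes lab: "labelled 8 G p l"
begin

text \<open>Points get the even positions, since \<open>singleton_fibre\<close> needs finite valency
  there and points are on finitely many lines.\<close>

definition lpos :: "'q + 'm \<Rightarrow> int" where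
  "lpos u = (case u of Inl x \<Rightarrow> 2 * int (inv_into {..<8} p x) | Inr L \<Rightarrow> 2 * int (inv_into {..<8} l L) + 1)"

lemma lpos_point: "i < 8 \<Longrightarrow> lpos (Inl (p i)) = 2 * int i"
  and lpos_line: "i < 8 \<Longrightarrow> lpos (Inr (l i)) = 2 * int i + 1"
  using labelled_inj[OF lab] by (auto simp: lpos_def inv_into_f_f)

lemma lpos_step:
  assumes "(x, L) \<in> inc G"
  shows "16 dvd lpos (Inr L) - lpos (Inl x) - 1 \<or> 16 dvd lpos (Inr L) - lpos (Inl x) + 1"
proof -
  obtain j where j: "j < 8" "L = l j" "x = p j \<or> x = p (Suc j mod 8)"
    using assms lab unfolding labelled_def by auto
  show ?thesis
  proof (cases "x = p j")
    case True
    then show ?thesis using j lpos_point[of j] lpos_line[of j] by simp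
  next
    case False
    then have x: "x = p (Suc j mod 8)" using j by blast
    have "lpos (Inl x) = 2 * int (Suc j mod 8)" unfolding x by (rule lpos_point) simp
    moreover have "Suc j mod 8 = Suc j \<or> (Suc j mod 8 = 0 \<and> j = 7)" using j(1) by (auto simp: mod_Suc)
    ultimately show ?thesis using j(1,2) lpos_line[of j] by auto
  qed
qed

lemma lpos_gadj:
  assumes "gadj G u v"
  shows "16 dvd lpos v - lpos u - 1 \<or> 16 dvd lpos v - lpos u + 1"
proof (cases u)
  case (Inl x)
  then obtain L where "v = Inr L" "(x, L) \<in> inc G" using assms by (cases v) auto
  then show ?thesis using lpos_step Inl by simp
next
  case (Inr L)
  then obtain x where x: "v = Inl x" "(x, L) \<in> inc G" using assms by (cases v) auto
  have neg: "lpos v - lpos u - 1 = - (lpos u - lpos v + 1)" "lpos v - lpos u + 1 = - (lpos u - lpos v - 1)"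
    by simp_all
  have "16 dvd lpos u - lpos v - 1 \<or> 16 dvd lpos u - lpos v + 1" using lpos_step[OF x(2)] x(1) Inr by simp
  then show ?thesis unfolding neg dvd_minus_iff by blast
qed

lemma wrap_lpos:
  assumes "weak_generalized_gon 8 S" "epimorphism f g S G"
  shows "wrap (elements S) (gadj S) (gdist S) (\<lambda>u. lpos (map_sum f g u))"
proof -
  interpret polygon 8 "elements S" "gadj S" "gdist S" by (rule polygon_of_weak_gon[OF assms(1)])
  show ?thesis
  proof
    fix u v assume "gadj S u v"
    then show "16 dvd lpos (map_sum f g v) - lpos (map_sum f g u) - 1 \<or>
        16 dvd lpos (map_sum f g v) - lpos (map_sum f g u) + 1"
      using lpos_gadj gadj_map[OF assms] by blast
  next
    fix i :: int
    define r where "r = nat (i mod 16)"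
    have r: "int r = i mod 16" by (simp add: r_def)
    have "\<exists>u\<in>elements S. lpos (map_sum f g u) = int r"
    proof (cases "even r")
      case True
      have "r < 16" using r by linarith
      then have h: "r div 2 < 8" by simp
      then have "p (r div 2) \<in> points G" using lab by (auto simp: labelled_def bij_betw_def)
      then obtain x where "x \<in> points S" "f x = p (r div 2)"
        using assms(2) by (auto simp: epimorphism_def) (metis imageE)
      then show ?thesis using lpos_point[OF h] True
        by (intro bexI[of _ "Inl x"]) (auto simp: elements_def)
    next
      case False
      have "r < 16" using r by linarith
      then have h: "r div 2 < 8" by simp
      then have "l (r div 2) \<in> lines G" using lab by (auto simp: labelled_def bij_betw_def)
      then obtain L where "L \<in> lines S" "g L = l (r div 2)"
        using assms(2) by (auto simp: epimorphism_def) (metis imageE)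
      moreover have "2 * int (r div 2) + 1 = int r" using False by (auto elim!: oddE)
      ultimately show ?thesis using lpos_line[OF h]
        by (intro bexI[of _ "Inr L"]) (auto simp: elements_def)
    qed
    moreover have "16 dvd int r - i" unfolding r by (simp add: mod_eq_dvd_iff[symmetric])
    ultimately show "\<exists>u\<in>elements S. 16 dvd lpos (map_sum f g u) - i" by metis
  qed
qed

lemma lpos_eq:
  assumes "u \<in> elements G" "v \<in> elements G" "16 dvd lpos u - lpos v"
  shows "u = v"
proof -
  have el: "\<exists>i<8. w = Inl (p i) \<and> lpos w = 2 * int i \<or> w = Inr (l i) \<and> lpos w = 2 * int i + 1"
    if w: "w \<in> elements G" for w
  proof -
    consider i where "i < 8" "w = Inl (p i)" | i where "i < 8" "w = Inr (l i)"
      using w points_labelled[OF lab] lines_labelled[OF lab] by (auto simp: elements_def)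
    then show ?thesis using lpos_point lpos_line by cases blast+
  qed
  obtain i where i: "i < 8" "u = Inl (p i) \<and> lpos u = 2 * int i \<or> u = Inr (l i) \<and> lpos u = 2 * int i + 1"
    using el[OF assms(1)] by blast
  obtain j where j: "j < 8" "v = Inl (p j) \<and> lpos v = 2 * int j \<or> v = Inr (l j) \<and> lpos v = 2 * int j + 1"
    using el[OF assms(2)] by blast
  have "lpos u = lpos v"
  proof (rule ccontr)
    assume "lpos u \<noteq> lpos v"
    then have "16 \<le> \<bar>lpos u - lpos v\<bar>" using zdvd_imp_le[of 16 "\<bar>lpos u - lpos v\<bar>"] assms(3) by simp
    then show False using i j by linarith
  qed
  then have "(isl u \<longleftrightarrow> isl v) \<and> i = j" using i(2) j(2) by (auto; presburger)
  then show ?thesis using i(2) j(2) by auto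
qed

text \<open>\<open>lift_up\<close> and \<open>lift_down\<close> provide a neighbour over the right
  position, and a position modulo 16 determines an element of the octagon.\<close>

lemma lift_flag:
  assumes "weak_generalized_gon 8 S" "epimorphism f g S G"
    and "u \<in> elements S" "gadj G (map_sum f g u) v'"
  shows "\<exists>v. gadj S u v \<and> map_sum f g v = v'"
proof -
  interpret wrap "elements S" "gadj S" "gdist S" "\<lambda>u. lpos (map_sum f g u)"
    by (rule wrap_lpos[OF assms(1,2)])
  have G: "point_line_geometry G" by (rule labelled_geometry[OF lab]) simp
  have v'G: "v' \<in> elements G" using gadj_elements[OF G assms(4)] by blast
  have im: "map_sum f g v \<in> elements G" if "v \<in> elements S" for v
    using that assms(2) by (auto simp: elements_def epimorphism_def)
  define a where "a = lpos (map_sum f g u)"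
  have "16 dvd lpos v' - a - 1 \<or> 16 dvd lpos v' - a + 1"
    unfolding a_def by (rule lpos_gadj[OF assms(4)])
  moreover have "u \<in> F a" using F_self assms(3) by (simp add: a_def)
  moreover have eq: "map_sum f g v = v'" if "v \<in> F i" "16 dvd lpos v' - i" for v i
  proof -
    have v: "v \<in> elements S" "16 dvd lpos (map_sum f g v) - i" using that(1) by (auto simp: F_def)
    have "16 dvd (lpos (map_sum f g v) - i) - (lpos v' - i)" by (rule dvd_diff[OF v(2) that(2)])
    then show ?thesis using lpos_eq[OF im[OF v(1)] v'G] by simp
  qed
  moreover have "lpos v' - a - 1 = lpos v' - (a + 1)" "lpos v' - a + 1 = lpos v' - (a - 1)" by simp_all
  ultimately show ?thesis using lift_up[of u a] lift_down[of u a] by metis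
qed

end

section \<open>Epimorphisms with a singleton line fibre\<close>

lemma join_labelled:
  assumes lab: "labelled 8 G p l" and j: "j < 8"
  shows "join G (p j) (p (Suc j mod 8)) = l j" "join G (p (Suc j mod 8)) (p j) = l j"
proof -
  have "L = l j" if L: "L \<in> lines G" "(p j, L) \<in> inc G" "(p (Suc j mod 8), L) \<in> inc G" for L
  proof -
    obtain i where i: "i < 8" "L = l i" using L(1) lines_labelled[OF lab] by auto
    have "j = i \<or> j = Suc i mod 8" "Suc j mod 8 = i \<or> Suc j mod 8 = Suc i mod 8"
      using inc_labelled[OF lab _ j i(1)] inc_labelled[OF lab _ _ i(1), of "Suc j mod 8"] L i by auto
    then have "i = j" using i(1) j by (auto simp: mod_Suc split: if_splits)
    then show ?thesis using i by simp
  qed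
  moreover have "l j \<in> lines G" "(p j, l j) \<in> inc G" "(p (Suc j mod 8), l j) \<in> inc G"
    using inc_labelled[OF lab _ j j] inc_labelled[OF lab _ _ j, of "Suc j mod 8"] lines_labelled[OF lab] j
    by auto
  ultimately show "join G (p j) (p (Suc j mod 8)) = l j" "join G (p (Suc j mod 8)) (p j) = l j"
    unfolding join_def by (blast intro: the_equality)+
qed

lemma csum_one_bij:
  assumes "|A| =o r +c cone"
  obtains h where "bij_betw h A (Field r <+> {()})"
proof -
  have "|A| =o |Field r <+> {()}|" using assms by (simp add: csum_def cone_def Field_card_of)
  then show thesis using that card_of_ordIso by blast
qed

text \<open>An element of \<open>C\<close> that is mapped to the added point of
  \<open>r +c cone\<close> is sent instead to the image of some \<open>b\<close> outside
  \<open>C\<close>. This works alike for finite and infinite \<open>r\<close>.\<close>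

lemma part_ordLeq:
  assumes "|A| =o r +c cone" "Card_order r" "C \<subseteq> A" "C \<noteq> A"
  shows "|C| \<le>o r"
proof -
  obtain h where h: "bij_betw h A (Field r <+> {()})" using csum_one_bij[OF assms(1)] .
  obtain b where b: "b \<in> A" "b \<notin> C" using assms(3,4) by blast
  have inj: "inj_on h A" and im: "h ` A = Field r <+> {()}" using h by (auto simp: bij_betw_def)
  define k where "k x = (if h x = Inr () then h b else h x)" for x
  have "inj_on k C"
    using inj b assms(3) unfolding inj_on_def k_def by (metis subsetD)
  moreover have "k x \<in> Inl ` Field r" if "x \<in> C" for x
  proof -
    have x: "x \<in> A" "x \<noteq> b" using that assms(3) b by auto
    then have "h x \<in> Field r <+> {()}" "h b \<in> Field r <+> {()}" "h x \<noteq> h b"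
      using im b inj by (auto dest: inj_onD)
    then show ?thesis by (auto simp: k_def)
  qed
  ultimately have "|C| \<le>o |(Inl :: _ \<Rightarrow> _ + unit) ` Field r|"
    by (intro card_of_ordLeqI) auto
  also have "|(Inl :: _ \<Rightarrow> _ + unit) ` Field r| \<le>o |Field r|" by (rule card_of_image)
  also have "|Field r| =o r" by (rule card_of_Field_ordIso[OF assms(2)])
  finally show ?thesis .
qed

lemma cone_ordLeq: "A \<noteq> {} \<Longrightarrow> cone \<le>o |A|"
  unfolding cone_def by (rule card_of_singl_ordLeq)

text \<open>For every epimorphism onto an ordinary octagon, lifting flags expresses the points near
  a fibre and the lines meeting it by adjacent fibres. The singleton fibre makes \<open>K\<close>
  carry exactly the points of two fibres, and the recursion of class (a) can start.\<close>

lemma class_a_of_singleton: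
  assumes S: "weak_generalized_gon 8 S" and G: "ordinary_gon 8 G" and epi: "epimorphism f g S G"
    and K: "K \<in> lines S" and single: "\<And>M. M \<in> lines S \<Longrightarrow> g M = g K \<Longrightarrow> M = K"
    and ord: "Card_order s" "|points_on S K| =o s +c cone"
  shows "class_a S G s f g"
proof -
  obtain p0 l0 where lab0: "labelled 8 G p0 l0" using G unfolding ordinary_gon_labelled by blast
  have "g K \<in> lines G" using epi K by (auto simp: epimorphism_def)
  then obtain m where m: "m < 8" "g K = l0 m" using lines_labelled[OF lab0] by auto
  define p l where "p i = p0 ((i + m) mod 8)" and "l i = l0 ((i + m) mod 8)" for i
  have lab: "labelled 8 G p l" using labelled_rotate[OF lab0, of m] by (simp add: p_def[abs_def] l_def[abs_def])
  have gK: "g K = l 0" using m by (simp add: l_def)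
  have pl: "point_line_geometry S" using S by (simp add: weak_generalized_gon_def)
  have incG: "(p i, l j) \<in> inc G \<longleftrightarrow> i = j \<or> i = Suc j mod 8" if "i < 8" "j < 8" for i j
    using inc_labelled[OF lab _ that] by simp
  have p_eq: "p i = p j \<longleftrightarrow> i = j" and l_eq: "l i = l j \<longleftrightarrow> i = j" if "i < 8" "j < 8" for i j
    using p_eq[OF lab] l_eq[OF lab] that by auto
  define P M where "P i = {z \<in> points S. f z = p i}" and "M i = {L \<in> lines S. g L = l i}" for i
  have flag: "x \<in> points S \<and> L \<in> lines S \<and> (f x, g L) \<in> inc G" if "(x, L) \<in> inc S" for x L
    using pl epi that by (auto simp: point_line_geometry_def epimorphism_def morphism_def)
  have fP: "\<exists>i<8. z \<in> P i" if "z \<in> points S" for z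
    using that epi points_labelled[OF lab] by (auto simp: P_def epimorphism_def)
  have fM: "\<exists>i<8. L \<in> M i" if "L \<in> lines S" for L
    using that epi lines_labelled[OF lab] by (auto simp: M_def epimorphism_def)
  have lift_p: "\<exists>L\<in>M j. (z, L) \<in> inc S" if "z \<in> P i" "(p i, l j) \<in> inc G" for z i j
  proof -
    have "Inl z \<in> elements S" "gadj G (map_sum f g (Inl z)) (Inr (l j))"
      using that by (auto simp: P_def elements_def)
    then obtain v where v: "gadj S (Inl z) v" "map_sum f g v = Inr (l j)"
      using lift_flag[OF lab S epi] by blast
    then obtain L where "v = Inr L" by (cases v) auto
    then show ?thesis using v flag by (auto simp: M_def)
  qed
  have lift_l: "\<exists>z\<in>P i. (z, L) \<in> inc S" if "L \<in> M j" "(p i, l j) \<in> inc G" for L i j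
  proof -
    have "Inr L \<in> elements S" "gadj G (map_sum f g (Inr L)) (Inl (p i))"
      using that by (auto simp: M_def elements_def)
    then obtain v where v: "gadj S (Inr L) v" "map_sum f g v = Inl (p i)"
      using lift_flag[OF lab S epi] by blast
    then obtain z where "v = Inl z" by (cases v) auto
    then show ?thesis using v flag by (auto simp: P_def)
  qed
  have through: "L \<in> M i \<or> L \<in> M (Suc i mod 8)" if a: "(y, L) \<in> inc S" "y \<in> P (Suc i mod 8)" "i < 8" for y L i
  proof -
    obtain j where j: "j < 8" "L \<in> M j" using fM flag[OF a(1)] by blast
    then have "(p (Suc i mod 8), l j) \<in> inc G" using flag[OF a(1)] a(2) by (auto simp: P_def M_def)
    then have "Suc i mod 8 = j \<or> Suc i mod 8 = Suc j mod 8" using incG[of "Suc i mod 8" j] j by simp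
    then have "Suc i mod 8 = j \<or> i = j" using a(3) j(1) by (auto simp: mod_Suc split: if_splits)
    then show ?thesis using j by auto
  qed
  have on: "y \<in> P i \<or> y \<in> P (Suc i mod 8)" if a: "(y, L) \<in> inc S" "L \<in> M i" "i < 8" for y L i
  proof -
    obtain j where j: "j < 8" "y \<in> P j" using fP flag[OF a(1)] by blast
    then have "(p j, l i) \<in> inc G" using flag[OF a(1)] a(2) by (auto simp: P_def M_def)
    then show ?thesis using incG[OF j(1) a(3)] j by auto
  qed
  define near where "near X = {z \<in> points S. \<exists>y\<in>X. collinear S z y}" for X
  define meets where "meets X = {L \<in> lines S. \<exists>y\<in>X. (y, L) \<in> inc S}" for X
  have meets_P: "meets (P (Suc i mod 8)) = M i \<union> M (Suc i mod 8)" if i: "i < 8" for i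
  proof
    show "meets (P (Suc i mod 8)) \<subseteq> M i \<union> M (Suc i mod 8)"
      using through[OF _ _ i] by (auto simp: meets_def)
    have "(p (Suc i mod 8), l i) \<in> inc G" "(p (Suc i mod 8), l (Suc i mod 8)) \<in> inc G"
      using incG i by auto
    then show "M i \<union> M (Suc i mod 8) \<subseteq> meets (P (Suc i mod 8))"
      using lift_l by (fastforce simp: meets_def M_def)
  qed
  \<comment> \<open>The fibre is added on both sides because its points need not be collinear with
    one another; class (a) subtracts it anyway. The index \<open>Suc i mod 8\<close> makes
    \<open>i\<close> the predecessor.\<close>
  have near_P: "near (P (Suc i mod 8)) \<union> P (Suc i mod 8) =
      P i \<union> P (Suc i mod 8) \<union> P (Suc (Suc i mod 8) mod 8)" if i: "i < 8" for i
  proof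
    show "near (P (Suc i mod 8)) \<union> P (Suc i mod 8) \<subseteq>
        P i \<union> P (Suc i mod 8) \<union> P (Suc (Suc i mod 8) mod 8)"
    proof
      fix z assume "z \<in> near (P (Suc i mod 8)) \<union> P (Suc i mod 8)"
      moreover have "z \<in> P i \<union> P (Suc i mod 8) \<union> P (Suc (Suc i mod 8) mod 8)"
        if near: "z \<in> near (P (Suc i mod 8))"
      proof -
        obtain y L where y: "y \<in> P (Suc i mod 8)" "(y, L) \<in> inc S" and z: "(z, L) \<in> inc S"
          using near by (auto simp: near_def collinear_def)
        have i': "Suc i mod 8 < 8" by simp
        show ?thesis using through[OF y(2,1) i]
        proof
          assume "L \<in> M i"
          from on[OF z this i] show ?thesis by (elim disjE) simp_all
        next
          assume "L \<in> M (Suc i mod 8)"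
          from on[OF z this i'] show ?thesis by (elim disjE) simp_all
        qed
      qed
      ultimately show "z \<in> P i \<union> P (Suc i mod 8) \<union> P (Suc (Suc i mod 8) mod 8)" by blast
    qed
    have step: "z \<in> near (P j)"
      if z: "z \<in> P a" "(p a, l b) \<in> inc G" "(p j, l b) \<in> inc G" "p a \<noteq> p j" for z a b j
    proof -
      obtain L where L: "L \<in> M b" "(z, L) \<in> inc S" using lift_p[OF z(1,2)] by blast
      obtain y where y: "y \<in> P j" "(y, L) \<in> inc S" using lift_l[OF L(1) z(3)] by blast
      have "z \<noteq> y" using z(1,4) y(1) by (auto simp: P_def)
      then show ?thesis using flag[OF L(2)] flag[OF y(2)] y L(2) by (auto simp: near_def collinear_def)
    qed
    have "P i \<subseteq> near (P (Suc i mod 8))"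
      using step[of _ i i "Suc i mod 8"] incG p_eq[OF i, of "Suc i mod 8"] i by (auto simp: mod_Suc)
    moreover have "P (Suc (Suc i mod 8) mod 8) \<subseteq> near (P (Suc i mod 8))"
      using step[of _ "Suc (Suc i mod 8) mod 8" "Suc i mod 8" "Suc i mod 8"] incG
        p_eq[of "Suc (Suc i mod 8) mod 8" "Suc i mod 8"] by (auto simp: mod_Suc)
    ultimately show "P i \<union> P (Suc i mod 8) \<union> P (Suc (Suc i mod 8) mod 8) \<subseteq>
        near (P (Suc i mod 8)) \<union> P (Suc i mod 8)" by blast
  qed
  have Pd: "P i \<inter> P j = {}" and Md: "M i \<inter> M j = {}" if "i < 8" "j < 8" "i \<noteq> j" for i j
    using p_eq l_eq that by (auto simp: P_def M_def)
  have "L = K" if "L \<in> lines S" "g L = l 0" for L using single[OF that(1)] that(2) gK by simp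
  then have M0: "M 0 = {K}" unfolding M_def using K gK by blast
  have on_K: "points_on S K = P 0 \<union> P 1"
  proof
    show "points_on S K \<subseteq> P 0 \<union> P 1" using on[of _ K 0] M0 by (auto simp: points_on_def)
    have "(z, K) \<in> inc S" if "z \<in> P i" "i = 0 \<or> i = 1" for z i
      using lift_p[OF that(1), of 0] incG[of i 0] that(2) M0 by auto
    then show "P 0 \<union> P 1 \<subseteq> points_on S K" by (auto simp: points_on_def P_def)
  qed
  have ne: "P 0 \<noteq> {}" "P 1 \<noteq> {}" using lift_l[of K 0 0] lift_l[of K 0 1] M0 incG by auto
  have suc: "Suc 0 mod 8 = 1" "Suc 1 mod 8 = 2" "Suc 2 mod 8 = 3" "Suc 3 mod 8 = 4"
    "Suc 4 mod 8 = 5" "Suc 5 mod 8 = 6" "Suc 6 mod 8 = 7" "Suc 7 mod 8 = 0" by simp_all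
  have n: "near (P 0) \<union> P 0 = P 7 \<union> P 0 \<union> P 1" "near (P 1) \<union> P 1 = P 0 \<union> P 1 \<union> P 2"
    "near (P 7) \<union> P 7 = P 6 \<union> P 7 \<union> P 0" "near (P 2) \<union> P 2 = P 1 \<union> P 2 \<union> P 3"
    "near (P 6) \<union> P 6 = P 5 \<union> P 6 \<union> P 7" "near (P 3) \<union> P 3 = P 2 \<union> P 3 \<union> P 4"
    using near_P[of 7] near_P[of 0] near_P[of 6] near_P[of 1] near_P[of 5] near_P[of 2]
    unfolding suc by simp_all
  have c1: "P 7 = near (P 0) - points_on S K" "P 2 = near (P 1) - points_on S K"
    using n(1,2) Pd[of 7 0] Pd[of 7 1] Pd[of 2 0] Pd[of 2 1] unfolding on_K by auto
  have c2: "P 6 = near (P 7) - (P 0 \<union> P 7)" "P 3 = near (P 2) - (P 2 \<union> P 1)"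
    using n(3,4) Pd[of 6 0] Pd[of 6 7] Pd[of 3 1] Pd[of 3 2] by auto
  have c3: "P 5 = near (P 6) - (P 7 \<union> P 6)" "P 4 = near (P 3) - (P 2 \<union> P 3)"
    using n(5,6) Pd[of 5 6] Pd[of 5 7] Pd[of 4 2] Pd[of 4 3] by auto
  have mt: "meets (P 0) = M 7 \<union> M 0" "meets (P 1) = M 0 \<union> M 1" "meets (P 7) = M 6 \<union> M 7"
    "meets (P 2) = M 1 \<union> M 2" "meets (P 6) = M 5 \<union> M 6" "meets (P 3) = M 2 \<union> M 3"
    "meets (P 4) = M 3 \<union> M 4" "meets (P 5) = M 4 \<union> M 5"
    using meets_P[of 7] meets_P[of 0] meets_P[of 6] meets_P[of 1] meets_P[of 5] meets_P[of 2]
      meets_P[of 3] meets_P[of 4] unfolding suc by simp_all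
  have c4: "M 7 = meets (P 0) - {K}" "M 1 = meets (P 1) - {K}" "M 6 = meets (P 7) - M 7"
    "M 2 = meets (P 2) - M 1" "M 5 = meets (P 6) - M 6" "M 3 = meets (P 3) - M 2"
    "M 4 = meets (P 4) - M 3" "M 4 = meets (P 5) - M 5"
    unfolding mt M0[symmetric]
    using Md[of 7 0] Md[of 1 0] Md[of 6 7] Md[of 2 1] Md[of 5 6] Md[of 3 2] Md[of 4 3] Md[of 4 5] by auto
  have j: "join G (p 0) (p 1) = l 0" "join G (p 0) (p 7) = l 7" "join G (p 2) (p 1) = l 1"
    "join G (p 7) (p 6) = l 6" "join G (p 2) (p 3) = l 2" "join G (p 6) (p 5) = l 5"
    "join G (p 4) (p 3) = l 3" "join G (p 4) (p 5) = l 4" "join G (p 7) (p 0) = l 7" "join G (p 3) (p 4) = l 3"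
    using join_labelled[OF lab, of 0] join_labelled[OF lab, of 1] join_labelled[OF lab, of 2]
      join_labelled[OF lab, of 3] join_labelled[OF lab, of 4] join_labelled[OF lab, of 5]
      join_labelled[OF lab, of 6] join_labelled[OF lab, of 7] unfolding suc by simp_all
  have col: "collinear G (p i) (p j)" if "i < 8" "j < 8" "i = Suc j mod 8 \<or> j = Suc i mod 8" for i j
  proof -
    have "p i \<in> points G" "p j \<in> points G" "l i \<in> lines G" "l j \<in> lines G" "i \<noteq> j"
      using points_labelled[OF lab] lines_labelled[OF lab] that by (auto simp: mod_Suc split: if_splits)
    then show ?thesis using p_eq[of i j] incG[of i j] incG[of j i] incG[of i i] incG[of j j] that
      unfolding collinear_def by blast
  qed
  have "{..<8::nat} = {2, 1, 0, 7, 6, 5, 4, 3}" by auto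
  then have "points G = p ` {2, 1, 0, 7, 6, 5, 4, 3}" using points_labelled[OF lab] by simp
  then have set: "set [p 2, p 1, p 0, p 7, p 6, p 5, p 4, p 3] = points G" by simp
  have dis: "distinct [p 2, p 1, p 0, p 7, p 6, p 5, p 4, p 3]" using p_eq by simp
  have ords: "|P 0| \<le>o s" "|P 1| \<le>o s"
    using part_ordLeq[OF ord(2,1), of "P 0"] part_ordLeq[OF ord(2,1), of "P 1"] on_K ne Pd[of 0 1] by auto
  \<comment> \<open>\<open>K\<close> lies over the line joining \<open>p 0\<close> and
    \<open>p 1\<close>, which become \<open>c\<close> and \<open>b\<close>. From there
    \<open>d\<close>, \<open>e\<close>, \<open>f'\<close> run backwards through \<open>p 7\<close>,
    \<open>p 6\<close>, \<open>p 5\<close>, and \<open>a\<close>, \<open>h\<close>,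
    \<open>g'\<close> forwards through \<open>p 2\<close>, \<open>p 3\<close>,
    \<open>p 4\<close>.\<close>
  show ?thesis
    unfolding class_a_def Let_def
    apply (rule exI[of _ "p 2"], rule exI[of _ "p 1"], rule exI[of _ "p 0"], rule exI[of _ "p 7"],
        rule exI[of _ "p 6"], rule exI[of _ "p 5"], rule exI[of _ "p 4"], rule exI[of _ "p 3"])
    apply (intro conjI dis set)
            apply (rule col; simp)+
    apply (rule bexI[OF _ K])
    apply (simp only: j P_def[symmetric] M_def[symmetric] near_def[symmetric] meets_def[symmetric])
    apply (intro conjI c1 c2 c3 c4 M0 ords cone_ordLeq ne)
    using on_K Pd[of 0 1] by auto
qed

section \<open>Constructions and classification\<close>

lemma elements_iff [simp]: "Inl x \<in> elements G \<longleftrightarrow> x \<in> points G"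
  "Inr L \<in> elements G \<longleftrightarrow> L \<in> lines G"
  by (auto simp: elements_def)

lemma pencil_dual [simp]: "lines_through (dual G) = points_on G" "points_on (dual G) = lines_through G"
  by (auto simp: fun_eq_iff lines_through_def points_on_def)

lemma nbs_of_point: "point_line_geometry G \<Longrightarrow> {v. gadj G (Inl x) v} = Inr ` lines_through G x"
  and nbs_of_line: "point_line_geometry G \<Longrightarrow> {v. gadj G (Inr L) v} = Inl ` points_on G L"
proof -
  assume G: "point_line_geometry G"
  have "gadj G (Inl x) v \<longleftrightarrow> v \<in> Inr ` lines_through G x" for v
    using G by (cases v) (auto simp: lines_through_def point_line_geometry_def)
  then show "{v. gadj G (Inl x) v} = Inr ` lines_through G x" by blast
  have "gadj G (Inr L) v \<longleftrightarrow> v \<in> Inl ` points_on G L" for v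
    using G by (cases v) (auto simp: points_on_def point_line_geometry_def)
  then show "{v. gadj G (Inr L) v} = Inl ` points_on G L" by blast
qed

section \<open>Duality, and ordinary polygons as the weak polygons with all valencies 2\<close>

lemma subgeometry_dual: "subgeometry (dual H) (dual G) \<longleftrightarrow> subgeometry H G"
  by (auto simp: subgeometry_def set_eq_iff)

lemma ordinary_gon_dual: "ordinary_gon k (dual G) \<longleftrightarrow> ordinary_gon k G"
proof -
  have "ordinary_gon k (dual G)" if "ordinary_gon k G" for G :: "('a, 'b) geometry"
    using that labelled_dual unfolding ordinary_gon_labelled by blast
  moreover have "ordinary_gon k (dual G)" if "ordinary_gon k G" for G :: "('b, 'a) geometry"
    using that labelled_dual unfolding ordinary_gon_labelled by blast
  ultimately show ?thesis by (metis dual_dual)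
qed

lemma weak_generalized_gon_dual:
  assumes "weak_generalized_gon m G"
  shows "weak_generalized_gon m (dual G)"
  unfolding weak_generalized_gon_def
proof (intro conjI ballI allI impI)
  define sw :: "'b + 'a \<Rightarrow> 'a + 'b" where "sw = case_sum Inr Inl"
  have sw: "sw x \<in> elements H \<longleftrightarrow> x \<in> elements (dual H)" for x and H :: "('a, 'b) geometry"
    by (cases x) (auto simp: sw_def elements_def)
  show "3 \<le> m" using assms by (simp add: weak_generalized_gon_def)
  show "point_line_geometry (dual G)"
    using assms by (auto simp: weak_generalized_gon_def point_line_geometry_def)
  show "elements (dual G) \<noteq> {}" using assms by (auto simp: weak_generalized_gon_def elements_def)
  fix x y assume "x \<in> elements (dual G)" "y \<in> elements (dual G)"
  then have "sw x \<in> elements G" "sw y \<in> elements G" by (simp_all add: sw)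
  then obtain H where "subgeometry H G" "ordinary_gon m H" "sw x \<in> elements H" "sw y \<in> elements H"
    using assms unfolding weak_generalized_gon_def by blast
  then show "\<exists>H. subgeometry H (dual G) \<and> ordinary_gon m H \<and> x \<in> elements H \<and> y \<in> elements H"
    by (intro exI[of _ "dual H"]) (simp add: subgeometry_dual ordinary_gon_dual sw)
next
  fix k H assume k: "2 \<le> k \<and> k < m"
  have "\<not> (subgeometry (dual H) G \<and> ordinary_gon k (dual H))"
    using assms k unfolding weak_generalized_gon_def by blast
  then show "\<not> (subgeometry H (dual G) \<and> ordinary_gon k H)"
    using subgeometry_dual[of H "dual G"] by (simp add: ordinary_gon_dual)
qed

lemma two_ordIso: "|A| =o cone +c cone \<longleftrightarrow> card A = 2"
proof
  assume "|A| =o cone +c cone"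
  then obtain h where "bij_betw h A (Field cone <+> {()})" by (rule csum_one_bij)
  then have "card A = card (Field cone <+> {()})" by (rule bij_betw_same_card)
  then show "card A = 2" by (simp add: cone_def Field_card_of card_Plus)
next
  assume A: "card A = 2"
  then have "finite A" by (simp add: card_ge_0_finite)
  moreover have "card ({()} <+> {()}) = 2" by (simp add: card_Plus)
  ultimately obtain h where "bij_betw h A ({()} <+> {()})"
    using A finite_same_card_bij[of A "{()} <+> {()}"] by auto
  then have "|A| =o |{()} <+> {()}|" using card_of_ordIso by blast
  then show "|A| =o cone +c cone" by (simp add: csum_def cone_def Field_card_of)
qed

lemma pencils_of_ordinary:
  assumes "ordinary_gon k G"
  shows "x \<in> points G \<Longrightarrow> card (lines_through G x) = 2" "L \<in> lines G \<Longrightarrow> card (points_on G L) = 2"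
proof -
  obtain p l where lab: "labelled k G p l" and k: "2 \<le> k"
    using assms unfolding ordinary_gon_labelled by blast
  note G = labelled_geometry[OF lab k]
  show "card (lines_through G x) = 2" if "x \<in> points G"
    using card_nbs[OF lab k, of "Inl x"] that nbs_of_point[OF G, of x]
    by (auto simp: elements_def card_image)
  show "card (points_on G L) = 2" if "L \<in> lines G"
    using card_nbs[OF lab k, of "Inr L"] that nbs_of_line[OF G, of L]
    by (auto simp: elements_def card_image)
qed

lemma card_nbs_2:
  assumes "point_line_geometry G" "\<And>x. x \<in> points G \<Longrightarrow> card (lines_through G x) = 2"
    "\<And>L. L \<in> lines G \<Longrightarrow> card (points_on G L) = 2" "u \<in> elements G"
  shows "card {v. gadj G u v} = 2"
  using assms by (cases u) (auto simp: nbs_of_point nbs_of_line elements_def card_image)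

text \<open>A smaller sub-polygon would be closed under walks by \<open>sub_gon_closed\<close>,
  hence contain all points, of which there are too many.\<close>

lemma weak_gon_of_ordinary:
  assumes "ordinary_gon m G" "3 \<le> m"
  shows "weak_generalized_gon m G"
proof -
  obtain p l where lab: "labelled m G p l" and m: "2 \<le> m"
    using assms unfolding ordinary_gon_labelled by blast
  note G = labelled_geometry[OF lab m]
  have self: "subgeometry G G" using G by (auto simp: subgeometry_def point_line_geometry_def)
  have "p 0 \<in> points G" using points_labelled[OF lab m] m by auto
  then have ne: "elements G \<noteq> {}" by (auto simp: elements_def)
  have "\<not> (subgeometry H G \<and> ordinary_gon k H)" if k: "2 \<le> k" "k < m" for k H
  proof
    assume H: "subgeometry H G \<and> ordinary_gon k H"
    then obtain p' l' where lab': "labelled k H p' l'" unfolding ordinary_gon_labelled by blast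
    have x: "Inl (p' 0) \<in> elements H" using points_labelled[OF lab' k(1)] k by (auto simp: elements_def)
    have "w \<in> elements H" if w: "w \<in> elements G" for w
    proof -
      have sub: "elements H \<subseteq> elements G" using H elements_sub by blast
      obtain i where "(gadj G ^^ i) (Inl (p' 0)) w" using walk_labelled[OF lab m] x sub w by blast
      then show ?thesis
        using sub_gon_closed[of H G k, OF _ _ _ x] H sub card_nbs[OF lab m] by blast
    qed
    then have "points G \<subseteq> points H" by (auto simp: elements_def)
    then have "points H = points G" using H by (auto simp: subgeometry_def)
    moreover have "card (points G) = m" "card (points H) = k"
      using lab lab' bij_betw_same_card by (fastforce simp: labelled_def)+
    ultimately show False using k by simp
  qed
  then show ?thesis using assms G self ne unfolding weak_generalized_gon_def by blast
qed

lemma thin_gon_of_ordinary: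
  assumes "ordinary_gon m G" "3 \<le> m"
  shows "thin_generalized_gon m G cone"
  using weak_gon_of_ordinary[OF assms] pencils_of_ordinary[OF assms(1)]
  by (simp add: thin_generalized_gon_def has_order_def two_ordIso)
    (simp add: cone_def card_of_Card_order ordLeq_refl)

text \<open>With all valencies 2, any sub m-gon is closed under walks, and walks reach
  everything.\<close>

lemma ordinary_of_weak_gon:
  assumes "weak_generalized_gon m G" "\<And>x. x \<in> points G \<Longrightarrow> card (lines_through G x) = 2"
    "\<And>L. L \<in> lines G \<Longrightarrow> card (points_on G L) = 2"
  shows "ordinary_gon m G"
proof -
  have G: "point_line_geometry G" using assms(1) by (simp add: weak_generalized_gon_def)
  obtain u where u: "u \<in> elements G" using assms(1) by (auto simp: weak_generalized_gon_def)
  then obtain H where H: "subgeometry H G" "ordinary_gon m H" "u \<in> elements H"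
    using assms(1) unfolding weak_generalized_gon_def by blast
  have sub: "elements H \<subseteq> elements G" using H(1) by (rule elements_sub)
  have "w \<in> elements H" if w: "w \<in> elements G" for w
  proof -
    obtain H' where H': "subgeometry H' G" "ordinary_gon m H'" "u \<in> elements H'" "w \<in> elements H'"
      using assms(1) u w unfolding weak_generalized_gon_def by blast
    obtain p l where lab: "labelled m H' p l" and m: "2 \<le> m"
      using H'(2) unfolding ordinary_gon_labelled by blast
    obtain i where i: "(gadj H' ^^ i) u w" using walk_labelled[OF lab m H'(3,4)] by blast
    have "(gadj G ^^ i) u w" using i
      by (induction i arbitrary: w)
        (auto elim!: relpowp_Suc_E intro!: relpowp_Suc_I gadj_sub[OF H'(1)])
    then show ?thesis
      using sub_gon_closed[OF H(1,2) _ H(3)] card_nbs_2[OF G assms(2,3)] sub by blast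
  qed
  then have "points G \<subseteq> points H" "lines G \<subseteq> lines H" by (auto simp: elements_def)
  then have "points H = points G" "lines H = lines G" "inc H = inc G"
    using H(1) G by (auto simp: subgeometry_def point_line_geometry_def)
  then show ?thesis using H(2) by (simp add: ordinary_gon_def)
qed

section \<open>From position maps back to epimorphisms\<close>

definition octagon :: "(nat, nat) geometry" where
  "octagon = \<lparr>points = {..<8}, lines = {..<8}, inc = {(i, i) | i. i < 8} \<union> {(Suc i mod 8, i) | i. i < 8}\<rparr>"

lemma ordinary_octagon: "ordinary_gon 8 octagon"
proof -
  have "labelled 8 octagon (\<lambda>i. i) (\<lambda>i. i)"
    by (simp add: labelled_def octagon_def bij_betw_def)
  then show ?thesis unfolding ordinary_gon_labelled by auto
qed

text \<open>The centre will be a line at position 0, so the parity is opposite to that of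
  \<open>lpos\<close>: line \<open>i\<close> sits at \<open>2 * i\<close> and point \<open>i\<close>
  at \<open>2 * i - 1\<close>. The last conclusion serves to recognise the fibre of the
  centre.\<close>

lemma epimorphism_of_wrap:
  assumes S: "point_line_geometry S" and "wrap (elements S) (gadj S) d \<phi>"
    and par: "\<And>u. u \<in> elements S \<Longrightarrow> odd (\<phi> u) \<longleftrightarrow> isl u"
  obtains f g where "epimorphism f g S octagon"
    "\<And>L M. L \<in> lines S \<Longrightarrow> M \<in> lines S \<Longrightarrow> g L = g M \<Longrightarrow> 16 dvd \<phi> (Inr L) - \<phi> (Inr M)"
proof -
  interpret wrap "elements S" "gadj S" d \<phi> by fact
  define f where "f x = nat ((\<phi> (Inl x) + 1) mod 16 div 2)" for x
  define g where "g L = nat (\<phi> (Inr L) mod 16 div 2)" for L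
  have half: "\<exists>a. z = 16 * a + 2 * int (nat (z mod 16 div 2))" "nat (z mod 16 div 2) < 8"
    if "even z" for z :: int
  proof -
    have "even (z mod 16)" using that by (simp add: dvd_mod_iff)
    then have "z mod 16 = 2 * int (nat (z mod 16 div 2))" by simp
    moreover have "z = 16 * (z div 16) + z mod 16" by simp
    ultimately show "\<exists>a. z = 16 * a + 2 * int (nat (z mod 16 div 2))" by metis
    have "z mod 16 < 16" by simp
    then show "nat (z mod 16 div 2) < 8" by linarith
  qed
  have f: "\<exists>a. \<phi> (Inl x) = 16 * a + 2 * int (f x) - 1" "f x < 8" if "x \<in> points S" for x
  proof -
    have "even (\<phi> (Inl x) + 1)" using par[of "Inl x"] that by (auto simp: elements_def)
    from half[OF this] show "\<exists>a. \<phi> (Inl x) = 16 * a + 2 * int (f x) - 1" "f x < 8"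
      unfolding f_def[symmetric] by (metis add_diff_cancel_right', simp)
  qed
  have g: "\<exists>a. \<phi> (Inr L) = 16 * a + 2 * int (g L)" "g L < 8" if "L \<in> lines S" for L
  proof -
    have "even (\<phi> (Inr L))" using par[of "Inr L"] that by (auto simp: elements_def)
    from half[OF this] show "\<exists>a. \<phi> (Inr L) = 16 * a + 2 * int (g L)" "g L < 8"
      unfolding g_def[symmetric] by simp_all
  qed
  have "(f x, g L) \<in> inc octagon" if xL: "(x, L) \<in> inc S" for x L
  proof -
    have V: "x \<in> points S" "L \<in> lines S" using S xL by (auto simp: point_line_geometry_def)
    obtain a where a: "\<phi> (Inl x) = 16 * a + 2 * int (f x) - 1" using f(1)[OF V(1)] by blast
    obtain b where b: "\<phi> (Inr L) = 16 * b + 2 * int (g L)" using g(1)[OF V(2)] by blast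
    have "16 dvd \<phi> (Inr L) - \<phi> (Inl x) - 1 \<or> 16 dvd \<phi> (Inr L) - \<phi> (Inl x) + 1"
      by (rule step) (simp add: xL)
    then obtain e where "\<phi> (Inr L) - \<phi> (Inl x) - 1 = 16 * e \<or> \<phi> (Inr L) - \<phi> (Inl x) + 1 = 16 * e"
      by (meson dvdE)
    then have "int (g L) - int (f x) = 8 * (e + a - b) \<or> int (g L) - int (f x) + 1 = 8 * (e + a - b)"
      unfolding a b by (rule disj_forward) (simp_all add: algebra_simps)
    then obtain q where "int (g L) - int (f x) = 8 * q \<or> int (g L) - int (f x) + 1 = 8 * q" by blast
    then have "g L = f x \<or> f x = Suc (g L) \<or> (f x = 0 \<and> g L = 7)"
      using f(2)[OF V(1)] g(2)[OF V(2)] by arith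
    then show ?thesis using f(2)[OF V(1)] g(2)[OF V(2)] by (auto simp: octagon_def mod_Suc)
  qed
  moreover have "i \<in> f ` points S" if "i < 8" for i
  proof -
    obtain u where u: "u \<in> elements S" "16 dvd \<phi> u - (2 * int i - 1)" using onto by blast
    then obtain e where e: "\<phi> u = 2 * int i - 1 + 16 * e" by (auto elim!: dvdE simp: algebra_simps)
    have "odd (\<phi> u)" unfolding e by simp
    then obtain x where x: "u = Inl x" "x \<in> points S" using par[OF u(1)] u(1) by (auto simp: elements_def)
    obtain a where "\<phi> (Inl x) = 16 * a + 2 * int (f x) - 1" using f(1)[OF x(2)] by blast
    then have "int (f x) - int i = 8 * (e - a)" using e x(1) by simp
    then obtain q where "int (f x) - int i = 8 * q" by blast
    then have "f x = i" using f(2)[OF x(2)] that by arith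
    then show ?thesis using x(2) by blast
  qed
  moreover have "i \<in> g ` lines S" if "i < 8" for i
  proof -
    obtain u where u: "u \<in> elements S" "16 dvd \<phi> u - 2 * int i" using onto by blast
    then obtain e where e: "\<phi> u = 2 * int i + 16 * e" by (auto elim!: dvdE simp: algebra_simps)
    have "even (\<phi> u)" unfolding e by simp
    then obtain L where L: "u = Inr L" "L \<in> lines S" using par[OF u(1)] u(1) by (auto simp: elements_def)
    obtain a where "\<phi> (Inr L) = 16 * a + 2 * int (g L)" using g(1)[OF L(2)] by blast
    then have "int (g L) - int i = 8 * (e - a)" using e L(1) by simp
    then obtain q where "int (g L) - int i = 8 * q" by blast
    then have "g L = i" using g(2)[OF L(2)] that by arith
    then show ?thesis using L(2) by blast
  qed
  moreover have "points octagon = {..<8}" "lines octagon = {..<8}" by (simp_all add: octagon_def)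
  ultimately have "epimorphism f g S octagon"
    using f(2) g(2) by (auto simp: epimorphism_def morphism_def image_subset_iff)
  moreover have "16 dvd \<phi> (Inr L) - \<phi> (Inr M)" if LM: "L \<in> lines S" "M \<in> lines S" "g L = g M" for L M
  proof -
    obtain a b where "\<phi> (Inr L) = 16 * a + 2 * int (g L)" "\<phi> (Inr M) = 16 * b + 2 * int (g M)"
      using g(1) LM(1,2) by blast
    then have "\<phi> (Inr L) - \<phi> (Inr M) = 16 * (a - b)" using LM(3) by simp
    then show ?thesis by simp
  qed
  ultimately show thesis using that by blast
qed

lemma ex_class_a:
  assumes S: "weak_generalized_gon 8 S" and K: "K \<in> lines S"
    and ord: "Card_order s" "|points_on S K| =o s +c cone"
  obtains f g where "epimorphism f g S octagon" "class_a S octagon s f g"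
proof -
  interpret polygon 8 "elements S" "gadj S" "gdist S" by (rule polygon_of_weak_gon[OF S])
  have G: "point_line_geometry S" using S by (simp add: weak_generalized_gon_def)
  have KV: "Inr K \<in> elements S" using K by (auto simp: elements_def)
  obtain v v' where v: "gadj S (Inr K) v" "gadj S (Inr K) v'" "v \<noteq> v'" using two_neighbours[OF KV] by blast
  \<comment> \<open>Any splitting into two nonempty sides would do; one point against the rest
    always exists.\<close>
  interpret C: centred "elements S" "gadj S" "gdist S" "Inr K" "{v}" "nbs (Inr K) - {v}"
    by unfold_locales (use v KV in \<open>auto simp: nbs_def\<close>)
  have par: "odd (C.pos u) \<longleftrightarrow> isl u" if "u \<in> elements S" for u
  proof -
    have "even (C.pos u) \<longleftrightarrow> even (gdist S u (Inr K))" by (simp add: C.pos_def)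
    then show ?thesis using gdist_parity[OF S that KV] by simp
  qed
  obtain f g where fg: "epimorphism f g S octagon"
    "\<And>L M. L \<in> lines S \<Longrightarrow> M \<in> lines S \<Longrightarrow> g L = g M \<Longrightarrow> 16 dvd C.pos (Inr L) - C.pos (Inr M)"
    using epimorphism_of_wrap[OF G C.wrap_pos par] by blast
  have "M = K" if M: "M \<in> lines S" "g M = g K" for M
  proof -
    have "C.pos (Inr K) = 0" using C.abs_pos[of "Inr K"] d_eq_0[OF KV KV] by simp
    then have "16 dvd C.pos (Inr M)" using fg(2)[OF M(1) K M(2)] by simp
    then show ?thesis using C.pos_centre[of "Inr M"] M(1) by (auto simp: elements_def)
  qed
  then have "class_a S octagon s f g"
    using class_a_of_singleton[OF S ordinary_octagon fg(1) K _ ord] by blast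
  then show thesis using that fg(1) by blast
qed

section \<open>Exclusion of larger orders of the target, and the classification\<close>

lemma finite_order:
  assumes "|A| =o r +c cone" "finite (Field r)"
  shows "finite A \<and> card A = Suc (card (Field r))"
proof -
  obtain h where h: "bij_betw h A (Field r <+> {()})" using csum_one_bij[OF assms(1)] .
  have "card A = Suc (card (Field r))"
    using bij_betw_same_card[OF h] assms(2) by (simp add: card_Plus)
  moreover have "finite A" using bij_betw_finite[OF h] assms(2) by simp
  ultimately show ?thesis by blast
qed

lemma thick_element:
  assumes "weak_generalized_gon m S" "thick S" "u \<in> elements S"
  shows "\<exists>X\<subseteq>{v. gadj S u v}. card X = 3"
proof -
  have S: "point_line_geometry S" using assms(1) by (simp add: weak_generalized_gon_def)
  show ?thesis
  proof (cases u)
    case (Inl x)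
    then obtain X where "X \<subseteq> lines_through S x" "card X = 3"
      using assms(2,3) by (auto simp: thick_def elements_def)
    then show ?thesis using nbs_of_point[OF S, of x] Inl
      by (intro exI[of _ "Inr ` X"]) (auto simp: card_image)
  next
    case (Inr L)
    then obtain X where "X \<subseteq> points_on S L" "card X = 3"
      using assms(2,3) by (auto simp: thick_def elements_def)
    then show ?thesis using nbs_of_line[OF S, of L] Inr
      by (intro exI[of _ "Inl ` X"]) (auto simp: card_image)
  qed
qed

text \<open>The position map of \<open>D\<close> centred at another point \<open>b\<close> of
  \<open>g M\<close>, with that line alone on the positive side, puts \<open>x\<close> over 2 and
  both lines over 1. The composed map has a singleton fibre; by surjectivity its image is one in
  \<open>D\<close>, hence over -1, 0 or 1. From there upwards, lower neighbours are unique.\<close>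

lemma line_over_unique:
  assumes S: "weak_generalized_gon 8 S" "thick S"
    and T: "\<And>x. x \<in> points S \<Longrightarrow> finite (lines_through S x) \<and> card (lines_through S x) = T"
    and D: "weak_generalized_gon 8 D" and three: "\<And>L. L \<in> lines D \<Longrightarrow> \<exists>X\<subseteq>points_on D L. card X = 3"
    and epi: "epimorphism f g S D"
    and M: "(x, M) \<in> inc S" "(x, M') \<in> inc S" "g M = g M'"
  shows "M = M'"
proof -
  interpret D: polygon 8 "elements D" "gadj D" "gdist D" by (rule polygon_of_weak_gon[OF D])
  interpret S: polygon 8 "elements S" "gadj S" "gdist S" by (rule polygon_of_weak_gon[OF S(1)])
  have gS: "point_line_geometry S" and gD: "point_line_geometry D"
    using S(1) D by (simp_all add: weak_generalized_gon_def)
  define L where "L = g M"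
  have xM: "x \<in> points S" "M \<in> lines S" "M' \<in> lines S" using gS M by (auto simp: point_line_geometry_def)
  have fL: "(f x, L) \<in> inc D" using gadj_map[OF S(1) epi, of "Inl x" "Inr M"] M(1) by (simp add: L_def)
  then have LD: "L \<in> lines D" using gD by (auto simp: point_line_geometry_def)
  obtain X where X: "X \<subseteq> points_on D L" "card X = 3" using three[OF LD] by blast
  have "\<not> X \<subseteq> {f x}" using X(2) card_mono[of "{f x}" X] by auto
  then obtain b where b: "b \<in> points D" "(b, L) \<in> inc D" "b \<noteq> f x" using X(1) by (auto simp: points_on_def)
  have bV: "Inl b \<in> elements D" using b by (auto simp: elements_def)
  obtain v v' where v: "gadj D (Inl b) v" "gadj D (Inl b) v'" "v \<noteq> v'" using D.two_neighbours[OF bV] by blast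
  interpret C: centred "elements D" "gadj D" "gdist D" "Inl b" "{Inr L}" "D.nbs (Inl b) - {Inr L}"
    by unfold_locales (use v b bV in \<open>auto simp: D.nbs_def\<close>)
  interpret W: wrap "elements D" "gadj D" "gdist D" C.pos by (rule C.wrap_pos)
  define h where "h = map_sum f g"
  have h_el: "h u \<in> elements D" if "u \<in> elements S" for u
    using that epi by (auto simp: h_def elements_def epimorphism_def)
  have h_onto: "\<exists>u\<in>elements S. h u = w" if "w \<in> elements D" for w
  proof (cases w)
    case (Inl y)
    then have "y \<in> f ` points S" using that epi by (auto simp: elements_def epimorphism_def)
    then obtain z where "z \<in> points S" "f z = y" by blast
    then show ?thesis using Inl by (intro bexI[of _ "Inl z"]) (auto simp: h_def elements_def)
  next
    case (Inr N)
    then have "N \<in> g ` lines S" using that epi by (auto simp: elements_def epimorphism_def)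
    then obtain N' where "N' \<in> lines S" "g N' = N" by blast
    then show ?thesis using Inr by (intro bexI[of _ "Inr N'"]) (auto simp: h_def elements_def)
  qed
  interpret TW: thick_wrap "elements S" "gadj S" "gdist S" "\<lambda>u. C.pos (h u)"
  proof
    show "16 dvd C.pos (h v) - C.pos (h u) - 1 \<or> 16 dvd C.pos (h v) - C.pos (h u) + 1" if "gadj S u v" for u v
      unfolding h_def by (rule C.pos_step[OF gadj_map[OF S(1) epi that]])
    show "\<exists>u\<in>elements S. 16 dvd C.pos (h u) - i" for i
      using C.pos_onto[of i] h_onto by metis
    show "\<exists>X\<subseteq>{v. gadj S u v}. card X = 3" if "u \<in> elements S" for u
      by (rule thick_element[OF S that])
  qed
  have fib: "u \<in> TW.F i \<longleftrightarrow> u \<in> elements S \<and> h u \<in> W.F i" for u i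
    using h_el by (auto simp: TW.F_def W.F_def)
  have par: "even i \<longleftrightarrow> isl w" if w: "w \<in> W.F i" for w i
  proof -
    have wD: "w \<in> elements D" and "16 dvd C.pos w - i" using w by (auto simp: W.F_def)
    then have "even (C.pos w - i)" by (elim dvd_trans[rotated]) simp
    then have "even i \<longleftrightarrow> even (C.pos w)" by simp
    also have "\<dots> \<longleftrightarrow> even (gdist D w (Inl b))" by (simp add: C.pos_def)
    finally show ?thesis using gdist_parity[OF D wD bV] by simp
  qed
  have deg: "finite (S.nbs u) \<and> card (S.nbs u) = T" if "even i" "u \<in> TW.F i" for i u
  proof -
    have "u \<in> elements S" "isl (h u)" using that fib par by blast+
    then have "isl u" "u \<in> elements S" by (cases u; simp add: h_def)+
    then obtain y where y: "u = Inl y" "y \<in> points S" by (auto simp: elements_def)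
    then show ?thesis using T[OF y(2)] nbs_of_point[OF gS, of y]
      by (simp add: S.nbs_def card_image)
  qed
  obtain j c where c: "TW.F j = {c}" using TW.singleton_fibre[of T] deg by blast
  have Wj: "W.F j = {h c}"
  proof
    show "{h c} \<subseteq> W.F j" using c fib by blast
    show "W.F j \<subseteq> {h c}"
    proof
      fix w assume w: "w \<in> W.F j"
      then obtain u where "u \<in> elements S" "h u = w" using h_onto W.F_V by blast
      then have "u \<in> TW.F j" using fib w by simp
      then show "w \<in> {h c}" using c \<open>h u = w\<close> by simp
    qed
  qed
  have W0: "W.F 0 = {Inl b}" using C.pos_centre bV by (auto simp: W.F_def)
  have W3: "\<exists>X\<subseteq>D.nbs w. card X = 3" if w: "odd i" "w \<in> W.F i" for i w
  proof -
    have "\<not> isl w" "w \<in> elements D" using par w W.F_V by auto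
    then obtain N where N: "w = Inr N" "N \<in> lines D" by (auto simp: elements_def)
    obtain X where "X \<subseteq> points_on D N" "card X = 3" using three[OF N(2)] by blast
    then show ?thesis using nbs_of_line[OF gD, of N] N(1)
      by (intro exI[of _ "Inl ` X"]) (auto simp: D.nbs_def card_image)
  qed
  have "\<exists>i\<in>{-1, 0, 1}. W.F i = {h c}" by (rule W.singleton_near_centre[OF W0 W3 Wj])
  then obtain i where i: "i \<in> {-1, 0, 1}" "W.F i = {h c}" by blast
  have TWi: "TW.F i = {c}"
  proof -
    have "u \<in> TW.F i \<longleftrightarrow> u \<in> TW.F j" for u using fib i(2) Wj by simp
    then show ?thesis using c by blast
  qed
  have "Inr L \<in> W.F 1" using C.pos_N1[of "Inr L"] LD by (simp add: W.F_def)
  then have "Inl (f x) \<in> W.F 2 \<or> Inl (f x) \<in> W.F 0" using W.F_step[of "Inr L" 1 "Inl (f x)"] fL by simp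
  then have x2: "Inl x \<in> TW.F 2" using W0 b(3) fib[of "Inl x" 2] xM(1) by (auto simp: h_def)
  have M1: "Inr N \<in> TW.F 1" if "N \<in> lines S" "g N = L" for N
    using fib[of "Inr N" 1] \<open>Inr L \<in> W.F 1\<close> that by (auto simp: h_def)
  \<comment> \<open>The number of steps from the singleton fibre up to position 2, thus 1, 2 or
    3.\<close>
  define k where "k = nat (2 - i)"
  have k: "1 \<le> k" "k \<le> 7" "i + int k = 2" "i + int k - 1 = 1" using i(1) by (auto simp: k_def)
  have "Inr M = (Inr M' :: 'a + 'b)"
    using TW.down_unique_of_singleton[OF TWi k(1,2), of "Inl x" "Inr M" "Inr M'"] k(3,4) x2 M1 xM M
    by (simp add: L_def)
  then show ?thesis by simp
qed

text \<open>By \<open>line_over_unique\<close>, three lines through a point keep distinct images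
  through the image point, which is on only two lines.\<close>

lemma no_epimorphism_onto_thick_lines:
  assumes S: "weak_generalized_gon 8 S" "thick S"
    and T: "\<And>x. x \<in> points S \<Longrightarrow> finite (lines_through S x) \<and> card (lines_through S x) = T"
    and D: "weak_generalized_gon 8 D" and two: "\<And>x. x \<in> points D \<Longrightarrow> card (lines_through D x) = 2"
    and three: "\<And>L. L \<in> lines D \<Longrightarrow> \<exists>X\<subseteq>points_on D L. card X = 3"
  shows "\<not> epimorphism f g S D"
proof
  assume epi: "epimorphism f g S D"
  have "points S \<noteq> {}"
  proof
    assume p: "points S = {}"
    then obtain L where "L \<in> lines S" using S(1) by (auto simp: weak_generalized_gon_def elements_def)
    then obtain X where "X \<subseteq> points_on S L" "card X = 3" using S(2) unfolding thick_def by blast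
    then show False using p by (auto simp: points_on_def)
  qed
  then obtain x where x: "x \<in> points S" by blast
  then obtain X where X: "X \<subseteq> lines_through S x" "card X = 3" using S(2) unfolding thick_def by blast
  have "inj_on g X"
  proof (rule inj_onI)
    fix M M' assume "M \<in> X" "M' \<in> X" "g M = g M'"
    moreover from this have "(x, M) \<in> inc S" "(x, M') \<in> inc S" using X(1) by (auto simp: lines_through_def)
    ultimately show "M = M'" using line_over_unique[OF S T D three epi] by blast
  qed
  then have "card (g ` X) = 3" using X(2) by (simp add: card_image)
  moreover have "g ` X \<subseteq> lines_through D (f x)"
    using X(1) x epi by (auto simp: lines_through_def epimorphism_def morphism_def)
  moreover have "f x \<in> points D" using x epi by (auto simp: epimorphism_def)
  then have "card (lines_through D (f x)) = 2" by (rule two)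
  moreover from this have "finite (lines_through D (f x))" by (simp add: card_ge_0_finite)
  ultimately show False using card_mono[of "lines_through D (f x)" "g ` X"] by simp
qed

lemma ordinary_classes:
  assumes S: "weak_generalized_gon 8 S" "thick S" and ord: "has_order S s t" and t: "finite (Field t)"
    and D: "ordinary_gon 8 D" and epi: "epimorphism f g S D"
  shows "class_a S D s f g \<or> class_b S D t f g"
proof -
  obtain p l where lab: "labelled 8 D p l" using D unfolding ordinary_gon_labelled by blast
  have gS: "point_line_geometry S" using S(1) by (simp add: weak_generalized_gon_def)
  interpret wrap "elements S" "gadj S" "gdist S" "\<lambda>u. lpos p l (map_sum f g u)"
    by (rule wrap_lpos[OF lab S(1) epi])
  interpret thick_wrap "elements S" "gadj S" "gdist S" "\<lambda>u. lpos p l (map_sum f g u)"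
    by unfold_locales (rule thick_element[OF S])
  have deg: "finite (nbs u) \<and> card (nbs u) = Suc (card (Field t))" if "even i" "u \<in> F i" for i u
  proof -
    have uS: "u \<in> elements S" and "16 dvd lpos p l (map_sum f g u) - i" using that(2) by (auto simp: F_def)
    then have "even (lpos p l (map_sum f g u) - i)" by (elim dvd_trans[rotated]) simp
    then have ev: "even (lpos p l (map_sum f g u))" using that(1) by simp
    have "\<exists>y. u = Inl y \<and> y \<in> points S"
    proof (cases u)
      case (Inr L)
      then show ?thesis using ev by (simp add: lpos_def[OF lab])
    qed (use uS in \<open>auto simp: elements_def\<close>)
    then obtain y where y: "u = Inl y" "y \<in> points S" by blast
    have "finite (lines_through S y) \<and> card (lines_through S y) = Suc (card (Field t))"
      using finite_order[OF _ t] ord y(2) unfolding has_order_def by blast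
    then show ?thesis using nbs_of_point[OF gS, of y] y(1) by (simp add: nbs_def card_image)
  qed
  obtain j c where c: "F j = {c}" using singleton_fibre[of "Suc (card (Field t))"] deg by blast
  have cS: "c \<in> elements S" using c F_V by blast
  have single: "u = c" if "u \<in> elements S" "map_sum f g u = map_sum f g c" for u
  proof -
    have "c \<in> F j" using c by simp
    then have "16 dvd lpos p l (map_sum f g u) - j" unfolding F_def that(2) by blast
    then have "u \<in> F j" unfolding F_def using that(1) by blast
    then show ?thesis using c by simp
  qed
  show ?thesis
  proof (cases c)
    case (Inr K)
    have "M = K" if "M \<in> lines S" "g M = g K" for M
      using single[of "Inr M"] that Inr by simp
    moreover have "K \<in> lines S" using cS Inr by (auto simp: elements_def)
    ultimately have "class_a S D s f g"
      using class_a_of_singleton[OF S(1) D epi] ord unfolding has_order_def by blast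
    then show ?thesis ..
  next
    case (Inl x)
    have "y = x" if "y \<in> points S" "f y = f x" for y
      using single[of "Inl y"] that Inl by simp
    moreover have "x \<in> points S" using cS Inl by (auto simp: elements_def)
    moreover have "ordinary_gon 8 (dual D)" "epimorphism g f (dual S) (dual D)"
      using D epi by (simp_all add: ordinary_gon_dual epimorphism_dual)
    ultimately have "class_a (dual S) (dual D) t g f"
      using class_a_of_singleton[OF weak_generalized_gon_dual[OF S(1)], of "dual D" g f x t] ord
      unfolding has_order_def by simp
    then show ?thesis by (simp add: class_b_def)
  qed
qed

text \<open>If \<open>Field r\<close> is not a singleton, two of its elements together with the
  added one yield three.\<close>

lemma order_one_or_three:
  assumes "Card_order r" "cone \<le>o r"
  shows "r =o cone \<or> (\<forall>A. |A| =o r +c cone \<longrightarrow> (\<exists>X\<subseteq>A. card X = 3))"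
proof (cases "\<exists>a b. a \<in> Field r \<and> b \<in> Field r \<and> a \<noteq> b")
  case True
  then obtain a b where ab: "a \<in> Field r" "b \<in> Field r" "a \<noteq> b" by blast
  have "\<exists>X\<subseteq>A. card X = 3" if A: "|A| =o r +c cone" for A :: "'b set"
  proof -
    obtain h where h: "bij_betw h A (Field r <+> {()})" using csum_one_bij[OF A] .
    define Y where "Y = {Inl a, Inl b, Inr ()}"
    have Y: "Y \<subseteq> h ` A" "card Y = 3" using ab h by (auto simp: Y_def bij_betw_def)
    then obtain X where "X \<subseteq> A" "Y = h ` X" by (meson subset_imageE)
    moreover have "inj_on h X" using h \<open>X \<subseteq> A\<close> inj_on_subset by (auto simp: bij_betw_def)
    ultimately show ?thesis using Y(2) card_image by metis
  qed
  then show ?thesis by blast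
next
  case False
  have r: "|Field r| =o r" by (rule card_of_Field_ordIso[OF assms(1)])
  have "Field r \<noteq> {}"
  proof
    assume e: "Field r = {}"
    have "cone \<le>o |Field r|" using assms(2) r ordIso_symmetric ordLeq_ordIso_trans by blast
    then have "|{()}| \<le>o |{} :: 'a set|" unfolding cone_def e .
    then show False using card_of_empty3 by blast
  qed
  then obtain a where "Field r = {a}" using False by blast
  then have "bij_betw (\<lambda>_. a) {()} (Field r)" by (simp add: bij_betw_def)
  then have "|{()}| =o |Field r|" by (rule card_of_ordIsoI)
  then show ?thesis using r ordIso_symmetric ordIso_transitive unfolding cone_def by blast
qed

theorem corollary4p2:
  fixes \<Gamma> :: "('p, 'l) geometry" and s :: "'s rel" and t :: "'t rel"
  assumes "locally_finite_gon 8 \<Gamma> s t"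
    and "finite (Field t)"
  shows
    "(\<forall>(\<Delta> :: ('q, 'm) geometry) (s' :: 'u rel) \<phi> \<psi>.
        thin_generalized_gon 8 \<Delta> s' \<and> epimorphism \<phi> \<psi> \<Gamma> \<Delta> \<longrightarrow>
        s' =o cone \<and> ordinary_gon 8 \<Delta> \<and> (class_a \<Gamma> \<Delta> s \<phi> \<psi> \<or> class_b \<Gamma> \<Delta> t \<phi> \<psi>)) \<and>
     (\<exists>(\<Delta> :: (nat, nat) geometry) \<phi> \<psi>.
        thin_generalized_gon 8 \<Delta> cone \<and> ordinary_gon 8 \<Delta> \<and> epimorphism \<phi> \<psi> \<Gamma> \<Delta> \<and>
        class_a \<Gamma> \<Delta> s \<phi> \<psi>) \<and>
     (\<exists>(\<Delta> :: (nat, nat) geometry) \<phi> \<psi>.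
        thin_generalized_gon 8 \<Delta> cone \<and> ordinary_gon 8 \<Delta> \<and> epimorphism \<phi> \<psi> \<Gamma> \<Delta> \<and>
        class_b \<Gamma> \<Delta> t \<phi> \<psi>)"
proof (intro conjI allI impI)
  have S: "weak_generalized_gon 8 \<Gamma>" "thick \<Gamma>" and ord: "has_order \<Gamma> s t"
    using assms(1) by (auto simp: locally_finite_gon_def thick_generalized_gon_def)
  have T: "finite (lines_through \<Gamma> x) \<and> card (lines_through \<Gamma> x) = Suc (card (Field t))"
    if "x \<in> points \<Gamma>" for x
    using finite_order[OF _ assms(2)] ord that unfolding has_order_def by blast
  {
    fix \<Delta> :: "('q, 'm) geometry" and s' :: "'u rel" and \<phi> \<psi>
    assume a: "thin_generalized_gon 8 \<Delta> s' \<and> epimorphism \<phi> \<psi> \<Gamma> \<Delta>"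
    then have D: "weak_generalized_gon 8 \<Delta>" and epi: "epimorphism \<phi> \<psi> \<Gamma> \<Delta>"
      and dord: "has_order \<Delta> s' cone" "cone \<le>o s'" by (auto simp: thin_generalized_gon_def)
    have two: "card (lines_through \<Delta> x) = 2" if "x \<in> points \<Delta>" for x
      using dord(1) that two_ordIso unfolding has_order_def by blast
    show s': "s' =o cone"
    proof (rule ccontr)
      assume "\<not> s' =o cone"
      then have "\<exists>X\<subseteq>points_on \<Delta> L. card X = 3" if "L \<in> lines \<Delta>" for L
        using order_one_or_three[of s'] dord that unfolding has_order_def by blast
      then show False using no_epimorphism_onto_thick_lines[OF S T D two] epi by blast
    qed
    have "card (points_on \<Delta> L) = 2" if L: "L \<in> lines \<Delta>" for L
    proof -
      have "|points_on \<Delta> L| =o s' +c cone" using dord(1) L unfolding has_order_def by blast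
      also have "s' +c cone =o cone +c cone" by (rule csum_cong1[OF s'])
      finally show ?thesis unfolding two_ordIso .
    qed
    then show ord8: "ordinary_gon 8 \<Delta>" by (intro ordinary_of_weak_gon[OF D two])
    show "class_a \<Gamma> \<Delta> s \<phi> \<psi> \<or> class_b \<Gamma> \<Delta> t \<phi> \<psi>"
      by (rule ordinary_classes[OF S ord assms(2) ord8 epi])
  }
  obtain u where "u \<in> elements \<Gamma>" using S(1) by (auto simp: weak_generalized_gon_def)
  then obtain v where "gadj \<Gamma> u v"
    using polygon.two_neighbours[OF polygon_of_weak_gon[OF S(1)]] by blast
  then obtain x L where "(x, L) \<in> inc \<Gamma>" by (cases u; cases v) auto
  then have x: "x \<in> points \<Gamma>" and L: "L \<in> lines \<Gamma>"
    using S(1) by (auto simp: weak_generalized_gon_def point_line_geometry_def)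
  obtain \<phi> \<psi> where "epimorphism \<phi> \<psi> \<Gamma> octagon" "class_a \<Gamma> octagon s \<phi> \<psi>"
    using ex_class_a[OF S(1) L, of s] ord L unfolding has_order_def by blast
  then show "\<exists>(\<Delta> :: (nat, nat) geometry) \<phi> \<psi>. thin_generalized_gon 8 \<Delta> cone \<and> ordinary_gon 8 \<Delta> \<and>
      epimorphism \<phi> \<psi> \<Gamma> \<Delta> \<and> class_a \<Gamma> \<Delta> s \<phi> \<psi>"
    using thin_gon_of_ordinary[OF ordinary_octagon] ordinary_octagon by auto
  \<comment> \<open>The point \<open>x\<close> is a line of the dual, so the construction for class
    (a) applies there with \<open>x\<close> as centre; dualising the result gives class (b).\<close>
  obtain \<psi> \<phi> where e: "epimorphism \<psi> \<phi> (dual \<Gamma>) octagon" "class_a (dual \<Gamma>) octagon t \<psi> \<phi>"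
    using ex_class_a[OF weak_generalized_gon_dual[OF S(1)], of x t] ord x unfolding has_order_def by auto
  have "epimorphism \<phi> \<psi> \<Gamma> (dual octagon)" using e(1) epimorphism_dual[of \<phi> \<psi> "dual \<Gamma>" octagon] by simp
  moreover have "class_b \<Gamma> (dual octagon) t \<phi> \<psi>" using e(2) by (simp add: class_b_def)
  moreover have o: "ordinary_gon 8 (dual octagon)" by (simp add: ordinary_gon_dual ordinary_octagon)
  moreover have "thin_generalized_gon 8 (dual octagon) cone" by (rule thin_gon_of_ordinary[OF o]) simp
  ultimately show "\<exists>(\<Delta> :: (nat, nat) geometry) \<phi> \<psi>. thin_generalized_gon 8 \<Delta> cone \<and> ordinary_gon 8 \<Delta> \<and>
      epimorphism \<phi> \<psi> \<Gamma> \<Delta> \<and> class_b \<Gamma> \<Delta> t \<phi> \<psi>"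
    by blast
qed

end
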